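(* Let $G$ be a graph on $n$ vertices. Then $$\operatorname{reg}(R/J_{G}) \leq \operatorname{ht}(J_{G}).$$
   Context: Graphs are finite and simple (no loops, no multiple edges). $V(G)$ and $E(G)$ denote the vertex and edge sets of $G$. Let $\Bbbk$ be any field. For a graph $G$ on $n$ vertices, labelled $1,\dots,n$, let $R = \Bbbk[x_1,\dots,x_n,y_1,\dots,y_n]$ with the standard grading. The binomial edge ideal of $G$ is $J_G = (x_i y_j - x_j y_i \mid \{i,j\} \in E(G)) \subseteq R$. $\operatorname{reg}$ denotes the Castelnuovo--Mumford regularity of a finitely generated graded $R$-module, and $\operatorname{ht}$ denotes the height of an ideal of $R$. *)

theory Defs
  imports
    "HOL-Library.Poly_Mapping"
    "HOL-Library.Extended_Nat"
    "HOL-Library.Extended_Real"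
    "HOL-Algebra.Module"
    "HOL-Algebra.QuotRing"
    "Jordan_Normal_Form.Matrix"
begin

section \<open>Polynomial rings with the standard grading\<close>

text \<open>
  A polynomial is a finitely supported map from monomials to coefficients, and a monomial is a
  finitely supported map from variables to exponents. The ring \<open>k[X]\<close> for a set \<open>X\<close> of variables
  is a carrier inside this type, so that the number of variables is a parameter and may be \<open>0\<close>.
\<close>

type_synonym 'x monom = "'x \<Rightarrow>\<^sub>0 nat"
type_synonym ('x, 'k) mpoly = "'x monom \<Rightarrow>\<^sub>0 'k"

definition var :: "'x \<Rightarrow> ('x, 'k::field) mpoly" where
  "var v = Poly_Mapping.single (Poly_Mapping.single v 1) 1"

definition poly_ring :: "'x set \<Rightarrow> ('x, 'k::field) mpoly ring" where
  "poly_ring X = \<lparr>carrier = {p. \<forall>m \<in> Poly_Mapping.keys p. Poly_Mapping.keys m \<subseteq> X},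
     monoid.mult = (*), one = 1, zero = 0, add = (+)\<rparr>"

definition monom_degree :: "'x monom \<Rightarrow> nat" where
  "monom_degree m = (\<Sum>v \<in> Poly_Mapping.keys m. Poly_Mapping.lookup m v)"

definition homogeneous_part :: "'x set \<Rightarrow> int \<Rightarrow> ('x, 'k::field) mpoly set" where
  "homogeneous_part X d =
     {p \<in> carrier (poly_ring X). \<forall>m \<in> Poly_Mapping.keys p. int (monom_degree m) = d}"

lemma cring_poly_ring: "cring (poly_ring X :: ('x, 'k::field) mpoly ring)"
proof (rule cringI)
  show "abelian_group (poly_ring X :: ('x, 'k) mpoly ring)"
  proof (rule abelian_groupI)
    fix p :: "('x, 'k) mpoly"
    assume "p \<in> carrier (poly_ring X)"
    then have "- p \<in> carrier (poly_ring X)" "- p \<oplus>\<^bsub>poly_ring X\<^esub> p = \<zero>\<^bsub>poly_ring X\<^esub>"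
      by (auto simp: poly_ring_def)
    then show "\<exists>q\<in>carrier (poly_ring X). q \<oplus>\<^bsub>poly_ring X\<^esub> p = \<zero>\<^bsub>poly_ring X\<^esub>" ..
  next
    fix p q :: "('x, 'k) mpoly"
    assume "p \<in> carrier (poly_ring X)" "q \<in> carrier (poly_ring X)"
    then show "p \<oplus>\<^bsub>poly_ring X\<^esub> q \<in> carrier (poly_ring X)"
      using Poly_Mapping.keys_add[of p q] by (fastforce simp: poly_ring_def)
  qed (auto simp: poly_ring_def algebra_simps)
next
  show "comm_monoid (poly_ring X :: ('x, 'k) mpoly ring)"
  proof (rule comm_monoidI)
    fix p q :: "('x, 'k) mpoly"
    assume pq: "p \<in> carrier (poly_ring X)" "q \<in> carrier (poly_ring X)"
    have "Poly_Mapping.keys m \<subseteq> X" if m: "m \<in> Poly_Mapping.keys (p * q)" for m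
    proof -
      from m obtain a b where "m = a + b" "a \<in> Poly_Mapping.keys p" "b \<in> Poly_Mapping.keys q"
        using Poly_Mapping.keys_mult[of p q] by blast
      then show ?thesis
        using pq Poly_Mapping.keys_add[of a b] by (fastforce simp: poly_ring_def)
    qed
    then show "p \<otimes>\<^bsub>poly_ring X\<^esub> q \<in> carrier (poly_ring X)"
      by (simp add: poly_ring_def)
  qed (auto simp: poly_ring_def algebra_simps)
qed (auto simp: poly_ring_def algebra_simps)


section \<open>Height of an ideal\<close>

definition prime_height :: "('a, 'b) ring_scheme \<Rightarrow> 'a set \<Rightarrow> enat" where
  "prime_height R P =
     Sup {enat l | l. \<exists>C :: nat \<Rightarrow> 'a set.
       (\<forall>i\<le>l. primeideal (C i) R) \<and> (\<forall>i<l. C i \<subset> C (Suc i)) \<and> C l = P}"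

definition ideal_height :: "('a, 'b) ring_scheme \<Rightarrow> 'a set \<Rightarrow> enat" where
  "ideal_height R I = Inf {prime_height R P | P. primeideal P R \<and> I \<subseteq> P}"


section \<open>The graded module \<open>R/I\<close>\<close>

definition quotient_module :: "('a, 'b) ring_scheme \<Rightarrow> 'a set \<Rightarrow> ('a, 'a set) module" where
  "quotient_module R I =
     \<lparr>carrier = carrier (R Quot I), monoid.mult = monoid.mult (R Quot I), one = one (R Quot I),
      zero = zero (R Quot I), add = add (R Quot I),
      smult = (\<lambda>a c. (I +>\<^bsub>R\<^esub> a) \<otimes>\<^bsub>R Quot I\<^esub> c)\<rparr>"

definition quotient_grading ::
    "'x set \<Rightarrow> ('x, 'k::field) mpoly set \<Rightarrow> int \<Rightarrow> ('x, 'k) mpoly set set" where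
  "quotient_grading X I d = (\<lambda>p. I +>\<^bsub>poly_ring X\<^esub> p) ` homogeneous_part X d"

lemma (in ideal) module_quotient_module:
  assumes "cring R"
  shows "module R (quotient_module R I)"
proof -
  interpret Q: cring "R Quot I"
    by (rule quotient_is_cring[OF assms])
  interpret h: ring_hom_ring R "R Quot I" "(+>) I"
    by (rule rcos_ring_hom_ring)
  have *: "abelian_group (quotient_module R I)"
    by (rule abelian_groupI)
      (use Q.add.l_inv_ex in \<open>auto simp: quotient_module_def Q.a_assoc intro!: Q.a_comm\<close>)
  show ?thesis
    by (rule moduleI[OF assms *])
      (simp_all add: quotient_module_def Q.l_distr Q.r_distr Q.m_assoc)
qed


section \<open>Castelnuovo--Mumford regularity\<close>

definition free_module :: "'x set \<Rightarrow> nat \<Rightarrow> ('x, 'k::field) mpoly vec set" where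
  "free_module X r = {v \<in> carrier_vec r. \<forall>k<r. v $ k \<in> carrier (poly_ring X)}"

definition augmentation ::
    "nat \<Rightarrow> (nat \<Rightarrow> 'm) \<Rightarrow> (('x, 'k::field) mpoly, 'm) module
       \<Rightarrow> ('x, 'k) mpoly vec \<Rightarrow> 'm" where
  "augmentation r g M v = finsum M (\<lambda>k. (v $ k) \<odot>\<^bsub>M\<^esub> g k) {..<r}"

text \<open>
  Minimal graded free resolutions of a graded module \<open>M\<close> over \<open>R = k[X]\<close>, where \<open>gr d\<close> is the
  component of \<open>M\<close> in degree \<open>d\<close>. The \<open>i\<close>-th free module is the sum of the \<open>R(- deg i k)\<close> for
  \<open>k < r i\<close>; so its \<open>k\<close>-th basis element has degree \<open>deg i k\<close>. The differential from the \<open>i + 1\<close>-st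
  to the \<open>i\<close>-th free module is multiplication by the matrix \<open>A i\<close>, and the augmentation sends the
  \<open>k\<close>-th basis element of the \<open>0\<close>-th free module to \<open>g k\<close>. All these maps are homogeneous of
  degree \<open>0\<close>. Minimality says that the entries of the matrices lie in the ideal generated by the
  variables, that is, have constant coefficient \<open>0\<close>. Finite resolutions have \<open>r i = 0\<close> for
  large \<open>i\<close>.
\<close>

definition minimal_graded_free_resolution ::
    "'x set \<Rightarrow> (('x, 'k::field) mpoly, 'm) module \<Rightarrow> (int \<Rightarrow> 'm set)
       \<Rightarrow> (nat \<Rightarrow> nat) \<Rightarrow> (nat \<Rightarrow> nat \<Rightarrow> int) \<Rightarrow> (nat \<Rightarrow> 'm) \<Rightarrow> (nat \<Rightarrow> ('x, 'k) mpoly mat) \<Rightarrow> bool"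
  where
  "minimal_graded_free_resolution X M gr r deg g A \<longleftrightarrow>
     (\<forall>k < r 0. g k \<in> gr (deg 0 k)) \<and>
     (\<forall>i. A i \<in> carrier_mat (r i) (r (Suc i)) \<and>
        (\<forall>j < r i. \<forall>k < r (Suc i).
           A i $$ (j, k) \<in> homogeneous_part X (deg (Suc i) k - deg i j) \<and>
           Poly_Mapping.lookup (A i $$ (j, k)) 0 = 0)) \<and>
     augmentation (r 0) g M ` free_module X (r 0) = carrier M \<and>
     {v \<in> free_module X (r 0). augmentation (r 0) g M v = \<zero>\<^bsub>M\<^esub>}
       = (*\<^sub>v) (A 0) ` free_module X (r 1) \<and>
     (\<forall>i. {v \<in> free_module X (r (Suc i)). A i *\<^sub>v v = 0\<^sub>v (r i)}
       = (*\<^sub>v) (A (Suc i)) ` free_module X (r (Suc (Suc i))))"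

text \<open>
  The regularity of \<open>M\<close> is the largest value of \<open>deg i k - i\<close> over the generators of a minimal
  graded free resolution. For finite \<open>X\<close> and finitely generated graded \<open>M\<close> such a resolution
  exists, and any two are isomorphic; so the supremum below, which is taken over all of them, is
  the value for any one of them. The regularity of the zero module is \<open>-\<infinity>\<close>.
\<close>

definition regularity ::
    "'x set \<Rightarrow> (('x, 'k::field) mpoly, 'm) module \<Rightarrow> (int \<Rightarrow> 'm set) \<Rightarrow> ereal" where
  "regularity X M gr =
     Sup {ereal (real_of_int (deg i k - int i)) | r deg g A i k.
       minimal_graded_free_resolution X M gr r deg g A \<and> k < r i}"


section \<open>Binomial edge ideals\<close>

definition simple_graph :: "'v set \<Rightarrow> 'v set set \<Rightarrow> bool" where
  "simple_graph V E \<longleftrightarrow> finite V \<and> (\<forall>e \<in> E. e \<subseteq> V \<and> card e = 2)"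

datatype 'v edge_var = XVar 'v | YVar 'v

definition edge_vars :: "'v set \<Rightarrow> 'v edge_var set" where
  "edge_vars V = XVar ` V \<union> YVar ` V"

definition binomial_edge_ideal :: "'v set \<Rightarrow> 'v set set \<Rightarrow> ('v edge_var, 'k::field) mpoly set" where
  "binomial_edge_ideal V E =
     Idl\<^bsub>poly_ring (edge_vars V)\<^esub>
       {var (XVar i) * var (YVar j) - var (XVar j) * var (YVar i) | i j. {i, j} \<in> E}"

end

theory Submission
  imports Defs
begin

text \<open>
  Regularity is bounded through Koszul homology: a generator of degree \<open>d\<close> in homological degree
  \<open>i\<close> of a minimal resolution of \<open>R/J\<close> gives, by a zigzag through resolution and Koszul complex,
  a nonzero class in \<open>H\<^sub>i(R/J)\<^sub>d\<close>.

  For a vertex \<open>v\<close> of \<open>G\<close> let \<open>G\<^sub>v\<close> be \<open>G\<close> with the neighbourhood of \<open>v\<close> completed to a clique. Then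
  \<open>J\<^sub>G\<close> is the intersection of \<open>J\<close> of \<open>G\<^sub>v\<close> with \<open>(x\<^sub>v, y\<^sub>v) + J\<close> of \<open>G - v\<close> (Ohtani), so that a
  Mayer-Vietoris argument bounds the regularity of \<open>G\<close> by those of \<open>G\<^sub>v\<close> and \<open>G - v\<close>, and by that of
  \<open>G\<^sub>v - v\<close> plus \<open>1\<close>. By induction this gives: if the edges of \<open>G\<close> are covered by blocks
  \<open>B\<^sub>1, ..., B\<^sub>c\<close> partitioning the vertices, by \<open>t\<close> cliques and by \<open>q\<close> stars, then the regularity is
  at most \<open>\<Sum> (card B\<^sub>i - 1) + t + 2 q\<close>.

  A prime \<open>P\<close> above \<open>J\<^sub>G\<close> provides such a cover: the stars are centred at the vertices with
  \<open>x\<^sub>v, y\<^sub>v \<in> P\<close>, and two other vertices are in the same block if their minor is in \<open>P\<close>. The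
  resulting bound is the height of the prime generated by these variables and minors, which is
  contained in \<open>P\<close>.
\<close>

text \<open>\<open>regularity\<close> is a supremum over all minimal resolutions, so it suffices to
  bound the degrees in each given one. With Koszul cycles modulo \<open>J\<close> the long exact
  sequences become explicit manipulations of chains, valid over any field. The bound must survive
  both completion and deletion; a cover by blocks, cliques and stars does, a formula in
  \<open>G\<close> alone need not. The prices are forced by Mayer-Vietoris, where
  \<open>G\<^sub>v - v\<close> must do better by \<open>1\<close>. Completing at the centre of a
  star trades it for one clique, so a star costs \<open>2\<close>, which is also what
  \<open>x\<^sub>v, y\<^sub>v\<close> contribute to the height. At any other vertex the saving must
  come from a block that loses a vertex or from cliques that merge. The recursion ends when all
  closed neighbourhoods are cliques. There the ideal is prime and its regularity is at most the
  number of components with an edge; this is shown by passing to the quotient by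
  \<open>x\<^sub>v\<close>, where the ideal is again an intersection. Heights are compared one prime
  \<open>P\<close> at a time, by an explicit descending chain of prime ideals.\<close>

abbreviation keys where "keys \<equiv> Poly_Mapping.keys"
abbreviation lookup where "lookup \<equiv> Poly_Mapping.lookup"
abbreviation single where "single \<equiv> Poly_Mapping.single"

section \<open>Carriers of polynomial rings\<close>

abbreviation polys :: "'x set \<Rightarrow> ('x, 'k::field) mpoly set" where
  "polys X \<equiv> carrier (poly_ring X)"

lemma polys_iff: "p \<in> polys X \<longleftrightarrow> (\<forall>m \<in> keys p. keys m \<subseteq> X)"
  by (simp add: poly_ring_def)

lemma poly_ring_sel [simp]:
  "p \<otimes>\<^bsub>poly_ring X\<^esub> q = p * q" "p \<oplus>\<^bsub>poly_ring X\<^esub> q = p + q"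
  "\<zero>\<^bsub>poly_ring X\<^esub> = 0" "\<one>\<^bsub>poly_ring X\<^esub> = 1"
  by (simp_all add: poly_ring_def)

lemma polys_zero [simp, intro]: "0 \<in> polys X"
  and polys_one [simp, intro]: "1 \<in> polys X"
  by (auto simp: polys_iff)

lemma polys_add [intro]: "p \<in> polys X \<Longrightarrow> q \<in> polys X \<Longrightarrow> p + q \<in> polys X"
  using cring.cring_simprules(1)[OF cring_poly_ring, of p X q] by simp

lemma polys_mult [intro]: "p \<in> polys X \<Longrightarrow> q \<in> polys X \<Longrightarrow> p * q \<in> polys X"
  using cring.cring_simprules(5)[OF cring_poly_ring, of p X q] by simp

lemma polys_uminus [intro]: "p \<in> polys X \<Longrightarrow> - p \<in> polys X"
  by (simp add: polys_iff)

lemma polys_diff [intro]: "p \<in> polys X \<Longrightarrow> q \<in> polys X \<Longrightarrow> p - q \<in> polys X"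
  using polys_add[of p X "- q"] polys_uminus[of q X] by simp

lemma polys_single [intro]: "keys m \<subseteq> X \<Longrightarrow> single m c \<in> polys X"
  by (simp add: polys_iff)

lemma polys_var [intro]: "v \<in> X \<Longrightarrow> var v \<in> polys X"
  by (auto simp: polys_iff var_def)

lemma polys_sum [intro]: "(\<And>i. i \<in> S \<Longrightarrow> f i \<in> polys X) \<Longrightarrow> sum f S \<in> polys X"
  by (induction S rule: infinite_finite_induct) auto

lemma poly_ring_a_inv [simp]: "p \<in> polys X \<Longrightarrow> \<ominus>\<^bsub>poly_ring X\<^esub> p = - p"
proof -
  assume p: "p \<in> polys X"
  interpret cring "poly_ring X" by (rule cring_poly_ring)
  show ?thesis
    using minus_equality[of "- p" p] p polys_uminus[of p X] by simp
qed

lemma poly_mapping_sum_single: "(p :: 'm \<Rightarrow>\<^sub>0 'a::comm_monoid_add) = (\<Sum>m\<in>keys p. single m (lookup p m))"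
  by (rule poly_mapping_eqI)
     (simp add: lookup_sum lookup_single when_def in_keys_iff sum.delta)

text \<open>Additive induction over the terms of \<open>p\<close>. Only terms of \<open>p\<close>
  itself have to be checked, so facts about its support, such as membership in
  \<open>polys X\<close>, stay available for them.\<close>

lemma poly_mapping_closure:
  fixes p :: "'m \<Rightarrow>\<^sub>0 'a::comm_monoid_add"
  assumes "Q 0" "\<And>p q. Q p \<Longrightarrow> Q q \<Longrightarrow> Q (p + q)"
    and "\<And>m. m \<in> keys p \<Longrightarrow> Q (single m (lookup p m))"
  shows "Q p"
proof -
  have "Q (\<Sum>m\<in>S. single m (lookup p m))" if "finite S" "S \<subseteq> keys p" for S
    using that by (induction S rule: finite_induct) (auto intro: assms)
  from this[of "keys p"] show ?thesis
    using poly_mapping_sum_single[of p] by simp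
qed

lemma keys_add_monom: "keys (m + n) = keys m \<union> keys (n :: 'x monom)"
  by (auto simp: in_keys_iff lookup_add)

section \<open>Ideals of polynomial rings\<close>

lemma ideal_poly_ringI:
  assumes "I \<subseteq> polys X" "0 \<in> I" "\<And>p q. p \<in> I \<Longrightarrow> q \<in> I \<Longrightarrow> p + q \<in> I"
    and "\<And>p r. p \<in> I \<Longrightarrow> r \<in> polys X \<Longrightarrow> r * p \<in> I"
  shows "ideal I (poly_ring X :: ('x, 'k::field) mpoly ring)"
proof (rule idealI)
  show "ring (poly_ring X :: ('x, 'k) mpoly ring)"
    using cring_poly_ring by (rule cring.axioms)
  then interpret ring "poly_ring X :: ('x, 'k) mpoly ring" .
  show "subgroup I (add_monoid (poly_ring X :: ('x, 'k) mpoly ring))"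
  proof (rule subgroup.intro)
    fix p assume "p \<in> I"
    then have "- 1 * p \<in> I" using assms(4)[of p "- 1"] by blast
    moreover have "inv\<^bsub>add_monoid (poly_ring X)\<^esub> p = - p"
      using \<open>p \<in> I\<close> assms(1) poly_ring_a_inv[of p X] by (auto simp: a_inv_def)
    ultimately show "inv\<^bsub>add_monoid (poly_ring X)\<^esub> p \<in> I" by simp
  qed (use assms in auto)
qed (use assms in \<open>auto simp: mult.commute\<close>)

context
  fixes X :: "'x set" and I :: "('x, 'k::field) mpoly set"
  assumes I: "ideal I (poly_ring X)"
begin

interpretation ideal I "poly_ring X" by (rule I)

lemma ideal_polys: "p \<in> I \<Longrightarrow> p \<in> polys X"
  using a_subset by auto

lemma ideal_zero: "0 \<in> I"
  using additive_subgroup.zero_closed[OF is_additive_subgroup] by simp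

lemma ideal_add: "p \<in> I \<Longrightarrow> q \<in> I \<Longrightarrow> p + q \<in> I"
  using additive_subgroup.a_closed[OF is_additive_subgroup, of p q] by simp

lemma ideal_mult: "p \<in> I \<Longrightarrow> r \<in> polys X \<Longrightarrow> r * p \<in> I"
  using I_l_closed by simp

lemma ideal_mult': "p \<in> I \<Longrightarrow> r \<in> polys X \<Longrightarrow> p * r \<in> I"
  using I_r_closed by simp

lemma ideal_uminus: "p \<in> I \<Longrightarrow> - p \<in> I"
  using ideal_mult[of p "- 1"] by (simp add: polys_uminus)

lemma ideal_diff: "p \<in> I \<Longrightarrow> q \<in> I \<Longrightarrow> p - q \<in> I"
  using ideal_add[of p "- q"] ideal_uminus[of q] by simp

lemma ideal_sum: "(\<And>i. i \<in> S \<Longrightarrow> f i \<in> I) \<Longrightarrow> sum f S \<in> I"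
  by (induction S rule: infinite_finite_induct) (auto intro: ideal_zero ideal_add)

lemma ideal_cong: "p - q \<in> I \<Longrightarrow> q \<in> I \<Longrightarrow> p \<in> I"
  using ideal_add[of "p - q" q] by simp

end

abbreviation gen_ideal :: "'x set \<Rightarrow> ('x, 'k::field) mpoly set \<Rightarrow> ('x, 'k) mpoly set" where
  "gen_ideal X B \<equiv> Idl\<^bsub>poly_ring X\<^esub> B"

lemma gen_ideal_ideal: "B \<subseteq> polys X \<Longrightarrow> ideal (gen_ideal X B) (poly_ring X)"
  using ring.genideal_ideal[OF cring.axioms(1)[OF cring_poly_ring]] .

lemma gen_ideal_base: "b \<in> B \<Longrightarrow> b \<in> gen_ideal X B"
  unfolding genideal_def by blast

lemma gen_ideal_subset: "ideal I (poly_ring X) \<Longrightarrow> B \<subseteq> I \<Longrightarrow> gen_ideal X B \<subseteq> I"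
  using ring.genideal_minimal[OF cring.axioms(1)[OF cring_poly_ring]] by blast

lemma gen_ideal_mono: "A \<subseteq> B \<Longrightarrow> gen_ideal X A \<subseteq> gen_ideal X B"
  unfolding genideal_def by blast

text \<open>\<open>Q\<close> need not be stable under multiplication, but the polynomials all of
  whose multiples satisfy \<open>Q\<close> form an ideal, and it contains \<open>B\<close>.\<close>

lemma gen_ideal_induct [consumes 2, case_names mult zero add]:
  fixes B :: "('x, 'k::field) mpoly set"
  assumes B: "B \<subseteq> polys X" and p: "p \<in> gen_ideal X B"
    and mult: "\<And>h b. h \<in> polys X \<Longrightarrow> b \<in> B \<Longrightarrow> Q (h * b)"
    and zero: "Q 0" and add: "\<And>p q. Q p \<Longrightarrow> Q q \<Longrightarrow> Q (p + q)"
  shows "Q p"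
proof -
  let ?I = "{p \<in> polys X. \<forall>r \<in> polys X. Q (r * p)}"
  have "ideal ?I (poly_ring X)"
  proof (rule ideal_poly_ringI)
    fix p r :: "('x, 'k) mpoly" assume "p \<in> ?I" "r \<in> polys X"
    then show "r * p \<in> ?I"
      by (auto simp: mult.assoc[symmetric] simp del: mult.assoc)
  qed (use zero add in \<open>auto simp: distrib_left\<close>)
  then have "gen_ideal X B \<subseteq> ?I"
    by (rule gen_ideal_subset) (use B mult in auto)
  with p have "Q (1 * p)" by blast
  then show ?thesis by simp
qed

section \<open>Sums of ideals\<close>

definition ideal_plus :: "('x, 'k::field) mpoly set \<Rightarrow> ('x, 'k) mpoly set \<Rightarrow> ('x, 'k) mpoly set" where
  "ideal_plus I J = {p + q | p q. p \<in> I \<and> q \<in> J}"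

lemma ideal_plus_ideal:
  fixes I J :: "('x, 'k::field) mpoly set"
  assumes "ideal I (poly_ring X)" "ideal J (poly_ring X)"
  shows "ideal (ideal_plus I J) (poly_ring X)"
proof (rule ideal_poly_ringI)
  show "0 \<in> ideal_plus I J"
    using ideal_zero[OF assms(1)] ideal_zero[OF assms(2)] by (force simp: ideal_plus_def)
next
  fix p q assume "p \<in> ideal_plus I J" "q \<in> ideal_plus I J"
  then obtain a b c d where "p = a + b" "q = c + d" "a \<in> I" "b \<in> J" "c \<in> I" "d \<in> J"
    by (auto simp: ideal_plus_def)
  then have "p + q = (a + c) + (b + d)" "a + c \<in> I" "b + d \<in> J"
    using ideal_add[OF assms(1)] ideal_add[OF assms(2)] by auto
  then show "p + q \<in> ideal_plus I J" unfolding ideal_plus_def by blast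
next
  fix p r :: "('x, 'k) mpoly" assume "p \<in> ideal_plus I J" "r \<in> polys X"
  then obtain a b where "p = a + b" "a \<in> I" "b \<in> J"
    by (auto simp: ideal_plus_def)
  then have "r * p = r * a + r * b" "r * a \<in> I" "r * b \<in> J"
    using ideal_mult[OF assms(1)] ideal_mult[OF assms(2)] \<open>r \<in> _\<close> by (auto simp: distrib_left)
  then show "r * p \<in> ideal_plus I J" unfolding ideal_plus_def by blast
qed (use ideal_polys[OF assms(1)] ideal_polys[OF assms(2)] in \<open>auto simp: ideal_plus_def\<close>)

lemma ideal_plusI1: "ideal J (poly_ring X) \<Longrightarrow> p \<in> I \<Longrightarrow> p \<in> ideal_plus I J"
  using ideal_zero[of J X] by (force simp: ideal_plus_def)

lemma ideal_plusI2: "ideal I (poly_ring X) \<Longrightarrow> p \<in> J \<Longrightarrow> p \<in> ideal_plus I J"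
  using ideal_zero[of I X] by (force simp: ideal_plus_def)

lemma ideal_plus_subset:
  "ideal K (poly_ring X) \<Longrightarrow> I \<subseteq> K \<Longrightarrow> J \<subseteq> K \<Longrightarrow> ideal_plus I J \<subseteq> K"
  using ideal_add[of K X] by (force simp: ideal_plus_def)

lemma gen_ideal_Un:
  assumes "A \<subseteq> polys X" "B \<subseteq> polys X"
  shows "gen_ideal X (A \<union> B) = ideal_plus (gen_ideal X A) (gen_ideal X B)"
proof
  have iA: "ideal (gen_ideal X A) (poly_ring X)" and iB: "ideal (gen_ideal X B) (poly_ring X)"
    using assms by (simp_all add: gen_ideal_ideal)
  show "gen_ideal X (A \<union> B) \<subseteq> ideal_plus (gen_ideal X A) (gen_ideal X B)"
    by (rule gen_ideal_subset[OF ideal_plus_ideal[OF iA iB]])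
       (auto intro: ideal_plusI1[OF iB] ideal_plusI2[OF iA] gen_ideal_base)
  show "ideal_plus (gen_ideal X A) (gen_ideal X B) \<subseteq> gen_ideal X (A \<union> B)"
    by (rule ideal_plus_subset[OF gen_ideal_ideal]) (use assms in \<open>auto intro: subsetD[OF gen_ideal_mono]\<close>)
qed

section \<open>Homogeneous components\<close>

definition restrict_monoms :: "('m \<Rightarrow> bool) \<Rightarrow> ('m \<Rightarrow>\<^sub>0 'k::zero) \<Rightarrow> ('m \<Rightarrow>\<^sub>0 'k)" where
  "restrict_monoms P p = Poly_Mapping.mapp (\<lambda>m c. if P m then c else 0) p"

lemma lookup_restrict_monoms: "lookup (restrict_monoms P p) m = (if P m then lookup p m else 0)"
  by (simp add: restrict_monoms_def lookup_mapp in_keys_iff when_def)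

lemma keys_restrict_monoms: "keys (restrict_monoms P p) = {m \<in> keys p. P m}"
  by (auto simp: in_keys_iff lookup_restrict_monoms split: if_splits)

lemma restrict_monoms_zero [simp]: "restrict_monoms P 0 = 0"
  by (rule poly_mapping_eqI) (simp add: lookup_restrict_monoms)

lemma restrict_monoms_add: "restrict_monoms P (p + q) = restrict_monoms P p + restrict_monoms P q"
  by (rule poly_mapping_eqI) (simp add: lookup_restrict_monoms lookup_add)

lemma restrict_monoms_diff:
  "restrict_monoms P (p - q) = restrict_monoms P p - restrict_monoms P (q :: 'm \<Rightarrow>\<^sub>0 'k::ab_group_add)"
  by (rule poly_mapping_eqI) (simp add: lookup_restrict_monoms lookup_minus)

lemma restrict_monoms_single: "restrict_monoms P (single m c) = (if P m then single m c else 0)"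
  by (rule poly_mapping_eqI) (auto simp: lookup_restrict_monoms lookup_single when_def)

lemma restrict_monoms_polys: "p \<in> polys X \<Longrightarrow> restrict_monoms P p \<in> polys X"
  by (auto simp: polys_iff keys_restrict_monoms)

lemma restrict_monoms_id: "(\<And>m. m \<in> keys p \<Longrightarrow> P m) \<Longrightarrow> restrict_monoms P p = p"
  by (rule poly_mapping_eqI) (auto simp: lookup_restrict_monoms in_keys_iff)

text \<open>In a product with a term of \<open>b\<close>, the condition \<open>P\<close> must be
  decided by the other factor alone. This covers homogeneous components of multiples of a
  homogeneous \<open>b\<close> as well as setting the variables of a vertex to
  \<open>0\<close>.\<close>

lemma restrict_monoms_mult:
  fixes h b :: "'m::comm_monoid_add \<Rightarrow>\<^sub>0 'k::comm_ring_1"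
  assumes "\<And>m a. a \<in> keys b \<Longrightarrow> P (m + a) \<longleftrightarrow> Q m"
  shows "restrict_monoms P (h * b) = restrict_monoms Q h * b"
proof -
  have "restrict_monoms P (single m c * b) = (if Q m then single m c * b else 0)" for m c
  proof -
    show ?thesis
    proof (rule poly_mapping_closure[where p = b])
      fix n assume "n \<in> keys b"
      then have "P (m + n) \<longleftrightarrow> Q m" using assms by blast
      then show "restrict_monoms P (single m c * single n (lookup b n)) =
          (if Q m then single m c * single n (lookup b n) else 0)"
        by (simp add: mult_single restrict_monoms_single)
    qed (auto simp: distrib_left restrict_monoms_add)
  qed
  then have *: "restrict_monoms P (single m c * b) = restrict_monoms Q (single m c) * b" for m c
    by (simp add: restrict_monoms_single)
  show ?thesis
    by (rule poly_mapping_closure[where p = h])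
       (simp_all add: * distrib_right restrict_monoms_add)
qed

lemma monom_degree_add: "monom_degree (m + n) = monom_degree m + monom_degree n"
  unfolding monom_degree_def by (rule setsum_keys_plus_distrib) auto

lemma monom_degree_zero [simp]: "monom_degree 0 = 0"
  by (simp add: monom_degree_def)

lemma monom_degree_single [simp]: "monom_degree (single v n) = n"
  by (simp add: monom_degree_def)

lemma monom_degree_eq_0: "monom_degree m = 0 \<longleftrightarrow> m = 0"
  by (auto simp: monom_degree_def in_keys_iff poly_mapping_eq_iff fun_eq_iff)

lemma homogeneous_polys: "p \<in> homogeneous_part X d \<Longrightarrow> p \<in> polys X"
  by (simp add: homogeneous_part_def)

lemma homogeneous_zero [simp, intro]: "0 \<in> homogeneous_part X d"
  by (simp add: homogeneous_part_def)

lemma homogeneous_add [intro]: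
  "p \<in> homogeneous_part X d \<Longrightarrow> q \<in> homogeneous_part X d \<Longrightarrow> p + q \<in> homogeneous_part X d"
  using Poly_Mapping.keys_add[of p q] by (auto simp: homogeneous_part_def)

lemma homogeneous_uminus [intro]: "p \<in> homogeneous_part X d \<Longrightarrow> - p \<in> homogeneous_part X d"
  by (auto simp: homogeneous_part_def)

lemma homogeneous_diff [intro]:
  "p \<in> homogeneous_part X d \<Longrightarrow> q \<in> homogeneous_part X d \<Longrightarrow> p - q \<in> homogeneous_part X d"
  using homogeneous_add[of p X d "- q"] homogeneous_uminus[of q X d] by simp

lemma homogeneous_sum [intro]:
  "(\<And>i. i \<in> S \<Longrightarrow> f i \<in> homogeneous_part X d) \<Longrightarrow> sum f S \<in> homogeneous_part X d"
  by (induction S rule: infinite_finite_induct) auto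

lemma homogeneous_mult:
  assumes "p \<in> homogeneous_part X d" "q \<in> homogeneous_part X e"
  shows "p * q \<in> homogeneous_part X (d + e)"
proof -
  have "int (monom_degree m) = d + e" if m: "m \<in> keys (p * q)" for m
  proof -
    from m obtain a b where "m = a + b" "a \<in> keys p" "b \<in> keys q"
      using Poly_Mapping.keys_mult[of p q] by blast
    then show ?thesis using assms by (auto simp: homogeneous_part_def monom_degree_add)
  qed
  then show ?thesis using assms by (auto simp: homogeneous_part_def)
qed

lemma homogeneous_var [intro]: "v \<in> X \<Longrightarrow> var v \<in> homogeneous_part X 1"
  using polys_var[of v X] by (auto simp: homogeneous_part_def var_def)

definition hcomp :: "int \<Rightarrow> ('x, 'k::field) mpoly \<Rightarrow> ('x, 'k) mpoly" where
  "hcomp d = restrict_monoms (\<lambda>m. int (monom_degree m) = d)"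

lemma hcomp_homogeneous: "p \<in> polys X \<Longrightarrow> hcomp d p \<in> homogeneous_part X d"
  by (auto simp: homogeneous_part_def hcomp_def keys_restrict_monoms intro: restrict_monoms_polys)

lemma hcomp_id: "p \<in> homogeneous_part X d \<Longrightarrow> hcomp d p = p"
  unfolding hcomp_def by (rule restrict_monoms_id) (auto simp: homogeneous_part_def)

lemma hcomp_zero [simp]: "hcomp d 0 = 0"
  by (simp add: hcomp_def)

lemma hcomp_add: "hcomp d (p + q) = hcomp d p + hcomp d q"
  by (simp add: hcomp_def restrict_monoms_add)

lemma hcomp_diff: "hcomp d (p - q) = hcomp d p - hcomp d q"
  by (simp add: hcomp_def restrict_monoms_diff)

lemma hcomp_sum: "hcomp d (sum f S) = (\<Sum>i\<in>S. hcomp d (f i))"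
  by (induction S rule: infinite_finite_induct) (auto simp: hcomp_add)

lemma hcomp_mult:
  assumes "b \<in> homogeneous_part X e"
  shows "hcomp d (h * b) = hcomp (d - e) h * b"
  unfolding hcomp_def
  by (rule restrict_monoms_mult) (use assms in \<open>auto simp: homogeneous_part_def monom_degree_add\<close>)

definition homogeneous_ideal :: "'x set \<Rightarrow> ('x, 'k::field) mpoly set \<Rightarrow> bool" where
  "homogeneous_ideal X I \<longleftrightarrow> ideal I (poly_ring X) \<and> (\<forall>p\<in>I. \<forall>d. hcomp d p \<in> I)"

lemma homogeneous_ideal_gen:
  assumes "\<And>b. b \<in> B \<Longrightarrow> \<exists>e. b \<in> homogeneous_part X e"
  shows "homogeneous_ideal X (gen_ideal X B)"
proof -
  have B: "B \<subseteq> polys X"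
    using assms homogeneous_polys by blast
  note I = gen_ideal_ideal[OF B]
  have "hcomp d p \<in> gen_ideal X B" if "p \<in> gen_ideal X B" for p d
    using B that
  proof (induction rule: gen_ideal_induct)
    case (mult h b)
    then obtain e where "b \<in> homogeneous_part X e" using assms by blast
    then show ?case
      using mult by (auto simp: hcomp_mult gen_ideal_base hcomp_homogeneous homogeneous_polys
          intro!: ideal_mult[OF I] intro: homogeneous_polys hcomp_homogeneous)
  qed (auto simp: hcomp_add intro: ideal_zero[OF I] ideal_add[OF I])
  with I show ?thesis by (simp add: homogeneous_ideal_def)
qed

section \<open>The Koszul complex\<close>

text \<open>The sign of moving \<open>v\<close> to its sorted place in the wedge product over
  \<open>T\<close>; this is what the linear order on the variables is for.\<close>

definition koszul_sign :: "'x::linorder \<Rightarrow> 'x set \<Rightarrow> ('x, 'k::field) mpoly" where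
  "koszul_sign v T = (- 1) ^ card {u \<in> T. u < v}"

text \<open>
  An element of the Koszul complex of \<open>k[X]\<close> is given by its coefficients \<open>c T\<close> at the wedge
  products of the basis vectors in \<open>T \<subseteq> X\<close>; only the \<open>T\<close> with \<open>card T = i\<close> matter for chains in
  homological degree \<open>i\<close>.
\<close>

definition koszul ::
    "'x::linorder set \<Rightarrow> ('x set \<Rightarrow> ('x, 'k::field) mpoly) \<Rightarrow> 'x set \<Rightarrow> ('x, 'k) mpoly" where
  "koszul X c T = (\<Sum>v\<in>X - T. koszul_sign v T * var v * c (insert v T))"

text \<open>Coefficients of the exterior product of the basis vector of \<open>z\<close> with
  \<open>c\<close>.\<close>

definition koszul_homotopy ::
    "'x::linorder \<Rightarrow> ('x set \<Rightarrow> ('x, 'k::field) mpoly) \<Rightarrow> 'x set \<Rightarrow> ('x, 'k) mpoly" where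
  "koszul_homotopy z c T = (if z \<in> T then koszul_sign z (T - {z}) * c (T - {z}) else 0)"

lemma koszul_sign_sq: "koszul_sign v T * koszul_sign v T = 1"
  by (simp add: koszul_sign_def flip: power_add mult_2 power_mult)

lemma koszul_sign_polys [intro]: "koszul_sign v T \<in> polys X"
proof -
  have "(- 1) ^ n \<in> polys X" for n
    by (induction n) (auto simp: polys_uminus)
  then show ?thesis by (simp add: koszul_sign_def)
qed

lemma koszul_sign_mult: "koszul_sign v T * p = p \<or> koszul_sign v T * p = - p"
  unfolding koszul_sign_def by (cases "even (card {u \<in> T. u < v})") auto

text \<open>Inserting the smaller of \<open>v\<close> and \<open>w\<close> changes the count for the
  larger one by \<open>1\<close>, while the larger one is not counted for the smaller.\<close>

lemma koszul_sign_swap: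
  assumes "finite T" "v \<noteq> w" "v \<notin> T" "w \<notin> T"
  shows "koszul_sign v T * koszul_sign w (insert v T) =
    - (koszul_sign w T * (koszul_sign v (insert w T) :: ('a::linorder, 'b::field) mpoly))"
proof -
  have *: "koszul_sign v T * koszul_sign w (insert v T) = - (koszul_sign w T * (koszul_sign v (insert w T) :: ('a, 'b::field) mpoly))"
    if "v < w" "v \<notin> T" for v w :: 'a
  proof -
    have "{u \<in> insert v T. u < w} = insert v {u \<in> T. u < w}" "{u \<in> insert w T. u < v} = {u \<in> T. u < v}"
      using that by auto
    then show ?thesis
      using assms(1) that by (simp add: koszul_sign_def)
  qed
  show ?thesis
  proof (cases v w rule: linorder_cases)
    case less
    then show ?thesis using * assms by blast
  next
    case greater
    then have "koszul_sign w T * koszul_sign v (insert w T) =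
        - (koszul_sign v T * (koszul_sign w (insert v T) :: ('a, 'b) mpoly))"
      using * assms by blast
    then show ?thesis by (simp only: minus_minus)
  qed (use assms in simp)
qed

text \<open>The terms cancel in pairs. The diagonal is left out and nothing is divided by
  \<open>2\<close>, so characteristic \<open>2\<close> is covered.\<close>

lemma sum_antisymmetric:
  fixes F :: "'x \<Rightarrow> 'x \<Rightarrow> 'r::ab_group_add"
  assumes "finite Y" "\<And>v w. v \<in> Y \<Longrightarrow> w \<in> Y \<Longrightarrow> v \<noteq> w \<Longrightarrow> F v w = - F w v"
  shows "(\<Sum>v\<in>Y. \<Sum>w\<in>Y - {v}. F v w) = 0"
  using assms
proof (induction Y rule: finite_induct)
  case (insert a Y)
  have "(\<Sum>w\<in>insert a Y - {v}. F v w) = F v a + (\<Sum>w\<in>Y - {v}. F v w)" if "v \<in> Y" for v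
  proof -
    have "insert a Y - {v} = insert a (Y - {v})" using insert.hyps that by auto
    then show ?thesis using insert.hyps by simp
  qed
  then have "(\<Sum>v\<in>insert a Y. \<Sum>w\<in>insert a Y - {v}. F v w) =
      (\<Sum>w\<in>Y. F a w) + ((\<Sum>v\<in>Y. F v a) + (\<Sum>v\<in>Y. \<Sum>w\<in>Y - {v}. F v w))"
    using insert.hyps by (simp add: sum.distrib)
  also have "(\<Sum>v\<in>Y. \<Sum>w\<in>Y - {v}. F v w) = 0"
    by (rule insert.IH) (rule insert.prems; simp)
  also have "(\<Sum>w\<in>Y. F a w) = (\<Sum>w\<in>Y. - F w a)"
    by (rule sum.cong[OF refl], rule insert.prems) (use insert.hyps in auto)
  finally show ?case by (simp add: sum_negf)
qed simp

lemma koszul_cong: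
  "(\<And>v. v \<in> X \<Longrightarrow> v \<notin> T \<Longrightarrow> c (insert v T) = c' (insert v T)) \<Longrightarrow> koszul X c T = koszul X c' T"
  unfolding koszul_def by (rule sum.cong) auto

lemma koszul_zero [simp]: "koszul X (\<lambda>_. 0) T = 0"
  by (simp add: koszul_def)

lemma koszul_add: "koszul X (\<lambda>T. c T + c' T) T = koszul X c T + koszul X c' T"
  by (simp add: koszul_def sum.distrib distrib_left)

lemma koszul_diff: "koszul X (\<lambda>T. c T - c' T) T = koszul X c T - koszul X c' T"
  by (simp add: koszul_def sum_subtractf right_diff_distrib)

lemma koszul_mult: "koszul X (\<lambda>T. p * c T) T = p * koszul X c T"
  by (simp add: koszul_def sum_distrib_left mult_ac)

lemma koszul_sum: "koszul X (\<lambda>T. \<Sum>i\<in>S. c i T) T = (\<Sum>i\<in>S. koszul X (c i) T)"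
  by (induction S rule: infinite_finite_induct) (auto simp: koszul_add)

lemma koszul_koszul:
  assumes "finite X" "T \<subseteq> X"
  shows "koszul X (koszul X c) T = 0"
proof -
  have T: "finite T" using assms finite_subset by blast
  define F where "F v w = koszul_sign v T * koszul_sign w (insert v T) *
    (var v * var w * c (insert w (insert v T)))" for v w
  have "koszul X (koszul X c) T = (\<Sum>v\<in>X - T. \<Sum>w\<in>(X - T) - {v}. F v w)"
    unfolding koszul_def
  proof (rule sum.cong[OF refl])
    fix v assume "v \<in> X - T"
    have "X - insert v T = (X - T) - {v}" by auto
    then show "koszul_sign v T * var v *
        (\<Sum>w\<in>X - insert v T. koszul_sign w (insert v T) * var w * c (insert w (insert v T))) =
        (\<Sum>w\<in>X - T - {v}. F v w)"
      by (simp add: F_def sum_distrib_left mult_ac)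
  qed
  also have "\<dots> = 0"
  proof (rule sum_antisymmetric)
    fix v w assume "v \<in> X - T" "w \<in> X - T" "v \<noteq> w"
    then have "koszul_sign v T * koszul_sign w (insert v T) =
        - (koszul_sign w T * (koszul_sign v (insert w T) :: ('a, 'b) mpoly))"
      using koszul_sign_swap[OF T, of v w] by blast
    moreover have "var v * var w * c (insert w (insert v T)) = var w * var v * c (insert v (insert w T))"
      by (simp only: insert_commute[of w v] mult.commute[of "var w" "var v"])
    ultimately show "F v w = - F w v"
      unfolding F_def by (simp only: mult_minus_left)
  qed (use assms in simp)
  finally show ?thesis .
qed

lemma sign_cancel:
  fixes a b c e :: "'r::comm_ring_1"
  assumes "a * a = 1" "e * e = 1" "a * b = - (c * e)"
  shows "b * e = - (a * c)"
proof -
  have "b * e = (a * a) * (b * e)" by (simp only: assms mult_1_left)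
  also have "\<dots> = a * (a * b) * e" by (simp only: mult_ac)
  also have "\<dots> = - (a * c * (e * e))" by (simp only: assms(3)) (simp add: mult_ac)
  finally show ?thesis by (simp only: assms(2) mult_1_right)
qed

text \<open>Multiplication by \<open>var z\<close> is null-homotopic on the Koszul complex, hence
  zero on Koszul homology. For \<open>z \<notin> T\<close> only the summand \<open>v = z\<close> is
  nonzero; for \<open>z \<in> T\<close> all other summands cancel in pairs, since the signs
  anticommute.\<close>

lemma koszul_homotopy:
  assumes "finite X" "T \<subseteq> X" "z \<in> X"
  shows "koszul X (koszul_homotopy z c) T + koszul_homotopy z (koszul X c) T = var z * c T"
proof (cases "z \<in> T")
  case False
  have "koszul X (koszul_homotopy z c) T =
      (\<Sum>v\<in>X - T. if v = z then koszul_sign z T * var z * (koszul_sign z T * c T) else 0)"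
    unfolding koszul_def by (rule sum.cong) (use False in \<open>auto simp: koszul_homotopy_def\<close>)
  also have "\<dots> = koszul_sign z T * var z * (koszul_sign z T * c T)"
    using assms False by simp
  also have "\<dots> = koszul_sign z T * koszul_sign z T * (var z * c T)"
    by (simp only: mult_ac)
  finally show ?thesis
    using False by (simp add: koszul_sign_sq koszul_homotopy_def)
next
  case True
  define T' where "T' = T - {z}"
  have T': "T = insert z T'" "z \<notin> T'" "finite T'"
    using True assms finite_subset[of T X] by (auto simp: T'_def)
  have "X - T' = insert z (X - T)" using T' assms by auto
  moreover have "finite (X - T)" "z \<notin> X - T" using assms True by auto
  ultimately have "koszul X c T' = koszul_sign z T' * var z * c (insert z T') +
      (\<Sum>v\<in>X - T. koszul_sign v T' * var v * c (insert v T'))"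
    unfolding koszul_def by (simp only: sum.insert not_False_eq_True)
  then have "koszul X c T' = koszul_sign z T' * var z * c T +
      (\<Sum>v\<in>X - T. koszul_sign v T' * var v * c (insert v T'))"
    by (simp only: T'(1)[symmetric])
  moreover have "koszul X (koszul_homotopy z c) T =
      - (koszul_sign z T' * (\<Sum>v\<in>X - T. koszul_sign v T' * var v * c (insert v T')))"
    unfolding koszul_def sum_distrib_left sum_negf[symmetric]
  proof (rule sum.cong[OF refl])
    fix v assume v: "v \<in> X - T"
    then have *: "insert v T - {z} = insert v T'" using T' by auto
    have **: "koszul_sign v T * koszul_sign z (insert v T') =
        - (koszul_sign z T' * (koszul_sign v T' :: ('a, 'b) mpoly))"
    proof -
      have "v \<noteq> z" "v \<notin> T'" using v T' by auto
      then have "koszul_sign z T' * koszul_sign v T =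
          - (koszul_sign v T' * (koszul_sign z (insert v T') :: ('a, 'b) mpoly))"
        using koszul_sign_swap[of T' z v] T' by simp
      then show ?thesis by (rule sign_cancel[OF koszul_sign_sq koszul_sign_sq])
    qed
    have "koszul_homotopy z c (insert v T) = koszul_sign z (insert v T') * c (insert v T')"
      using True by (simp add: koszul_homotopy_def *)
    then have "koszul_sign v T * var v * koszul_homotopy z c (insert v T) =
        koszul_sign v T * koszul_sign z (insert v T') * (var v * c (insert v T'))"
      by (simp only: mult_ac)
    also have "\<dots> = - (koszul_sign z T' * koszul_sign v T') * (var v * c (insert v T'))"
      by (simp only: **)
    finally show "koszul_sign v T * var v * koszul_homotopy z c (insert v T) =
        - (koszul_sign z T' * (koszul_sign v T' * var v * c (insert v T')))"
      by (simp only: mult_minus_left mult.assoc)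
  qed
  ultimately show ?thesis
    using True
    by (simp add: koszul_homotopy_def T'_def[symmetric] distrib_left mult.assoc[symmetric] koszul_sign_sq)
qed

lemma koszul_mem:
  assumes I: "ideal I (poly_ring X)" and "finite X" "T \<subseteq> X"
    and "\<And>T'. T' \<subseteq> X \<Longrightarrow> card T' = Suc (card T) \<Longrightarrow> c T' \<in> I"
  shows "koszul X c T \<in> I"
  unfolding koszul_def
proof (rule ideal_sum[OF I])
  fix v assume v: "v \<in> X - T"
  have "c (insert v T) \<in> I"
    using assms v finite_subset[of T X] by auto
  then show "koszul_sign v T * var v * c (insert v T) \<in> I"
    by (rule ideal_mult[OF I]) (use v in auto)
qed

text \<open>The basis element indexed by \<open>T\<close> has degree \<open>card T\<close>, so
  \<open>d\<close> is the total degree.\<close>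

definition koszul_chain ::
    "'x set \<Rightarrow> nat \<Rightarrow> int \<Rightarrow> ('x set \<Rightarrow> ('x, 'k::field) mpoly) \<Rightarrow> bool" where
  "koszul_chain X i d c \<longleftrightarrow> (\<forall>T. T \<subseteq> X \<and> card T = i \<longrightarrow> c T \<in> homogeneous_part X (d - int i))"

lemma koszul_chain_zero [simp]: "koszul_chain X i d (\<lambda>_. 0)"
  by (simp add: koszul_chain_def)

lemma koszul_chain_add:
  "koszul_chain X i d c \<Longrightarrow> koszul_chain X i d c' \<Longrightarrow> koszul_chain X i d (\<lambda>T. c T + c' T)"
  by (auto simp: koszul_chain_def)

lemma koszul_chain_diff:
  "koszul_chain X i d c \<Longrightarrow> koszul_chain X i d c' \<Longrightarrow> koszul_chain X i d (\<lambda>T. c T - c' T)"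
  by (auto simp: koszul_chain_def)

lemma koszul_chain_koszul:
  assumes "finite X" "koszul_chain X (Suc i) d c"
  shows "koszul_chain X i d (koszul X c)"
  unfolding koszul_chain_def
proof safe
  fix T assume T: "T \<subseteq> X" "i = card T"
  show "koszul X c T \<in> homogeneous_part X (d - int (card T))"
    unfolding koszul_def
  proof (rule homogeneous_sum)
    fix v assume v: "v \<in> X - T"
    have "c (insert v T) \<in> homogeneous_part X (d - int (Suc i))"
      using assms v T finite_subset[of T X] by (auto simp: koszul_chain_def)
    with v have "var v * c (insert v T) \<in> homogeneous_part X (1 + (d - int (Suc i)))"
      by (intro homogeneous_mult homogeneous_var) auto
    then have "var v * c (insert v T) \<in> homogeneous_part X (d - int (card T))"
      using T by simp
    then show "koszul_sign v T * var v * c (insert v T) \<in> homogeneous_part X (d - int (card T))"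
      using koszul_sign_mult[of v T "var v * c (insert v T)"] by (auto simp: mult.assoc)
  qed
qed

section \<open>Regularity in terms of Koszul homology\<close>

text \<open>The \<open>i\<close>-th Koszul homology of \<open>k[X]/I\<close>, that is
  \<open>Tor\<^sub>i(k[X]/I, k)\<close>, is zero in degree \<open>d\<close>; chains are represented
  over \<open>k[X]\<close>. For \<open>i = 0\<close> the condition \<open>Suc (card T) = i\<close>
  makes every chain a cycle.\<close>

definition koszul_vanish :: "'x::linorder set \<Rightarrow> ('x, 'k::field) mpoly set \<Rightarrow> nat \<Rightarrow> int \<Rightarrow> bool" where
  "koszul_vanish X I i d \<longleftrightarrow>
     (\<forall>c. koszul_chain X i d c \<longrightarrow> (\<forall>T\<subseteq>X. Suc (card T) = i \<longrightarrow> koszul X c T \<in> I) \<longrightarrow>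
       (\<exists>e. koszul_chain X (Suc i) d e \<and> (\<forall>T\<subseteq>X. card T = i \<longrightarrow> c T - koszul X e T \<in> I)))"

definition reg_le :: "'x::linorder set \<Rightarrow> ('x, 'k::field) mpoly set \<Rightarrow> nat \<Rightarrow> bool" where
  "reg_le X I b \<longleftrightarrow> (\<forall>i d. int i + int b < d \<longrightarrow> koszul_vanish X I i d)"

lemma reg_leD:
  assumes "reg_le X I b" "int i + int b < d" "koszul_chain X i d c"
    and "\<And>T. T \<subseteq> X \<Longrightarrow> Suc (card T) = i \<Longrightarrow> koszul X c T \<in> I"
  obtains e where "koszul_chain X (Suc i) d e"
    "\<And>T. T \<subseteq> X \<Longrightarrow> card T = i \<Longrightarrow> c T - koszul X e T \<in> I"
proof -
  have "koszul_vanish X I i d" using assms(1,2) by (simp add: reg_le_def)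
  then have "\<exists>e. koszul_chain X (Suc i) d e \<and> (\<forall>T\<subseteq>X. card T = i \<longrightarrow> c T - koszul X e T \<in> I)"
    unfolding koszul_vanish_def using assms(3,4) by simp
  then show ?thesis using that by blast
qed

lemma reg_le_mono: "reg_le X I b \<Longrightarrow> b \<le> b' \<Longrightarrow> reg_le X I b'"
  by (auto simp: reg_le_def)

lemma single_split_var:
  assumes "v \<in> keys m"
  shows "single m c = single (m - single v 1) c * var v"
proof -
  have "m - single v 1 + single v 1 = m"
    using assms by (intro poly_mapping_eqI) (auto simp: lookup_add lookup_minus lookup_single when_def in_keys_iff)
  then show ?thesis by (simp add: var_def mult_single)
qed

lemma keys_minus_single: "keys (m - single v (1::nat)) \<subseteq> keys m"
  by (auto simp: in_keys_iff lookup_minus)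

lemma mem_of_constant_coeff_zero:
  assumes I: "ideal I (poly_ring X)" and vars: "\<And>v. v \<in> X \<Longrightarrow> var v \<in> I"
    and p: "p \<in> polys X" "lookup p 0 = 0"
  shows "p \<in> I"
proof (rule poly_mapping_closure)
  fix m assume m: "m \<in> keys p"
  then have "m \<noteq> 0" using p by (auto simp: in_keys_iff)
  then obtain v where v: "v \<in> keys m"
    by (metis keys_eq_empty equals0I)
  then have "single (m - single v 1) (lookup p m) * var v \<in> I"
    using m p keys_minus_single[of m v]
    by (intro ideal_mult[OF I] vars polys_single) (auto simp: polys_iff)
  then show "single m (lookup p m) \<in> I"
    using single_split_var[OF v] by metis
qed (use ideal_zero[OF I] ideal_add[OF I] in auto)

lemma homogeneous_lookup_zero:
  "p \<in> homogeneous_part X d \<Longrightarrow> d \<noteq> 0 \<Longrightarrow> lookup p 0 = 0"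
  by (force simp: homogeneous_part_def in_keys_iff)

text \<open>For \<open>d > i\<close> the coefficients have positive degree and thus lie in
  \<open>I\<close>, so that \<open>0\<close> is a filling.\<close>

lemma reg_le_maximal:
  fixes I :: "('x::linorder, 'k::field) mpoly set"
  assumes I: "ideal I (poly_ring X)" and vars: "\<And>v. v \<in> X \<Longrightarrow> var v \<in> I"
  shows "reg_le X I 0"
  unfolding reg_le_def koszul_vanish_def
proof (intro allI impI exI conjI)
  fix i d T and c :: "'x set \<Rightarrow> ('x, 'k) mpoly"
  assume "int i + int 0 < d" "koszul_chain X i d c" "T \<subseteq> X" "card T = i"
  then have "c T \<in> homogeneous_part X (d - int i)" "d - int i \<noteq> 0"
    by (auto simp: koszul_chain_def)
  then have "c T \<in> I"
    by (intro mem_of_constant_coeff_zero[OF I vars] homogeneous_polys homogeneous_lookup_zero)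
  then show "c T - koszul X (\<lambda>_. 0) T \<in> I" by simp
qed simp

lemma gen_ideal_single:
  fixes a :: "('x, 'k::field) mpoly"
  assumes "a \<in> polys X"
  shows "gen_ideal X {a} = {q * a | q. q \<in> polys X}"
proof
  show "gen_ideal X {a} \<subseteq> {q * a | q. q \<in> polys X}"
  proof
    fix p assume p: "p \<in> gen_ideal X {a}"
    have a: "{a} \<subseteq> polys X" using assms by simp
    show "p \<in> {q * a | q. q \<in> polys X}"
      using a p
    proof (induction rule: gen_ideal_induct)
      case zero
      show ?case using polys_zero[of X] by force
    next
      case (add p q)
      then obtain r s where "p = r * a" "q = s * a" "r \<in> polys X" "s \<in> polys X" by auto
      then have "p + q = (r + s) * a" "r + s \<in> polys X" by (auto simp: distrib_right)
      then show ?case by blast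
    qed auto
  qed
  show "{q * a | q. q \<in> polys X} \<subseteq> gen_ideal X {a}"
  proof safe
    fix q :: "('x, 'k) mpoly" assume "q \<in> polys X"
    then show "q * a \<in> gen_ideal X {a}"
      using assms by (intro ideal_mult[OF gen_ideal_ideal] gen_ideal_base) auto
  qed
qed

text \<open>A cycle \<open>c\<close> modulo \<open>I\<close> bounds modulo \<open>I\<close> and
  \<open>var z\<close>, that is, up to a remainder \<open>q * var z\<close> modulo \<open>I\<close>.
  Cancelling \<open>var z\<close> shows that \<open>q\<close> is a cycle modulo \<open>I\<close>,
  and the homotopy then makes \<open>q * var z\<close> a boundary modulo \<open>I\<close>.\<close>

lemma reg_le_nonzerodivisor:
  fixes I :: "('x::linorder, 'k::field) mpoly set"
  assumes X: "finite X" and I: "homogeneous_ideal X I" and z: "z \<in> X"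
    and nzd: "\<And>p. p \<in> polys X \<Longrightarrow> var z * p \<in> I \<Longrightarrow> p \<in> I"
    and reg: "reg_le X (ideal_plus I (gen_ideal X {var z})) b"
  shows "reg_le X I b"
  unfolding reg_le_def koszul_vanish_def
proof (intro allI impI)
  fix i d and c :: "'x set \<Rightarrow> ('x, 'k) mpoly"
  assume d: "int i + int b < d" and c: "koszul_chain X i d c"
    and cyc: "\<forall>T\<subseteq>X. Suc (card T) = i \<longrightarrow> koszul X c T \<in> I"
  let ?K = "ideal_plus I (gen_ideal X {var z})"
  have iI: "ideal I (poly_ring X)" using I by (simp add: homogeneous_ideal_def)
  have gz: "gen_ideal X {var z} = {q * var z | q. q \<in> polys X}"
    using z by (intro gen_ideal_single) auto
  have iz: "ideal (gen_ideal X {var z}) (poly_ring X)"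
    using z by (intro gen_ideal_ideal) auto
  have "koszul X c T \<in> ?K" if "T \<subseteq> X" "Suc (card T) = i" for T
    using cyc that ideal_plusI1[OF iz] by blast
  then obtain e where e: "koszul_chain X (Suc i) d e"
    and ce: "\<And>T. T \<subseteq> X \<Longrightarrow> card T = i \<Longrightarrow> c T - koszul X e T \<in> ?K"
    using reg_leD[OF reg d c] by blast
  \<comment> \<open>Taking the component in the degree of \<open>c T\<close> makes \<open>q\<close>
    homogeneous of degree one less.\<close>
  have "\<exists>g q. g \<in> I \<and> q \<in> homogeneous_part X (d - 1 - int i) \<and> c T - koszul X e T = g + q * var z"
    if T: "T \<subseteq> X" "card T = i" for T
  proof -
    obtain g q where gq: "c T - koszul X e T = g + q * var z" "g \<in> I" "q \<in> polys X"
      using ce[OF T] by (auto simp: ideal_plus_def gz)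
    have "c T - koszul X e T \<in> homogeneous_part X (d - int i)"
      using c koszul_chain_koszul[OF X e] T by (auto simp: koszul_chain_def)
    then have "c T - koszul X e T = hcomp (d - int i) g + hcomp (d - int i) (q * var z)"
      using gq(1) hcomp_id hcomp_add by metis
    also have "hcomp (d - int i) (q * var z) = hcomp (d - int i - 1) q * var z"
      using z by (intro hcomp_mult) auto
    also have "d - int i - 1 = d - 1 - int i" by simp
    finally show ?thesis
      using gq I hcomp_homogeneous unfolding homogeneous_ideal_def by blast
  qed
  then obtain g q where g: "\<And>T. T \<subseteq> X \<Longrightarrow> card T = i \<Longrightarrow> g T \<in> I"
    and q: "\<And>T. T \<subseteq> X \<Longrightarrow> card T = i \<Longrightarrow> q T \<in> homogeneous_part X (d - 1 - int i)"
    and gq: "\<And>T. T \<subseteq> X \<Longrightarrow> card T = i \<Longrightarrow> c T - koszul X e T = g T + q T * var z"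
    by metis
  have q_cyc: "koszul X q T \<in> I" if T: "T \<subseteq> X" "Suc (card T) = i" for T
  proof (rule nzd)
    have fT: "finite T" using T X finite_subset by blast
    have "q (insert v T) \<in> polys X" if "v \<in> X - T" for v
      using q[of "insert v T"] that T fT by (auto intro: homogeneous_polys)
    then show "koszul X q T \<in> polys X"
      unfolding koszul_def by (intro polys_sum polys_mult koszul_sign_polys polys_var) auto
    have "var z * koszul X q T = koszul X (\<lambda>T. var z * q T) T" by (simp add: koszul_mult)
    also have "\<dots> = koszul X (\<lambda>T. c T - koszul X e T - g T) T"
    proof (rule koszul_cong)
      fix v assume "v \<in> X" "v \<notin> T"
      then have "insert v T \<subseteq> X" "card (insert v T) = i" using T fT by auto
      from gq[OF this] show "var z * q (insert v T) =
          c (insert v T) - koszul X e (insert v T) - g (insert v T)"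
        by (simp add: mult.commute)
    qed
    also have "\<dots> = koszul X c T - koszul X g T"
      using koszul_koszul[OF X T(1)] by (simp add: koszul_diff)
    also have "\<dots> \<in> I"
    proof (rule ideal_diff[OF iI])
      show "koszul X c T \<in> I" using cyc T by blast
      show "koszul X g T \<in> I" by (rule koszul_mem[OF iI X T(1)]) (use T g in auto)
    qed
    finally show "var z * koszul X q T \<in> I" .
  qed
  \<comment> \<open>Adding this to \<open>e\<close> fills the remainder \<open>q * var z\<close>;
    the error is the homotopy applied to \<open>koszul X q\<close>, which lies in
    \<open>I\<close>.\<close>
  let ?h = "koszul_homotopy z q"
  show "\<exists>e. koszul_chain X (Suc i) d e \<and> (\<forall>T\<subseteq>X. card T = i \<longrightarrow> c T - koszul X e T \<in> I)"
  proof (intro exI conjI allI impI)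
    have "koszul_chain X (Suc i) d ?h"
      unfolding koszul_chain_def
    proof safe
      fix T assume T: "T \<subseteq> X" "card T = Suc i"
      show "?h T \<in> homogeneous_part X (d - int (Suc i))"
      proof (cases "z \<in> T")
        case True
        then have "q (T - {z}) \<in> homogeneous_part X (d - int (Suc i))"
          using q[of "T - {z}"] T by (auto simp: algebra_simps)
        then show ?thesis
          using True koszul_sign_mult[of z "T - {z}" "q (T - {z})"] by (auto simp: koszul_homotopy_def)
      qed (simp add: koszul_homotopy_def)
    qed
    then show "koszul_chain X (Suc i) d (\<lambda>T. e T + ?h T)"
      using e by (rule koszul_chain_add[rotated])
    fix T assume T: "T \<subseteq> X" "card T = i"
    have "koszul_homotopy z (koszul X q) T \<in> I"
    proof (cases "z \<in> T")
      case True
      then have "Suc (card (T - {z})) = i"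
        using T X finite_subset[of T X] by (metis card.remove)
      then have "koszul X q (T - {z}) \<in> I" using q_cyc[of "T - {z}"] T by auto
      then show ?thesis
        using True by (auto simp: koszul_homotopy_def intro: ideal_mult[OF iI])
    qed (simp add: koszul_homotopy_def ideal_zero[OF iI])
    moreover have "c T - koszul X (\<lambda>T. e T + ?h T) T = g T + koszul_homotopy z (koszul X q) T"
      using gq[OF T] koszul_homotopy[OF X T(1) z, of q]
      by (simp add: koszul_add algebra_simps)
    ultimately show "c T - koszul X (\<lambda>T. e T + ?h T) T \<in> I"
      using g[OF T] ideal_add[OF iI] by simp
  qed
qed

text \<open>The connecting map of the Mayer-Vietoris sequence goes from homological degree
  \<open>i + 1\<close> of the quotient by \<open>A + B\<close> to degree \<open>i\<close> of the
  quotient by \<open>A \<inter> B\<close> and preserves \<open>d\<close>. Hence the sum is allowed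
  only \<open>b\<close> where \<open>A\<close> and \<open>B\<close> are allowed
  \<open>Suc b\<close>.\<close>

lemma reg_le_Int:
  fixes A B :: "('x::linorder, 'k::field) mpoly set"
  assumes X: "finite X" and A: "homogeneous_ideal X A" and B: "homogeneous_ideal X B"
    and regs: "reg_le X A (Suc b)" "reg_le X B (Suc b)" "reg_le X (ideal_plus A B) b"
  shows "reg_le X (A \<inter> B) (Suc b)"
  unfolding reg_le_def koszul_vanish_def
proof (intro allI impI)
  fix i d and c :: "'x set \<Rightarrow> ('x, 'k) mpoly"
  assume d: "int i + int (Suc b) < d" and c: "koszul_chain X i d c"
    and cyc: "\<forall>T\<subseteq>X. Suc (card T) = i \<longrightarrow> koszul X c T \<in> A \<inter> B"
  have iA: "ideal A (poly_ring X)" and iB: "ideal B (poly_ring X)"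
    using A B by (simp_all add: homogeneous_ideal_def)
  obtain a where a: "koszul_chain X (Suc i) d a"
    and ca: "\<And>T. T \<subseteq> X \<Longrightarrow> card T = i \<Longrightarrow> c T - koszul X a T \<in> A"
    using reg_leD[OF regs(1) d c] cyc by blast
  obtain a' where a': "koszul_chain X (Suc i) d a'"
    and ca': "\<And>T. T \<subseteq> X \<Longrightarrow> card T = i \<Longrightarrow> c T - koszul X a' T \<in> B"
    using reg_leD[OF regs(2) d c] cyc by blast
  \<comment> \<open>Fillings of \<open>c\<close> modulo \<open>A\<close> and modulo \<open>B\<close>
    differ by a cycle modulo the sum of the ideals. Filling this cycle lets the two be adjusted
    until they agree.\<close>
  let ?f = "\<lambda>T. a T - a' T"
  have f: "koszul_chain X (Suc i) d ?f" using a a' by (rule koszul_chain_diff)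
  have "koszul X ?f T \<in> ideal_plus A B" if "T \<subseteq> X" "Suc (card T) = Suc i" for T
  proof -
    have "koszul X ?f T = - (c T - koszul X a T) + (c T - koszul X a' T)"
      by (simp add: koszul_diff)
    then show ?thesis
      unfolding ideal_plus_def using ca ca' that ideal_uminus[OF iA] by blast
  qed
  moreover have "int (Suc i) + int b < d" using d by simp
  ultimately obtain e where e: "koszul_chain X (Suc (Suc i)) d e"
    and fe: "\<And>T. T \<subseteq> X \<Longrightarrow> card T = Suc i \<Longrightarrow> ?f T - koszul X e T \<in> ideal_plus A B"
    using reg_leD[OF regs(3) _ f] by blast
  have "\<exists>\<alpha> \<beta>. \<alpha> \<in> A \<and> \<beta> \<in> B \<and> \<alpha> \<in> homogeneous_part X (d - int (Suc i)) \<and>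
      a T - koszul X e T - \<alpha> = a' T + \<beta>"
    if T: "T \<subseteq> X" "card T = Suc i" for T
  proof -
    obtain \<alpha> \<beta> where ab: "?f T - koszul X e T = \<alpha> + \<beta>" "\<alpha> \<in> A" "\<beta> \<in> B"
      using fe[OF T] by (auto simp: ideal_plus_def)
    have "?f T - koszul X e T \<in> homogeneous_part X (d - int (Suc i))"
      using f koszul_chain_koszul[OF X e] T by (auto simp: koszul_chain_def)
    then have "?f T - koszul X e T = hcomp (d - int (Suc i)) \<alpha> + hcomp (d - int (Suc i)) \<beta>"
      using ab(1) hcomp_id hcomp_add by metis
    moreover have "hcomp (d - int (Suc i)) \<alpha> \<in> A" "hcomp (d - int (Suc i)) \<beta> \<in> B"
      using A B ab by (auto simp: homogeneous_ideal_def)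
    moreover have "hcomp (d - int (Suc i)) \<alpha> \<in> homogeneous_part X (d - int (Suc i))"
      using ab ideal_polys[OF iA] by (intro hcomp_homogeneous)
    ultimately show ?thesis by (intro exI conjI) (assumption | simp add: algebra_simps)+
  qed
  then have "\<forall>T. \<exists>\<alpha> \<beta>. T \<subseteq> X \<and> card T = Suc i \<longrightarrow> \<alpha> \<in> A \<and> \<beta> \<in> B \<and>
      \<alpha> \<in> homogeneous_part X (d - int (Suc i)) \<and> a T - koszul X e T - \<alpha> = a' T + \<beta>"
    by blast
  then obtain \<alpha> \<beta> where *: "\<forall>T. T \<subseteq> X \<and> card T = Suc i \<longrightarrow> \<alpha> T \<in> A \<and> \<beta> T \<in> B \<and>
      \<alpha> T \<in> homogeneous_part X (d - int (Suc i)) \<and> a T - koszul X e T - \<alpha> T = a' T + \<beta> T"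
    unfolding choice_iff by blast
  then have \<alpha>: "\<And>T. T \<subseteq> X \<Longrightarrow> card T = Suc i \<Longrightarrow> \<alpha> T \<in> A"
    and \<alpha>_hom: "\<And>T. T \<subseteq> X \<Longrightarrow> card T = Suc i \<Longrightarrow> \<alpha> T \<in> homogeneous_part X (d - int (Suc i))"
    and \<beta>: "\<And>T. T \<subseteq> X \<Longrightarrow> card T = Suc i \<Longrightarrow> \<beta> T \<in> B"
    and eq: "\<And>T. T \<subseteq> X \<Longrightarrow> card T = Suc i \<Longrightarrow> a T - koszul X e T - \<alpha> T = a' T + \<beta> T"
    by simp_all
  \<comment> \<open>This chain is \<open>a\<close> corrected by a boundary and an element of
    \<open>A\<close>, and by \<open>eq\<close> also \<open>a'\<close> corrected by an element of
    \<open>B\<close>. So it fills \<open>c\<close> modulo both ideals.\<close>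
  let ?g = "\<lambda>T. a T - koszul X e T - \<alpha> T"
  show "\<exists>e. koszul_chain X (Suc i) d e \<and> (\<forall>T\<subseteq>X. card T = i \<longrightarrow> c T - koszul X e T \<in> A \<inter> B)"
  proof (intro exI conjI allI impI IntI)
    show "koszul_chain X (Suc i) d ?g"
      using a koszul_chain_koszul[OF X e] \<alpha>_hom
      by (intro koszul_chain_diff) (auto simp: koszul_chain_def)
    fix T assume T: "T \<subseteq> X" "card T = i"
    have "c T - koszul X ?g T = (c T - koszul X a T) + koszul X \<alpha> T"
      using koszul_koszul[OF X T(1), of e] by (simp add: koszul_diff)
    also have "\<dots> \<in> A"
      using T ca \<alpha> by (intro ideal_add[OF iA] koszul_mem[OF iA X]) auto
    finally show "c T - koszul X ?g T \<in> A" .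
    have "koszul X ?g T = koszul X (\<lambda>T. a' T + \<beta> T) T"
      by (rule koszul_cong) (use T X finite_subset[of T X] in \<open>auto intro!: eq\<close>)
    then have "c T - koszul X ?g T = (c T - koszul X a' T) - koszul X \<beta> T"
      by (simp add: koszul_add)
    also have "\<dots> \<in> B"
    proof (rule ideal_diff[OF iB])
      show "koszul X \<beta> T \<in> B" by (rule koszul_mem[OF iB X T(1)]) (use T \<beta> in auto)
    qed (rule ca'[OF T])
    finally show "c T - koszul X ?g T \<in> B" .
  qed
qed

section \<open>Minimal resolutions and Koszul homology\<close>

lemma lookup_mult_zero: "lookup p 0 = 0 \<Longrightarrow> lookup (p * q :: ('x, 'k::field) mpoly) 0 = 0"
proof (rule ccontr)
  assume p: "lookup p 0 = 0" and "lookup (p * q) 0 \<noteq> 0"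
  then have "0 \<in> keys (p * q)" by (simp add: in_keys_iff)
  then obtain a b where ab: "0 = a + b" "a \<in> keys p"
    using Poly_Mapping.keys_mult[of p q] by blast
  have "lookup a v = 0" for v
    using arg_cong[OF ab(1), of "\<lambda>m. lookup m v"] by (simp add: lookup_add)
  then have "a = 0" by (simp add: poly_mapping_eqI)
  then show False using p ab by (simp add: in_keys_iff)
qed

lemma lookup_var_zero: "lookup (var v) 0 = 0"
proof -
  have "single v (1::nat) \<noteq> 0" by (metis keys_single keys_zero insert_not_empty one_neq_zero)
  then show ?thesis by (simp add: var_def lookup_single)
qed

lemma lookup_koszul_zero: "lookup (koszul X c T) 0 = 0"
  unfolding koszul_def lookup_sum
proof (rule sum.neutral, rule ballI)
  fix v
  have "koszul_sign v T * var v * c (insert v T) = var v * (koszul_sign v T * c (insert v T))"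
    by (simp only: mult_ac)
  then show "lookup (koszul_sign v T * var v * c (insert v T)) 0 = 0"
    by (simp only: lookup_mult_zero[OF lookup_var_zero])
qed

lemma lookup_single_mult_add:
  "lookup (single a c * p) (a + m) = c * lookup (p :: ('x, 'k::field) mpoly) m"
  by (rule poly_mapping_closure[where p = p])
     (simp_all add: distrib_left lookup_add mult_single lookup_single when_def)

section \<open>Ideals generated by variables and exactness of the Koszul complex\<close>

lemma gen_ideal_vars_iff:
  fixes p :: "('x, 'k::field) mpoly"
  assumes W: "W \<subseteq> X" and p: "p \<in> polys X"
  shows "p \<in> gen_ideal X (var ` W) \<longleftrightarrow> (\<forall>m\<in>keys p. keys m \<inter> W \<noteq> {})"
proof
  have W': "var ` W \<subseteq> (polys X :: ('x, 'k) mpoly set)" using W by auto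
  note I = gen_ideal_ideal[OF W']
  show "\<forall>m\<in>keys p. keys m \<inter> W \<noteq> {}" if "p \<in> gen_ideal X (var ` W)"
    using W' that
  proof (induction rule: gen_ideal_induct)
    case (mult h b)
    then obtain w where w: "w \<in> W" "b = var w" by auto
    show ?case
    proof
      fix m assume "m \<in> keys (h * b)"
      then obtain a where "m = a + single w 1"
        using Poly_Mapping.keys_mult[of h b] w by (auto simp: var_def)
      then have "w \<in> keys m" by (simp add: in_keys_iff lookup_add)
      with w show "keys m \<inter> W \<noteq> {}" by blast
    qed
  next
    case (add p q)
    then show ?case using Poly_Mapping.keys_add[of p q] by blast
  qed simp
  show "p \<in> gen_ideal X (var ` W)" if *: "\<forall>m\<in>keys p. keys m \<inter> W \<noteq> {}"
  proof (rule poly_mapping_closure)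
    fix m assume m: "m \<in> keys p"
    with * obtain w where w: "w \<in> keys m" "w \<in> W" by blast
    then have "single (m - single w 1) (lookup p m) * var w \<in> gen_ideal X (var ` W)"
      using m p keys_minus_single[of m w]
      by (intro ideal_mult[OF I] gen_ideal_base polys_single) (auto simp: polys_iff)
    then show "single m (lookup p m) \<in> gen_ideal X (var ` W)"
      using single_split_var[OF w(1)] by metis
  qed (use ideal_zero[OF I] ideal_add[OF I] in auto)
qed

lemma homogeneous_ideal_vars:
  "W \<subseteq> X \<Longrightarrow> homogeneous_ideal X (gen_ideal X (var ` W :: ('x, 'k::field) mpoly set))"
  by (rule homogeneous_ideal_gen) auto

text \<open>Descending induction from \<open>W = X\<close>: a variable outside \<open>W\<close> is a
  nonzerodivisor modulo the monomial ideal of \<open>W\<close>. The case \<open>W = {}\<close> gives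
  acyclicity of the Koszul complex.\<close>

lemma reg_le_vars:
  fixes X W :: "'x::linorder set"
  assumes X: "finite X" and W: "W \<subseteq> X"
  shows "reg_le X (gen_ideal X (var ` W :: ('x, 'k::field) mpoly set)) 0"
  using W
proof (induction "card (X - W)" arbitrary: W)
  case 0
  then have "W = X" using X by auto
  then show ?case
    by (intro reg_le_maximal gen_ideal_ideal) (auto intro: gen_ideal_base)
next
  case (Suc n)
  then obtain z where z: "z \<in> X" "z \<notin> W" by (metis card.empty Diff_eq_empty_iff nat.distinct(1) subsetI)
  let ?I = "gen_ideal X (var ` W :: ('x, 'k) mpoly set)"
  have "var ` insert z W = var ` W \<union> {var z :: ('x, 'k) mpoly}" by auto
  then have eq: "gen_ideal X (var ` insert z W :: ('x, 'k) mpoly set) = ideal_plus ?I (gen_ideal X {var z})"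
    using z Suc.prems by (simp only:) (rule gen_ideal_Un; auto)
  have "X - W - {z} = X - insert z W" by auto
  moreover have "card (X - W) = Suc (card (X - W - {z}))"
    using X z by (intro card_Suc_Diff1[symmetric]) auto
  ultimately have "card (X - W) = Suc (card (X - insert z W))" by simp
  then have "reg_le X (ideal_plus ?I (gen_ideal X {var z})) 0"
    using Suc.hyps(1)[of "insert z W"] Suc.hyps(2) Suc.prems z unfolding eq by simp
  then show ?case
  proof (rule reg_le_nonzerodivisor[OF X homogeneous_ideal_vars[OF Suc.prems] z(1), rotated])
    fix p :: "('x, 'k) mpoly" assume p: "p \<in> polys X" "var z * p \<in> ?I"
    have "keys m \<inter> W \<noteq> {}" if m: "m \<in> keys p" for m
    proof -
      have "single z 1 + m \<in> keys (var z * p)"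
        using m by (simp add: in_keys_iff var_def lookup_single_mult_add)
      then have "keys (single z 1 + m) \<inter> W \<noteq> {}"
        using p(2) gen_ideal_vars_iff[OF Suc.prems, of "var z * p"] p(1) z by auto
      moreover have "keys (single z 1 + m) \<subseteq> insert z (keys m)"
        using Poly_Mapping.keys_add[of "single z 1" m] by auto
      ultimately show ?thesis using z by blast
    qed
    then show "p \<in> ?I" using gen_ideal_vars_iff[OF Suc.prems p(1)] by blast
  qed
qed

text \<open>For \<open>d > i\<close> this is \<open>reg_le_vars\<close> with \<open>W = {}\<close>.
  For \<open>d \<le> i\<close> the coefficients can only be constants, and these vanish by
  \<open>const\<close>.\<close>

lemma koszul_exact:
  fixes c :: "'x::linorder set \<Rightarrow> ('x, 'k::field) mpoly"
  assumes X: "finite X" and c: "koszul_chain X i d c"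
    and cyc: "\<And>T. T \<subseteq> X \<Longrightarrow> Suc (card T) = i \<Longrightarrow> koszul X c T = 0"
    and const: "\<And>T. T \<subseteq> X \<Longrightarrow> card T = i \<Longrightarrow> lookup (c T) 0 = 0"
  obtains e where "koszul_chain X (Suc i) d e"
    "\<And>T. T \<subseteq> X \<Longrightarrow> card T = i \<Longrightarrow> c T = koszul X e T"
proof (cases "int i < d")
  case True
  have "reg_le X (gen_ideal X (var ` {} :: ('x, 'k) mpoly set)) 0"
    by (rule reg_le_vars) (use X in auto)
  moreover have "gen_ideal X (var ` {}) = ({0} :: ('x, 'k) mpoly set)"
  proof
    show "gen_ideal X (var ` {}) \<subseteq> ({0} :: ('x, 'k) mpoly set)"
      by (rule gen_ideal_subset[OF ideal_poly_ringI]) auto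
    show "({0} :: ('x, 'k) mpoly set) \<subseteq> gen_ideal X (var ` {})"
      using ideal_zero[OF gen_ideal_ideal, of "{}" X] by simp
  qed
  ultimately have reg: "reg_le X ({0} :: ('x, 'k) mpoly set) 0" by simp
  have d: "int i + int 0 < d" using True by simp
  have cyc0: "koszul X c T \<in> {0}" if "T \<subseteq> X" "Suc (card T) = i" for T
    by (simp only: cyc[OF that] singleton_iff)
  obtain e where e: "koszul_chain X (Suc i) d e"
    "\<And>T. T \<subseteq> X \<Longrightarrow> card T = i \<Longrightarrow> c T - koszul X e T \<in> {0}"
    by (rule reg_leD[OF reg d c cyc0]) (assumption | rule that)+
  show ?thesis
  proof (rule that[OF e(1)])
    fix T assume "T \<subseteq> X" "card T = i"
    from e(2)[OF this] show "c T = koszul X e T" by simp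
  qed
next
  case False
  have "c T = 0" if T: "T \<subseteq> X" "card T = i" for T
  proof -
    have "m = 0" if "m \<in> keys (c T)" for m
    proof -
      have "int (monom_degree m) = d - int i"
        using c T that by (auto simp: koszul_chain_def homogeneous_part_def)
      then show ?thesis using False monom_degree_eq_0[of m] by linarith
    qed
    then have "keys (c T) = {}" using const[OF T] by (metis equals0I in_keys_iff)
    then show ?thesis by simp
  qed
  then show ?thesis by (intro that[of "\<lambda>_. 0"]) simp_all
qed

text \<open>
  A resolution of \<open>k[X]/J\<close>, augmented by the ring \<open>k[X]\<close> itself in position \<open>0\<close>. The free module
  resolving in homological degree \<open>i\<close> thus sits in position \<open>i + 1\<close>, and in position \<open>0\<close>
  equations only hold modulo \<open>J\<close>.
\<close>

definition boundary ::
    "(nat \<Rightarrow> nat) \<Rightarrow> (nat \<Rightarrow> nat \<Rightarrow> nat \<Rightarrow> 'r::comm_ring_1) \<Rightarrow> nat \<Rightarrow> (nat \<Rightarrow> 'r) \<Rightarrow> nat \<Rightarrow> 'r" where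
  "boundary r B l v j = (\<Sum>k<r (Suc l). B l j k * v k)"

definition null_ideal :: "'r::zero set \<Rightarrow> nat \<Rightarrow> 'r set" where
  "null_ideal J l = (if l = 0 then J else {0})"

locale augmented_resolution =
  fixes X :: "'x::linorder set" and J :: "('x, 'k::field) mpoly set" and r :: "nat \<Rightarrow> nat"
    and \<delta> :: "nat \<Rightarrow> nat \<Rightarrow> int" and B :: "nat \<Rightarrow> nat \<Rightarrow> nat \<Rightarrow> ('x, 'k) mpoly"
  assumes X: "finite X" and J: "homogeneous_ideal X J"
    and B_hom: "\<And>l j k. j < r l \<Longrightarrow> k < r (Suc l) \<Longrightarrow>
      B l j k \<in> homogeneous_part X (\<delta> (Suc l) k - \<delta> l j)"
    and B_min: "\<And>l j k. j < r (Suc l) \<Longrightarrow> k < r (Suc (Suc l)) \<Longrightarrow> lookup (B (Suc l) j k) 0 = 0"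
    and r_0: "r 0 = 1" and \<delta>_0: "\<delta> 0 0 = 0"
    and surj: "\<And>p. p \<in> polys X \<Longrightarrow>
      \<exists>v. (\<forall>k<r 1. v k \<in> polys X) \<and> p - boundary r B 0 v 0 \<in> J"
    and complex: "\<And>l w j. (\<And>k. k < r (Suc (Suc l)) \<Longrightarrow> w k \<in> polys X) \<Longrightarrow> j < r l \<Longrightarrow>
      boundary r B l (boundary r B (Suc l) w) j \<in> null_ideal J l"
    and exact: "\<And>l v. (\<And>k. k < r (Suc l) \<Longrightarrow> v k \<in> polys X) \<Longrightarrow>
      (\<And>j. j < r l \<Longrightarrow> boundary r B l v j \<in> null_ideal J l) \<Longrightarrow>
      \<exists>w. (\<forall>k<r (Suc (Suc l)). w k \<in> polys X) \<and> (\<forall>k<r (Suc l). v k = boundary r B (Suc l) w k)"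
begin

abbreviation "D \<equiv> boundary r B"
abbreviation "Z \<equiv> null_ideal J"

lemmas D_def = boundary_def[of r B]
lemmas Z_def = null_ideal_def[of J]

lemma J_ideal: "ideal J (poly_ring X)"
  using J by (simp add: homogeneous_ideal_def)

lemma D_diff: "D l (\<lambda>k. v k - w k) j = D l v j - D l w j"
  by (simp add: D_def right_diff_distrib sum_subtractf)

lemma D_cong: "(\<And>k. k < r (Suc l) \<Longrightarrow> v k = w k) \<Longrightarrow> D l v j = D l w j"
  by (simp add: D_def)

lemma D_koszul: "D l (\<lambda>k. koszul X (\<lambda>T. c T k) T) j = koszul X (\<lambda>T. D l (c T) j) T"
  unfolding D_def by (simp add: koszul_sum koszul_mult)

lemma D_hom:
  assumes "j < r l" "\<And>k. k < r (Suc l) \<Longrightarrow> v k \<in> homogeneous_part X (d - \<delta> (Suc l) k)"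
  shows "D l v j \<in> homogeneous_part X (d - \<delta> l j)"
  unfolding D_def
proof (rule homogeneous_sum)
  fix k assume k: "k \<in> {..<r (Suc l)}"
  then have "B l j k * v k \<in> homogeneous_part X ((\<delta> (Suc l) k - \<delta> l j) + (d - \<delta> (Suc l) k))"
    using assms by (intro homogeneous_mult B_hom) auto
  then show "B l j k * v k \<in> homogeneous_part X (d - \<delta> l j)" by simp
qed

lemma D_hcomp:
  assumes "j < r l"
  shows "D l (\<lambda>k. hcomp (d - \<delta> (Suc l) k) (w k)) j = hcomp (d - \<delta> l j) (D l w j)"
  unfolding D_def hcomp_sum
proof (rule sum.cong[OF refl])
  fix k assume "k \<in> {..<r (Suc l)}"
  then have "hcomp (d - \<delta> l j) (w k * B l j k) = hcomp (d - \<delta> l j - (\<delta> (Suc l) k - \<delta> l j)) (w k) * B l j k"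
    using assms by (intro hcomp_mult[OF B_hom]) auto
  then show "B l j k * hcomp (d - \<delta> (Suc l) k) (w k) = hcomp (d - \<delta> l j) (B l j k * w k)"
    by (simp add: mult.commute)
qed

text \<open>The augmented complex is graded, so a lift can be replaced by its components in the
  right degrees.\<close>

lemma surj_hom:
  assumes "p \<in> homogeneous_part X d"
  shows "\<exists>v. (\<forall>k<r 1. v k \<in> homogeneous_part X (d - \<delta> 1 k)) \<and> p - D 0 v 0 \<in> J"
proof -
  obtain v where v: "\<forall>k<r 1. v k \<in> polys X" "p - D 0 v 0 \<in> J"
    using surj assms homogeneous_polys by blast
  have "hcomp d (p - D 0 v 0) \<in> J"
    using v(2) J by (simp add: homogeneous_ideal_def)
  moreover have "hcomp d (p - D 0 v 0) = p - D 0 (\<lambda>k. hcomp (d - \<delta> 1 k) (v k)) 0"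
    using D_hcomp[of 0 0 d v] r_0 \<delta>_0 hcomp_id[OF assms] by (simp add: hcomp_diff)
  ultimately have "p - D 0 (\<lambda>k. hcomp (d - \<delta> 1 k) (v k)) 0 \<in> J" by simp
  moreover have "\<forall>k<r 1. hcomp (d - \<delta> 1 k) (v k) \<in> homogeneous_part X (d - \<delta> 1 k)"
    using v hcomp_homogeneous by blast
  ultimately show ?thesis by (intro exI conjI)
qed

lemma exact_hom:
  assumes v: "\<And>k. k < r (Suc l) \<Longrightarrow> v k \<in> homogeneous_part X (d - \<delta> (Suc l) k)"
    and cyc: "\<And>j. j < r l \<Longrightarrow> D l v j \<in> Z l"
  shows "\<exists>w. (\<forall>k<r (Suc (Suc l)). w k \<in> homogeneous_part X (d - \<delta> (Suc (Suc l)) k)) \<and>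
    (\<forall>k<r (Suc l). v k = D (Suc l) w k)"
proof -
  obtain w where w: "\<forall>k<r (Suc (Suc l)). w k \<in> polys X" "\<forall>k<r (Suc l). v k = D (Suc l) w k"
    using exact[of l v] v cyc homogeneous_polys by blast
  let ?w = "\<lambda>k. hcomp (d - \<delta> (Suc (Suc l)) k) (w k)"
  have "v k = D (Suc l) ?w k" if "k < r (Suc l)" for k
    using D_hcomp[OF that, of d w] w(2) that hcomp_id[OF v[OF that]] by simp
  moreover have "\<forall>k<r (Suc (Suc l)). ?w k \<in> homogeneous_part X (d - \<delta> (Suc (Suc l)) k)"
    using w hcomp_homogeneous by blast
  ultimately show ?thesis by (intro exI[of _ ?w] conjI) simp_all
qed

text \<open>Elements of total degree \<open>d\<close> in the tensor product of position
  \<open>l\<close> of the resolution with homological degree \<open>m\<close> of the Koszul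
  complex.\<close>

definition chain :: "nat \<Rightarrow> nat \<Rightarrow> int \<Rightarrow> ('x set \<Rightarrow> nat \<Rightarrow> ('x, 'k) mpoly) \<Rightarrow> bool" where
  "chain l m d a \<longleftrightarrow> (\<forall>k<r l. koszul_chain X m (d - \<delta> l k) (\<lambda>T. a T k))"

lemma chainD:
  "chain l m d a \<Longrightarrow> k < r l \<Longrightarrow> T \<subseteq> X \<Longrightarrow> card T = m \<Longrightarrow>
    a T k \<in> homogeneous_part X (d - int m - \<delta> l k)"
  by (auto simp: chain_def koszul_chain_def algebra_simps)

lemma chainI:
  "(\<And>k T. k < r l \<Longrightarrow> T \<subseteq> X \<Longrightarrow> card T = m \<Longrightarrow> a T k \<in> homogeneous_part X (d - int m - \<delta> l k)) \<Longrightarrow>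
    chain l m d a"
  by (auto simp: chain_def koszul_chain_def algebra_simps)

lemma chain_diff_koszul:
  assumes "chain l m d a" "chain l (Suc m) d b"
  shows "chain l m d (\<lambda>T k. a T k - koszul X (\<lambda>T. b T k) T)"
  using assms koszul_chain_koszul[OF X] koszul_chain_diff unfolding chain_def by blast

lemma exact_chain:
  assumes a: "chain (Suc l) m d a"
    and cyc: "\<And>T j. T \<subseteq> X \<Longrightarrow> card T = m \<Longrightarrow> j < r l \<Longrightarrow> D l (a T) j \<in> Z l"
  obtains w where "chain (Suc (Suc l)) m d w"
    "\<And>T k. T \<subseteq> X \<Longrightarrow> card T = m \<Longrightarrow> k < r (Suc l) \<Longrightarrow> a T k = D (Suc l) (w T) k"
proof -
  have "\<exists>w. (\<forall>k<r (Suc (Suc l)). w k \<in> homogeneous_part X (d - int m - \<delta> (Suc (Suc l)) k)) \<and>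
      (\<forall>k<r (Suc l). a T k = D (Suc l) w k)" if "T \<subseteq> X" "card T = m" for T
    by (rule exact_hom) (use chainD[OF a] cyc that in auto)
  then have "\<forall>T. \<exists>w. T \<subseteq> X \<and> card T = m \<longrightarrow>
      (\<forall>k<r (Suc (Suc l)). w k \<in> homogeneous_part X (d - int m - \<delta> (Suc (Suc l)) k)) \<and>
      (\<forall>k<r (Suc l). a T k = D (Suc l) w k)"
    by blast
  then obtain w where "\<forall>T. T \<subseteq> X \<and> card T = m \<longrightarrow>
      (\<forall>k<r (Suc (Suc l)). w T k \<in> homogeneous_part X (d - int m - \<delta> (Suc (Suc l)) k)) \<and>
      (\<forall>k<r (Suc l). a T k = D (Suc l) (w T) k)"
    unfolding choice_iff by blast
  then have w: "(\<forall>k<r (Suc (Suc l)). w T k \<in> homogeneous_part X (d - int m - \<delta> (Suc (Suc l)) k)) \<and>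
      (\<forall>k<r (Suc l). a T k = D (Suc l) (w T) k)" if "T \<subseteq> X" "card T = m" for T
    using that by simp
  show ?thesis
  proof (rule that)
    show "chain (Suc (Suc l)) m d w"
      by (rule chainI) (use w in blast)
    show "a T k = D (Suc l) (w T) k" if "T \<subseteq> X" "card T = m" "k < r (Suc l)" for T k
      using w[OF that(1,2)] that(3) by blast
  qed
qed

text \<open>A chase in the tensor product of the two complexes. For \<open>l > 0\<close> the image
  of \<open>a\<close> in position \<open>l\<close> is a Koszul cycle without constant terms, hence
  the Koszul boundary of some \<open>a'\<close> in position \<open>l\<close>. Passing to
  \<open>a'\<close> lowers \<open>l\<close> and raises \<open>m\<close>, so \<open>m + l\<close> is
  constant. In position \<open>0\<close> the cycle lives over \<open>k[X]/J\<close>, where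
  \<open>reg_le\<close> fills it; exactness of the resolution carries the fillings back.\<close>

lemma zigzag:
  assumes reg: "reg_le X J b" and d: "int (m + l) + int b < d"
    and a: "chain (Suc l) m d a"
    and cyc: "\<And>T j. T \<subseteq> X \<Longrightarrow> Suc (card T) = m \<Longrightarrow> j < r l \<Longrightarrow> koszul X (\<lambda>T. D l (a T) j) T \<in> Z l"
  obtains e w where "chain (Suc l) (Suc m) d e" "chain (Suc (Suc l)) m d w"
    "\<And>T k. T \<subseteq> X \<Longrightarrow> card T = m \<Longrightarrow> k < r (Suc l) \<Longrightarrow>
      a T k - koszul X (\<lambda>T. e T k) T = D (Suc l) (w T) k"
proof -
  have "\<exists>e w. chain (Suc l) (Suc m) d e \<and> chain (Suc (Suc l)) m d w \<and>
    (\<forall>T k. T \<subseteq> X \<longrightarrow> card T = m \<longrightarrow> k < r (Suc l) \<longrightarrow>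
      a T k - koszul X (\<lambda>T. e T k) T = D (Suc l) (w T) k)"
    using d a cyc
  proof (induction l arbitrary: m a)
    case 0
    let ?c = "\<lambda>T. D 0 (a T) 0"
    have c: "koszul_chain X m d ?c"
      unfolding koszul_chain_def
    proof safe
      fix T assume T: "T \<subseteq> X" "m = card T"
      show "D 0 (a T) 0 \<in> homogeneous_part X (d - int (card T))"
        using D_hom[of 0 0 "a T" "d - int m"] chainD[OF "0.prems"(2), of _ T] T r_0 \<delta>_0 by auto
    qed
    obtain e where e: "koszul_chain X (Suc m) d e"
      and ce: "\<And>T. T \<subseteq> X \<Longrightarrow> card T = m \<Longrightarrow> ?c T - koszul X e T \<in> J"
      by (rule reg_leD[OF reg _ c]) (use "0.prems"(1,3) r_0 in \<open>auto simp: Z_def\<close>)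
    \<comment> \<open>The filling \<open>e\<close> sits in position \<open>0\<close> and is lifted
      to position \<open>1\<close> along the surjection modulo \<open>J\<close>.\<close>
    have "\<exists>v. (\<forall>k<r 1. v k \<in> homogeneous_part X (d - int (Suc m) - \<delta> 1 k)) \<and> e T - D 0 v 0 \<in> J"
      if "T \<subseteq> X" "card T = Suc m" for T
      by (rule surj_hom) (use e that in \<open>auto simp: koszul_chain_def\<close>)
    then have "\<forall>T. \<exists>v. T \<subseteq> X \<and> card T = Suc m \<longrightarrow>
        (\<forall>k<r 1. v k \<in> homogeneous_part X (d - int (Suc m) - \<delta> 1 k)) \<and> e T - D 0 v 0 \<in> J"
      by blast
    then obtain v where v: "\<forall>T. T \<subseteq> X \<and> card T = Suc m \<longrightarrow>
        (\<forall>k<r 1. v T k \<in> homogeneous_part X (d - int (Suc m) - \<delta> 1 k)) \<and> e T - D 0 (v T) 0 \<in> J"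
      unfolding choice_iff by blast
    have v_chain: "chain (Suc 0) (Suc m) d v"
      using v by (intro chainI) auto
    let ?a = "\<lambda>T k. a T k - koszul X (\<lambda>T. v T k) T"
    have a_chain: "chain (Suc 0) m d ?a"
      by (rule chain_diff_koszul[OF "0.prems"(2) v_chain])
    have "D 0 (?a T) j \<in> Z 0" if T: "T \<subseteq> X" "card T = m" and j: "j < r 0" for T j
    proof -
      have "D 0 (?a T) j = ?c T - koszul X (\<lambda>T. D 0 (v T) 0) T"
        using j r_0 by (simp add: D_diff D_koszul)
      also have "\<dots> = (?c T - koszul X e T) + koszul X (\<lambda>T. e T - D 0 (v T) 0) T"
        by (simp add: koszul_diff)
      also have "\<dots> \<in> J"
        using ce[OF T] v T by (intro ideal_add[OF J_ideal] koszul_mem[OF J_ideal X]) auto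
      finally show ?thesis by (simp add: Z_def)
    qed
    then obtain w where "chain (Suc (Suc 0)) m d w"
      "\<And>T k. T \<subseteq> X \<Longrightarrow> card T = m \<Longrightarrow> k < r (Suc 0) \<Longrightarrow> ?a T k = D (Suc 0) (w T) k"
      using exact_chain[OF a_chain] by blast
    with v_chain show ?case by blast
  next
    case (Suc l)
    let ?c = "\<lambda>T j. D (Suc l) (a T) j"
    have c_chain: "chain (Suc l) m d ?c"
      by (intro chainI D_hom) (use chainD[OF Suc.prems(2)] in auto)
    have "\<exists>e. koszul_chain X (Suc m) (d - \<delta> (Suc l) j) e \<and>
        (\<forall>T. T \<subseteq> X \<longrightarrow> card T = m \<longrightarrow> ?c T j = koszul X e T)" if j: "j < r (Suc l)" for j
    proof -
      \<comment> \<open>Here minimality enters: constants are the one place where the Koszul complex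
        is not exact.\<close>
      have *: "lookup (?c T j) 0 = 0" for T
        unfolding D_def lookup_sum using B_min j by (intro sum.neutral) (auto intro: lookup_mult_zero)
      have **: "koszul_chain X m (d - \<delta> (Suc l) j) (\<lambda>T. ?c T j)"
        using c_chain j by (simp add: chain_def)
      have ***: "koszul X (\<lambda>T. ?c T j) T = 0" if "T \<subseteq> X" "Suc (card T) = m" for T
        using Suc.prems(3)[OF that j] by (simp add: Z_def)
      obtain e where "koszul_chain X (Suc m) (d - \<delta> (Suc l) j) e"
        "\<And>T. T \<subseteq> X \<Longrightarrow> card T = m \<Longrightarrow> ?c T j = koszul X e T"
        by (rule koszul_exact[OF X ** *** *]) (assumption | rule that)+
      then show ?thesis by blast
    qed
    then have "\<forall>j. \<exists>e. j < r (Suc l) \<longrightarrow> koszul_chain X (Suc m) (d - \<delta> (Suc l) j) e \<and>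
        (\<forall>T. T \<subseteq> X \<longrightarrow> card T = m \<longrightarrow> ?c T j = koszul X e T)" by blast
    then obtain f where f: "\<forall>j. j < r (Suc l) \<longrightarrow> koszul_chain X (Suc m) (d - \<delta> (Suc l) j) (f j) \<and>
        (\<forall>T. T \<subseteq> X \<longrightarrow> card T = m \<longrightarrow> ?c T j = koszul X (f j) T)"
      unfolding choice_iff by blast
    define a' where "a' = (\<lambda>T j. f j T)"
    have a': "chain (Suc l) (Suc m) d a'"
      using f by (simp add: chain_def a'_def)
    have ca': "?c T j = koszul X (\<lambda>T. a' T j) T" if "T \<subseteq> X" "card T = m" "j < r (Suc l)" for T j
      using f that by (simp add: a'_def)
    have a'_cyc: "koszul X (\<lambda>T. D l (a' T) j) T \<in> Z l"
      if T: "T \<subseteq> X" "Suc (card T) = Suc m" and j: "j < r l" for T j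
    proof -
      have "koszul X (\<lambda>T. D l (a' T) j) T = D l (\<lambda>k. koszul X (\<lambda>T. a' T k) T) j"
        by (rule D_koszul[symmetric])
      also have "\<dots> = D l (?c T) j"
        by (rule D_cong) (use ca' T in simp)
      also have "\<dots> \<in> Z l"
        using complex[of l "a T" j] chainD[OF Suc.prems(2), of _ T] T j homogeneous_polys by blast
      finally show ?thesis .
    qed
    obtain e w where e: "chain (Suc l) (Suc (Suc m)) d e" and w: "chain (Suc (Suc l)) (Suc m) d w"
      and ew: "\<And>T k. T \<subseteq> X \<Longrightarrow> card T = Suc m \<Longrightarrow> k < r (Suc l) \<Longrightarrow>
        a' T k - koszul X (\<lambda>T. e T k) T = D (Suc l) (w T) k"
    proof -
      have "int (Suc m + l) + int b < d" using Suc.prems(1) by simp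
      from Suc.IH[OF this a' a'_cyc] show ?thesis using that by blast
    qed
    \<comment> \<open>The image of \<open>w\<close> under \<open>D\<close> is \<open>a'\<close> up
      to a Koszul boundary, which \<open>koszul\<close> kills. So \<open>?a\<close> is a cycle of
      the resolution. In the conclusion, \<open>w\<close> takes the role of
      \<open>e\<close>.\<close>
    let ?a = "\<lambda>T k. a T k - koszul X (\<lambda>T. w T k) T"
    have a_chain: "chain (Suc (Suc l)) m d ?a"
      by (rule chain_diff_koszul[OF Suc.prems(2) w])
    have "D (Suc l) (?a T) j \<in> Z (Suc l)" if T: "T \<subseteq> X" "card T = m" and j: "j < r (Suc l)" for T j
    proof -
      have "D (Suc l) (?a T) j = koszul X (\<lambda>T. a' T j) T - koszul X (\<lambda>T. D (Suc l) (w T) j) T"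
        using ca'[OF T j] by (simp add: D_diff D_koszul)
      also have "koszul X (\<lambda>T. D (Suc l) (w T) j) T =
          koszul X (\<lambda>T. a' T j - koszul X (\<lambda>T. e T j) T) T"
        by (rule koszul_cong) (use T X finite_subset[of T X] j in \<open>auto intro!: ew[symmetric]\<close>)
      also have "\<dots> = koszul X (\<lambda>T. a' T j) T"
        using koszul_koszul[OF X T(1)] by (simp add: koszul_diff)
      finally show ?thesis by (simp add: Z_def)
    qed
    then obtain w' where "chain (Suc (Suc (Suc l))) m d w'"
      "\<And>T k. T \<subseteq> X \<Longrightarrow> card T = m \<Longrightarrow> k < r (Suc (Suc l)) \<Longrightarrow> ?a T k = D (Suc (Suc l)) (w' T) k"
      using exact_chain[OF a_chain] by blast
    with w show ?case by blast
  qed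
  then show ?thesis using that by blast
qed

text \<open>Apply \<open>zigzag\<close> with \<open>m = 0\<close> to the basis element
  \<open>k\<close>; the cycle condition is then vacuous. If its degree were too large, it would be a
  Koszul boundary plus an image under \<open>D\<close>. Both have constant coefficient
  \<open>0\<close> at \<open>k\<close>, but the basis element has \<open>1\<close>.\<close>

lemma degree_le:
  assumes reg: "reg_le X J b" and k: "k < r (Suc i)"
  shows "\<delta> (Suc i) k - int i \<le> int b"
proof (rule ccontr)
  assume "\<not> \<delta> (Suc i) k - int i \<le> int b"
  then have d: "int (0 + i) + int b < \<delta> (Suc i) k" by simp
  define a :: "'x set \<Rightarrow> nat \<Rightarrow> ('x, 'k) mpoly" where "a T k' = (if k' = k then 1 else 0)" for T k'
  have "(1 :: ('x, 'k) mpoly) \<in> homogeneous_part X 0"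
    by (auto simp: homogeneous_part_def)
  then have "chain (Suc i) 0 (\<delta> (Suc i) k) a"
    by (intro chainI) (auto simp: a_def)
  then obtain e w where
    ew: "\<And>T k'. T \<subseteq> X \<Longrightarrow> card T = 0 \<Longrightarrow> k' < r (Suc i) \<Longrightarrow>
      a T k' - koszul X (\<lambda>T. e T k') T = D (Suc i) (w T) k'"
    by (rule zigzag[OF reg d]) auto
  have "lookup (D (Suc i) (w {}) k) 0 = 0"
    unfolding D_def lookup_sum using B_min k by (intro sum.neutral) (auto intro: lookup_mult_zero)
  moreover have "lookup (a {} k - koszul X (\<lambda>T. e T k) {}) 0 = 1"
    by (simp add: a_def lookup_minus lookup_koszul_zero)
  ultimately show False using ew[of "{}" k] k by simp
qed

end

section \<open>From matrix resolutions of the quotient to augmented resolutions\<close>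

lemma rcoset_eq_iff:
  fixes I :: "('x, 'k::field) mpoly set"
  assumes "ideal I (poly_ring X)" "p \<in> polys X" "q \<in> polys X"
  shows "I +>\<^bsub>poly_ring X\<^esub> p = I +>\<^bsub>poly_ring X\<^esub> q \<longleftrightarrow> p - q \<in> I"
  using ring.quotient_eq_iff_same_a_r_cos[OF cring.axioms(1)[OF cring_poly_ring] assms] assms(2,3)
  by (simp add: a_minus_def)

text \<open>Replaces \<open>finsum\<close> in the quotient module by the coset of an ordinary sum,
  using lifts \<open>\<gamma>\<close> of the generators.\<close>

lemma augmentation_quotient_module:
  fixes I :: "('x, 'k::field) mpoly set" and v :: "('x, 'k) mpoly vec"
  assumes I: "ideal I (poly_ring X)" and v: "\<And>k. k < n \<Longrightarrow> v $ k \<in> polys X"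
    and g: "\<And>k. k < n \<Longrightarrow> \<gamma> k \<in> polys X" "\<And>k. k < n \<Longrightarrow> g k = I +>\<^bsub>poly_ring X\<^esub> \<gamma> k"
  shows "augmentation n g (quotient_module (poly_ring X) I) v =
    I +>\<^bsub>poly_ring X\<^esub> (\<Sum>k<n. v $ k * \<gamma> k)"
proof -
  let ?R = "poly_ring X :: ('x, 'k) mpoly ring"
  let ?M = "quotient_module ?R I"
  interpret I: ideal I ?R by (rule I)
  interpret M: module ?R ?M by (rule I.module_quotient_module[OF cring_poly_ring])
  interpret h: ring_hom_ring ?R "?R Quot I" "(+>\<^bsub>?R\<^esub>) I" by (rule I.rcos_ring_hom_ring)
  have sel: "carrier ?M = carrier (?R Quot I)" "\<zero>\<^bsub>?M\<^esub> = \<zero>\<^bsub>?R Quot I\<^esub>"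
    "x \<oplus>\<^bsub>?M\<^esub> y = x \<oplus>\<^bsub>?R Quot I\<^esub> y"
    "a \<odot>\<^bsub>?M\<^esub> x = (I +>\<^bsub>?R\<^esub> a) \<otimes>\<^bsub>?R Quot I\<^esub> x" for x y a
    by (simp_all add: quotient_module_def)
  have smult: "v $ k \<odot>\<^bsub>?M\<^esub> g k = I +>\<^bsub>?R\<^esub> (v $ k * \<gamma> k)" if "k < n" for k
    using h.hom_mult[of "v $ k" "\<gamma> k"] v g that by (simp add: sel)
  have "finsum ?M (\<lambda>k. v $ k \<odot>\<^bsub>?M\<^esub> g k) {..<m} = I +>\<^bsub>?R\<^esub> (\<Sum>k<m. v $ k * \<gamma> k)" if "m \<le> n" for m
    using that
  proof (induction m)
    case 0
    show ?case using h.hom_zero by (simp add: sel)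
  next
    case (Suc m)
    have carr: "v $ k \<odot>\<^bsub>?M\<^esub> g k \<in> carrier ?M" if "k < n" for k
      using smult[OF that] h.hom_closed[of "v $ k * \<gamma> k"] v g that polys_mult[of "v $ k" X "\<gamma> k"]
      by (simp add: sel)
    have "(\<Sum>k<m. v $ k * \<gamma> k) \<in> polys X"
      using v g Suc.prems by (intro polys_sum polys_mult) auto
    moreover have "v $ m * \<gamma> m \<in> polys X"
      using v g Suc.prems by (intro polys_mult) auto
    ultimately have "I +>\<^bsub>?R\<^esub> (v $ m * \<gamma> m + (\<Sum>k<m. v $ k * \<gamma> k)) =
        (I +>\<^bsub>?R\<^esub> (v $ m * \<gamma> m)) \<oplus>\<^bsub>?M\<^esub> (I +>\<^bsub>?R\<^esub> (\<Sum>k<m. v $ k * \<gamma> k))"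
      using h.hom_add by (simp add: sel)
    moreover have "finsum ?M (\<lambda>k. v $ k \<odot>\<^bsub>?M\<^esub> g k) (insert m {..<m}) =
        v $ m \<odot>\<^bsub>?M\<^esub> g m \<oplus>\<^bsub>?M\<^esub> finsum ?M (\<lambda>k. v $ k \<odot>\<^bsub>?M\<^esub> g k) {..<m}"
      using Suc.prems carr by (intro M.finsum_insert) auto
    ultimately show ?case
      using Suc smult[of m] by (simp add: lessThan_Suc add.commute)
  qed
  then show ?thesis by (simp add: augmentation_def)
qed

theorem minimal_resolution_degree_le:
  fixes J :: "('x::linorder, 'k::field) mpoly set"
  assumes X: "finite X" and J: "homogeneous_ideal X J" and reg: "reg_le X J b"
    and res: "minimal_graded_free_resolution X (quotient_module (poly_ring X) J)
      (quotient_grading X J) r deg g A"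
    and k: "k < r i"
  shows "deg i k - int i \<le> int b"
proof -
  let ?R = "poly_ring X :: ('x, 'k) mpoly ring"
  let ?M = "quotient_module ?R J"
  have iJ: "ideal J ?R" using J by (simp add: homogeneous_ideal_def)
  interpret h: ring_hom_ring ?R "?R Quot J" "(+>\<^bsub>?R\<^esub>) J"
    by (rule ideal.rcos_ring_hom_ring[OF iJ])
  note res' = res[unfolded minimal_graded_free_resolution_def]
  have g: "\<And>k. k < r 0 \<Longrightarrow> g k \<in> quotient_grading X J (deg 0 k)"
    and A_carrier: "\<And>i. A i \<in> carrier_mat (r i) (r (Suc i))"
    and A_hom: "\<And>i j k. j < r i \<Longrightarrow> k < r (Suc i) \<Longrightarrow>
      A i $$ (j, k) \<in> homogeneous_part X (deg (Suc i) k - deg i j)"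
    and A_min: "\<And>i j k. j < r i \<Longrightarrow> k < r (Suc i) \<Longrightarrow> lookup (A i $$ (j, k)) 0 = 0"
    and aug_surj: "augmentation (r 0) g ?M ` free_module X (r 0) = carrier ?M"
    and exact0: "{v \<in> free_module X (r 0). augmentation (r 0) g ?M v = \<zero>\<^bsub>?M\<^esub>}
       = (*\<^sub>v) (A 0) ` free_module X (r 1)"
    and exact: "\<And>i. {v \<in> free_module X (r (Suc i)). A i *\<^sub>v v = 0\<^sub>v (r i)}
       = (*\<^sub>v) (A (Suc i)) ` free_module X (r (Suc (Suc i)))"
    using res' by blast+
  have "\<forall>k. \<exists>p. k < r 0 \<longrightarrow> p \<in> homogeneous_part X (deg 0 k) \<and> g k = J +>\<^bsub>?R\<^esub> p"
    using g unfolding quotient_grading_def by blast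
  then obtain \<gamma> where \<gamma>: "\<forall>k. k < r 0 \<longrightarrow> \<gamma> k \<in> homogeneous_part X (deg 0 k) \<and> g k = J +>\<^bsub>?R\<^esub> \<gamma> k"
    unfolding choice_iff by blast
  have \<gamma>_polys: "\<And>k. k < r 0 \<Longrightarrow> \<gamma> k \<in> polys X"
    using \<gamma> homogeneous_polys by blast
  have aug: "augmentation (r 0) g ?M (vec (r 0) v) = J +>\<^bsub>?R\<^esub> (\<Sum>k<r 0. \<gamma> k * v k)"
    if "\<And>k. k < r 0 \<Longrightarrow> v k \<in> polys X" for v
    using augmentation_quotient_module[OF iJ, of "r 0" "vec (r 0) v" \<gamma> g] that \<gamma> \<gamma>_polys
    by (simp add: mult.commute)
  have zero: "\<zero>\<^bsub>?M\<^esub> = J +>\<^bsub>?R\<^esub> 0"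
    using h.hom_zero by (simp add: quotient_module_def)
  have free: "vec n v \<in> free_module X n \<longleftrightarrow> (\<forall>k<n. v k \<in> polys X)"
    for n and v :: "nat \<Rightarrow> ('x, 'k) mpoly"
    by (simp add: free_module_def)
  have free_vec: "\<exists>v'. (\<forall>k<n. v' k \<in> polys X) \<and> v = vec n v'" if "v \<in> free_module X n"
    for n and v :: "('x, 'k) mpoly vec"
    using that by (intro exI[of _ "\<lambda>k. v $ k"]) (auto simp: free_module_def)
  have A_apply: "A i *\<^sub>v vec (r (Suc i)) w = vec (r i) (\<lambda>j. \<Sum>k<r (Suc i). A i $$ (j, k) * w k)" for i w
    using A_carrier[of i] by (intro eq_vecI) (auto simp: scalar_prod_def atLeast0LessThan)
  have \<gamma>_sum: "(\<Sum>k<r 0. \<gamma> k * v k) \<in> polys X" if "\<And>k. k < r 0 \<Longrightarrow> v k \<in> polys X" for v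
    using that \<gamma>_polys by (intro polys_sum polys_mult) auto
  \<comment> \<open>Everything moves up by one position to make room for the ring itself, of rank
    \<open>1\<close> and degree \<open>0\<close>. The row \<open>B 0\<close> consists of the lifts
    of the generators; these may be units, so minimality starts with \<open>B 1\<close>.\<close>
  define r' where "r' = case_nat 1 r"
  define \<delta> where "\<delta> = case_nat (\<lambda>_. 0) deg"
  define B where "B = case_nat (\<lambda>_ k. \<gamma> k) (\<lambda>i j k. A i $$ (j, k))"
  have r'_simps: "r' 0 = 1" "r' (Suc i) = r i" "r' 1 = r 0" for i
    by (simp_all add: r'_def)
  have B0: "boundary r' B 0 v j = (\<Sum>k<r 0. \<gamma> k * v k)" for v j
    by (simp add: boundary_def r'_simps B_def)
  have BSuc: "boundary r' B (Suc i) v j = (\<Sum>k<r (Suc i). A i $$ (j, k) * v k)" for i v j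
    by (simp add: boundary_def r'_simps B_def)
  interpret augmented_resolution X J r' \<delta> B
  proof
    fix l j k assume "j < r' l" "k < r' (Suc l)"
    then show "B l j k \<in> homogeneous_part X (\<delta> (Suc l) k - \<delta> l j)"
      using \<gamma> A_hom by (cases l) (auto simp: B_def r'_simps \<delta>_def)
  next
    fix l j k assume "j < r' (Suc l)" "k < r' (Suc (Suc l))"
    then show "lookup (B (Suc l) j k) 0 = 0"
      using A_min by (simp add: B_def r'_simps)
  next
    fix p :: "('x, 'k) mpoly" assume p: "p \<in> polys X"
    then have "J +>\<^bsub>?R\<^esub> p \<in> carrier ?M"
      using h.hom_closed[of p]
      by (simp add: quotient_module_def)
    then obtain v where v: "v \<in> free_module X (r 0)" "J +>\<^bsub>?R\<^esub> p = augmentation (r 0) g ?M v"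
      using aug_surj by blast
    then obtain v' where v': "\<forall>k<r 0. v' k \<in> polys X" "v = vec (r 0) v'" using free_vec by blast
    then have "J +>\<^bsub>?R\<^esub> p = J +>\<^bsub>?R\<^esub> (\<Sum>k<r 0. \<gamma> k * v' k)" using aug v by simp
    then have "p - (\<Sum>k<r 0. \<gamma> k * v' k) \<in> J"
      using rcoset_eq_iff[OF iJ p \<gamma>_sum] v' by blast
    then show "\<exists>v. (\<forall>k<r' 1. v k \<in> polys X) \<and> p - boundary r' B 0 v 0 \<in> J"
      using v' by (intro exI[of _ v']) (simp add: B0 r'_simps)
  next
    fix l j and w :: "nat \<Rightarrow> ('x, 'k) mpoly"
    assume "\<And>k. k < r' (Suc (Suc l)) \<Longrightarrow> w k \<in> polys X" and j: "j < r' l"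
    then have w: "vec (r (Suc l)) w \<in> free_module X (r (Suc l))"
      using free by (simp add: r'_simps)
    let ?v = "\<lambda>j. \<Sum>k<r (Suc l). A l $$ (j, k) * w k"
    have Aw: "vec (r l) ?v \<in> (*\<^sub>v) (A l) ` free_module X (r (Suc l))"
      using w A_apply[of l w] by (metis image_eqI)
    show "boundary r' B l (boundary r' B (Suc l) w) j \<in> null_ideal J l"
    proof (cases l)
      case 0
      have "vec (r 0) ?v \<in> {v \<in> free_module X (r 0). augmentation (r 0) g ?M v = \<zero>\<^bsub>?M\<^esub>}"
        unfolding exact0 using Aw 0 by (simp only: One_nat_def)
      then have mem: "vec (r 0) ?v \<in> free_module X (r 0)"
        "augmentation (r 0) g ?M (vec (r 0) ?v) = \<zero>\<^bsub>?M\<^esub>"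
        by blast+
      then have v: "\<And>k. k < r 0 \<Longrightarrow> ?v k \<in> polys X"
        using free[of "r 0" ?v] by blast
      have gs: "(\<Sum>k<r 0. \<gamma> k * ?v k) \<in> polys X" by (rule \<gamma>_sum) (rule v)
      have "J +>\<^bsub>?R\<^esub> (\<Sum>k<r 0. \<gamma> k * ?v k) = augmentation (r 0) g ?M (vec (r 0) ?v)"
        by (rule sym, rule aug) (rule v)
      also have "\<dots> = J +>\<^bsub>?R\<^esub> 0"
        by (rule trans[OF mem(2) zero])
      finally have "J +>\<^bsub>?R\<^esub> (\<Sum>k<r 0. \<gamma> k * ?v k) = J +>\<^bsub>?R\<^esub> 0" .
      then have "(\<Sum>k<r 0. \<gamma> k * ?v k) - 0 \<in> J"
        using rcoset_eq_iff[OF iJ gs polys_zero] by (simp only:)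
      then show ?thesis using 0 by (simp add: null_ideal_def B0 BSuc)
    next
      case (Suc i)
      have "vec (r (Suc i)) ?v \<in> {v \<in> free_module X (r (Suc i)). A i *\<^sub>v v = 0\<^sub>v (r i)}"
        unfolding exact using Aw Suc by (simp only:)
      then have "A i *\<^sub>v vec (r (Suc i)) ?v = 0\<^sub>v (r i)" by blast
      then have "vec (r i) (\<lambda>j. \<Sum>k<r (Suc i). A i $$ (j, k) * ?v k) = 0\<^sub>v (r i)"
        unfolding A_apply .
      from arg_cong[OF this, of "\<lambda>u. u $ j"] show ?thesis
        using j Suc by (simp add: null_ideal_def BSuc r'_simps)
    qed
  next
    fix l and v :: "nat \<Rightarrow> ('x, 'k) mpoly"
    assume v': "\<And>k. k < r' (Suc l) \<Longrightarrow> v k \<in> polys X"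
      and cyc: "\<And>j. j < r' l \<Longrightarrow> boundary r' B l v j \<in> null_ideal J l"
    have v: "\<And>k. k < r l \<Longrightarrow> v k \<in> polys X" using v' by (simp add: r'_simps)
    have "vec (r l) v \<in> (*\<^sub>v) (A l) ` free_module X (r (Suc l))"
    proof (cases l)
      case 0
      have "(\<Sum>k<r 0. \<gamma> k * v k) - 0 \<in> J"
        using cyc[of 0] 0 by (simp add: r'_simps null_ideal_def B0)
      moreover have gs: "(\<Sum>k<r 0. \<gamma> k * v k) \<in> polys X" by (rule \<gamma>_sum) (use v 0 in simp)
      ultimately have "J +>\<^bsub>?R\<^esub> (\<Sum>k<r 0. \<gamma> k * v k) = \<zero>\<^bsub>?M\<^esub>"
        unfolding zero using rcoset_eq_iff[OF iJ gs polys_zero] by (simp only:)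
      moreover have "augmentation (r 0) g ?M (vec (r 0) v) = J +>\<^bsub>?R\<^esub> (\<Sum>k<r 0. \<gamma> k * v k)"
        by (rule aug) (use v 0 in simp)
      ultimately have "augmentation (r 0) g ?M (vec (r 0) v) = \<zero>\<^bsub>?M\<^esub>" by (simp only:)
      then have "vec (r 0) v \<in> {v \<in> free_module X (r 0). augmentation (r 0) g ?M v = \<zero>\<^bsub>?M\<^esub>}"
        using free[of "r 0" v] v 0 by blast
      then show ?thesis unfolding exact0 using 0 by (simp only: One_nat_def)
    next
      case (Suc i)
      have "A i *\<^sub>v vec (r (Suc i)) v = 0\<^sub>v (r i)"
        unfolding A_apply using cyc Suc by (intro eq_vecI) (auto simp: r'_simps null_ideal_def BSuc)
      then have "vec (r (Suc i)) v \<in> {v \<in> free_module X (r (Suc i)). A i *\<^sub>v v = 0\<^sub>v (r i)}"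
        using free[of "r (Suc i)" v] v Suc by blast
      then show ?thesis unfolding exact using Suc by (simp only:)
    qed
    then obtain u where u: "u \<in> free_module X (r (Suc l))" "vec (r l) v = A l *\<^sub>v u" by blast
    then obtain w where w: "\<forall>k<r (Suc l). w k \<in> polys X" "u = vec (r (Suc l)) w"
      using free_vec by blast
    have "v j = boundary r' B (Suc l) w j" if "j < r l" for j
      using arg_cong[OF u(2), of "\<lambda>u. u $ j"] that unfolding w(2) A_apply by (simp add: BSuc)
    then show "\<exists>w. (\<forall>k<r' (Suc (Suc l)). w k \<in> polys X) \<and>
        (\<forall>k<r' (Suc l). v k = boundary r' B (Suc l) w k)"
      using w(1) by (auto simp: r'_simps)
  qed (simp_all add: X J r'_simps \<delta>_def)
  show ?thesis
    using degree_le[OF reg, of k i] k by (simp add: r'_simps \<delta>_def)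
qed

section \<open>Prime ideals of minors on disjoint cliques\<close>

text \<open>This order serves the Koszul signs.\<close>

instantiation edge_var :: (linorder) linorder
begin

definition less_eq_edge_var :: "'a edge_var \<Rightarrow> 'a edge_var \<Rightarrow> bool" where
  "less_eq_edge_var x y = (case (x, y) of
     (XVar i, XVar j) \<Rightarrow> i \<le> j | (XVar i, YVar j) \<Rightarrow> True
   | (YVar i, XVar j) \<Rightarrow> False | (YVar i, YVar j) \<Rightarrow> i \<le> j)"

definition less_edge_var :: "'a edge_var \<Rightarrow> 'a edge_var \<Rightarrow> bool" where
  "less_edge_var x y \<longleftrightarrow> x \<le> y \<and> \<not> y \<le> x"

instance
  by standard (auto simp: less_eq_edge_var_def less_edge_var_def split: edge_var.splits)

end

definition minor :: "'v \<Rightarrow> 'v \<Rightarrow> ('v edge_var, 'k::field) mpoly" where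
  "minor i j = var (XVar i) * var (YVar j) - var (XVar j) * var (YVar i)"

lemma edge_vars_iff [simp]: "XVar i \<in> edge_vars V \<longleftrightarrow> i \<in> V" "YVar i \<in> edge_vars V \<longleftrightarrow> i \<in> V"
  by (auto simp: edge_vars_def)

lemma finite_edge_vars [simp]: "finite V \<Longrightarrow> finite (edge_vars V)"
  by (simp add: edge_vars_def)

lemma minor_homogeneous: "i \<in> V \<Longrightarrow> j \<in> V \<Longrightarrow> minor i j \<in> homogeneous_part (edge_vars V) 2"
  unfolding minor_def
  using homogeneous_mult[OF homogeneous_var homogeneous_var, of "XVar i" "edge_vars V" "YVar j"]
    homogeneous_mult[OF homogeneous_var homogeneous_var, of "XVar j" "edge_vars V" "YVar i"]
  by (intro homogeneous_diff) auto

lemma minor_polys: "i \<in> V \<Longrightarrow> j \<in> V \<Longrightarrow> minor i j \<in> polys (edge_vars V)"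
  by (rule homogeneous_polys[OF minor_homogeneous])

lemma minor_same [simp]: "minor i i = 0"
  by (simp add: minor_def)

lemma minor_swap: "minor j i = - minor i j"
  by (simp add: minor_def)

lemma minor_memI:
  assumes I: "ideal I (poly_ring (edge_vars V))" and ij: "i \<in> V" "j \<in> V"
    and mem: "var (XVar i) \<in> I \<and> var (XVar j) \<in> I \<or> var (XVar i) \<in> I \<and> var (YVar i) \<in> I \<or>
      var (XVar j) \<in> I \<and> var (YVar j) \<in> I"
  shows "minor i j \<in> I"
proof -
  have "var (XVar i) \<in> I \<or> var (YVar j) \<in> I" "var (XVar j) \<in> I \<or> var (YVar i) \<in> I"
    using mem by blast+
  moreover have "p * q \<in> I" if "p \<in> I \<or> q \<in> I" "p \<in> polys (edge_vars V)" "q \<in> polys (edge_vars V)" for p q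
    using that ideal_mult[OF I, of q p] ideal_mult'[OF I, of p q] by blast
  ultimately have "var (XVar i) * var (YVar j) \<in> I" "var (XVar j) * var (YVar i) \<in> I"
    using ij by (simp_all add: polys_var)
  then show ?thesis unfolding minor_def by (rule ideal_diff[OF I])
qed

text \<open>\<open>W\<close> is a set of variables and not of vertices, because the degeneration
  modulo \<open>XVar v\<close> kills the variables \<open>XVar j\<close> of a clique while the
  \<open>YVar j\<close> may survive.\<close>

definition clique_gens ::
    "'v set \<Rightarrow> ('v \<Rightarrow> 'c) \<Rightarrow> 'v edge_var set \<Rightarrow> ('v edge_var, 'k::field) mpoly set" where
  "clique_gens A r W = var ` W \<union> {minor i j | i j. i \<in> A \<and> j \<in> A \<and> r i = r j}"

lemma clique_gensI1: "w \<in> W \<Longrightarrow> var w \<in> clique_gens A r W"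
  and clique_gensI2: "i \<in> A \<Longrightarrow> j \<in> A \<Longrightarrow> r i = r j \<Longrightarrow> minor i j \<in> clique_gens A r W"
  unfolding clique_gens_def by blast+

abbreviation clique_ideal ::
    "'v set \<Rightarrow> 'v set \<Rightarrow> ('v \<Rightarrow> 'c) \<Rightarrow> 'v edge_var set \<Rightarrow> ('v edge_var, 'k::field) mpoly set" where
  "clique_ideal V A r W \<equiv> gen_ideal (edge_vars V) (clique_gens A r W)"

text \<open>
  The vertices in \<open>A\<close> are partitioned into cliques by the labels \<open>r\<close>, and the variables in \<open>W\<close> are
  set to \<open>0\<close>. Each vertex outside \<open>A\<close> keeps at most one of its two variables.
\<close>

locale clique_data =
  fixes V A :: "nat set" and W :: "nat edge_var set"
  assumes V: "finite V" and A: "A \<subseteq> V" and W: "W \<subseteq> edge_vars V"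
    and A_W: "W \<inter> edge_vars A = {}"
    and half: "\<And>i. i \<in> V \<Longrightarrow> i \<notin> A \<Longrightarrow> XVar i \<in> W \<or> YVar i \<in> W"
begin

lemma clique_gens_polys: "clique_gens A r W \<subseteq> polys (edge_vars V)"
  using A W by (auto simp: clique_gens_def intro!: minor_polys)

lemma ideal: "ideal (clique_ideal V A r W) (poly_ring (edge_vars V))"
  by (rule gen_ideal_ideal[OF clique_gens_polys])

lemma homogeneous: "homogeneous_ideal (edge_vars V) (clique_ideal V A r W)"
proof (rule homogeneous_ideal_gen)
  fix b :: "(nat edge_var, 'k::field) mpoly" assume "b \<in> clique_gens A r W"
  then consider w where "w \<in> W" "b = var w" | i j where "i \<in> A" "j \<in> A" "b = minor i j"
    by (auto simp: clique_gens_def)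
  then show "\<exists>e. b \<in> homogeneous_part (edge_vars V) e"
  proof cases
    case 1
    show ?thesis unfolding 1(2) by (rule exI, rule homogeneous_var) (use 1 W in auto)
  next
    case 2
    show ?thesis unfolding 2(3) by (rule exI, rule minor_homogeneous) (use 2 A in auto)
  qed
qed

text \<open>
  The ideal is the kernel of the map to a polynomial ring that kills \<open>W\<close> and sends \<open>x\<^sub>i\<close> to
  \<open>X\<^sub>i Y\<^sub>c\<close> and \<open>y\<^sub>i\<close> to \<open>X\<^sub>i\<close> for \<open>i \<in> A\<close> with label \<open>c\<close>. On exponents this map is \<open>fibre\<close>.
\<close>

definition fibre :: "(nat \<Rightarrow> nat) \<Rightarrow> nat edge_var monom \<Rightarrow> nat edge_var monom" where
  "fibre r m = (\<Sum>i\<in>V. single (XVar i) (lookup m (XVar i) + lookup m (YVar i))) +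
     (\<Sum>i\<in>A. single (YVar (r i)) (lookup m (XVar i)))"

lemma fibre_add: "fibre r (m + n) = fibre r m + fibre r n"
  by (simp add: fibre_def lookup_add single_add sum.distrib algebra_simps)

lemma fibre_zero [simp]: "fibre r 0 = 0"
  by (simp add: fibre_def)

lemma lookup_fibre_X:
  "i \<in> V \<Longrightarrow> lookup (fibre r m) (XVar i) = lookup m (XVar i) + lookup m (YVar i)"
  using V by (simp add: fibre_def lookup_add lookup_sum lookup_single when_def)

lemma lookup_fibre_Y: "lookup (fibre r m) (YVar c) = (\<Sum>i\<in>{i \<in> A. r i = c}. lookup m (XVar i))"
proof -
  have "finite A" using V A finite_subset by blast
  then show ?thesis
    by (simp add: fibre_def lookup_add lookup_sum lookup_single when_def sum.inter_filter)
qed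

lemma fibre_swap:
  assumes "i \<in> A" "j \<in> A" "r i = r j"
  shows "fibre r (single (XVar i) 1 + single (YVar j) 1) = fibre r (single (XVar j) 1 + single (YVar i) 1)"
proof -
  have "finite A" using V A finite_subset by blast
  have "fibre r (single (XVar k) 1) = single (XVar k) 1 + single (YVar (r k)) 1"
    "fibre r (single (YVar k) 1) = single (XVar k) 1" if "k \<in> A" for k
    using that A V \<open>finite A\<close>
    by (auto simp: fibre_def lookup_single when_def if_distrib[of "single _"] cong: if_cong)
  then show ?thesis using assms by (simp add: fibre_add ac_simps)
qed

definition clique_map :: "(nat \<Rightarrow> nat) \<Rightarrow> (nat edge_var, 'k::field) mpoly \<Rightarrow> (nat edge_var, 'k) mpoly" where
  "clique_map r p = (\<Sum>m\<in>keys p. if keys m \<inter> W = {} then single (fibre r m) (lookup p m) else 0)"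

lemma clique_map_add: "clique_map r (p + q) = clique_map r p + clique_map r q"
  unfolding clique_map_def
  by (rule setsum_keys_plus_distrib[where f = "\<lambda>m c. if keys m \<inter> W = {} then single (fibre r m) c else 0"])
     (auto simp: single_add)

lemma clique_map_zero [simp]: "clique_map r 0 = 0"
  by (simp add: clique_map_def)

lemma clique_map_uminus: "clique_map r (- p) = - clique_map r p"
  by (rule minus_unique[symmetric]) (simp flip: clique_map_add)

lemma clique_map_diff: "clique_map r (p - q) = clique_map r p - clique_map r q"
  using clique_map_add[of r p "- q"] by (simp add: clique_map_uminus)

lemma clique_map_single:
  "clique_map r (single m c) = (if keys m \<inter> W = {} then single (fibre r m) c else 0)"
  by (cases "c = 0") (simp_all add: clique_map_def)

lemma clique_map_mult: "clique_map r (p * q) = clique_map r p * clique_map r q"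
proof -
  have *: "clique_map r (single m c * q) = clique_map r (single m c) * clique_map r q" for m c
  proof (rule poly_mapping_closure[where p = q])
    fix n
    show "clique_map r (single m c * single n (lookup q n)) =
        clique_map r (single m c) * clique_map r (single n (lookup q n))"
      by (auto simp: mult_single clique_map_single keys_add_monom fibre_add)
  qed (simp_all add: distrib_left clique_map_add)
  show ?thesis
    by (rule poly_mapping_closure[where p = p]) (simp_all add: * distrib_right clique_map_add)
qed

lemma clique_map_var: "z \<notin> W \<Longrightarrow> clique_map r (var z) = single (fibre r (single z 1)) 1"
  by (simp add: var_def clique_map_single)

text \<open>Equal fibres mean equal total exponents at each vertex and equal sums of
  \<open>XVar\<close>-exponents on each clique. While \<open>m\<close> and \<open>n\<close> differ,
  a factor \<open>x\<^sub>i y\<^sub>j\<close> of \<open>m\<close> can be exchanged for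
  \<open>x\<^sub>j y\<^sub>i\<close>, which changes \<open>m\<close> by a multiple of
  \<open>minor i j\<close> and brings it closer to \<open>n\<close>.\<close>

lemma fibre_eq_cong:
  fixes c :: "'k::field"
  assumes m: "keys m \<subseteq> edge_vars V - W" and n: "keys n \<subseteq> edge_vars V - W"
    and eq: "fibre r m = fibre r n"
  shows "single m c - single n c \<in> clique_ideal V A r W"
  using m eq
\<comment> \<open>The truncated differences count only the surplus of \<open>m\<close> over
  \<open>n\<close>.\<close>
proof (induction "\<Sum>i\<in>A. lookup m (XVar i) - lookup n (XVar i)" arbitrary: m rule: less_induct)
  case less
  have A_fin: "finite A" using V A finite_subset by blast
  have deg: "lookup m (XVar i) + lookup m (YVar i) = lookup n (XVar i) + lookup n (YVar i)" if "i \<in> V" for i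
    using lookup_fibre_X[OF that, of r] less.prems(2) by metis
  have cls: "(\<Sum>i\<in>{i \<in> A. r i = c}. lookup m (XVar i)) = (\<Sum>i\<in>{i \<in> A. r i = c}. lookup n (XVar i))" for c
    using lookup_fibre_Y[of r _ c] less.prems(2) by metis
  have W_zero: "lookup m w = 0" "lookup n w = 0" if "w \<in> W" for w
    using that less.prems(1) n by (auto simp: in_keys_iff)
  show ?case
  proof (cases "\<exists>i\<in>A. lookup n (XVar i) < lookup m (XVar i)")
    case False
    have XA: "lookup m (XVar i) = lookup n (XVar i)" if i: "i \<in> A" for i
    proof (rule ccontr)
      assume "lookup m (XVar i) \<noteq> lookup n (XVar i)"
      then have "(\<Sum>j\<in>{j \<in> A. r j = r i}. lookup m (XVar j)) < (\<Sum>j\<in>{j \<in> A. r j = r i}. lookup n (XVar j))"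
        using False i A_fin by (intro sum_strict_mono_ex1) (auto simp: not_less intro!: exI[of _ i] le_neq_implies_less)
      then show False using cls[of "r i"] by simp
    qed
    \<comment> \<open>Outside \<open>A\<close> one of the two variables of a vertex is in
      \<open>W\<close> and thus absent, so the total exponent determines the other.\<close>
    have "lookup m z = lookup n z" for z
    proof (cases "z \<in> edge_vars V")
      case True
      then obtain i where i: "i \<in> V" "z = XVar i \<or> z = YVar i" by (auto simp: edge_vars_def)
      show ?thesis
      proof (cases "i \<in> A")
        case True
        then show ?thesis using XA[OF True] deg[OF i(1)] i(2) by auto
      next
        case False
        then show ?thesis using half[OF i(1) False] deg[OF i(1)] i(2) W_zero by auto
      qed
    next
      case False
      then show ?thesis using less.prems(1) n by (metis DiffD1 in_keys_iff subsetD)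
    qed
    then have "m = n" by (rule poly_mapping_eqI)
    then show ?thesis using ideal_zero[OF ideal] by simp
  next
    case True
    then obtain i where i: "i \<in> A" "lookup n (XVar i) < lookup m (XVar i)" by blast
    \<comment> \<open>The sums over the clique of \<open>i\<close> agree, so the surplus at
      \<open>i\<close> forces a deficit at some \<open>j\<close>; there the total exponent provides
      a factor \<open>YVar j\<close>.\<close>
    have "\<exists>j\<in>A. r j = r i \<and> lookup m (XVar j) < lookup n (XVar j)"
    proof (rule ccontr)
      assume *: "\<not> ?thesis"
      have "(\<Sum>j\<in>{j \<in> A. r j = r i}. lookup n (XVar j)) < (\<Sum>j\<in>{j \<in> A. r j = r i}. lookup m (XVar j))"
        using * i A_fin by (intro sum_strict_mono_ex1) (auto simp: not_less)
      then show False using cls[of "r i"] by simp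
    qed
    then obtain j where j: "j \<in> A" "r j = r i" "lookup m (XVar j) < lookup n (XVar j)" by blast
    have ij: "i \<noteq> j" using i j by auto
    have y: "lookup m (YVar j) > 0" using deg[of j] j A by auto
    define m0 where "m0 = m - single (XVar i) 1 - single (YVar j) 1"
    define m' where "m' = m0 + single (XVar j) 1 + single (YVar i) 1"
    have m_eq: "m = m0 + single (XVar i) 1 + single (YVar j) 1"
      unfolding m0_def using i y
      by (intro poly_mapping_eqI) (auto simp: lookup_add lookup_minus lookup_single when_def)
    have keys_m0: "keys m0 \<subseteq> edge_vars V - W"
      using less.prems(1) m_eq by (auto simp: keys_add_monom)
    have "XVar j \<notin> W" "YVar i \<notin> W" using i j A_W by auto
    then have keys_m': "keys m' \<subseteq> edge_vars V - W"
      using keys_m0 i j A unfolding m'_def keys_add_monom by auto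
    have fibre_m': "fibre r m' = fibre r n"
    proof -
      have "fibre r (single (XVar i) 1 + single (YVar j) 1) = fibre r (single (XVar j) 1 + single (YVar i) 1)"
        using i j by (intro fibre_swap) auto
      then have "fibre r m' = fibre r m"
        by (simp only: m_eq m'_def add.assoc fibre_add)
      then show ?thesis using less.prems(2) by simp
    qed
    have "(\<Sum>k\<in>A. lookup m' (XVar k) - lookup n (XVar k)) < (\<Sum>k\<in>A. lookup m (XVar k) - lookup n (XVar k))"
    proof (rule sum_strict_mono_ex1[OF A_fin])
      show "\<forall>k\<in>A. lookup m' (XVar k) - lookup n (XVar k) \<le> lookup m (XVar k) - lookup n (XVar k)"
        using j by (auto simp: m'_def m_eq lookup_add lookup_single when_def)
      show "\<exists>k\<in>A. lookup m' (XVar k) - lookup n (XVar k) < lookup m (XVar k) - lookup n (XVar k)"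
        using i ij by (intro bexI[of _ i]) (auto simp: m'_def m_eq lookup_add lookup_single when_def)
    qed
    then have IH: "single m' c - single n c \<in> clique_ideal V A r W"
      by (rule less.hyps[OF _ keys_m' fibre_m'])
    have "single m c - single m' c = single m0 c * minor i j"
      by (simp add: m_eq m'_def minor_def var_def mult_single right_diff_distrib add.assoc)
    moreover have "single m0 c * minor i j \<in> clique_ideal V A r W"
    proof (rule ideal_mult[OF ideal])
      show "minor i j \<in> (clique_ideal V A r W :: (nat edge_var, 'k) mpoly set)"
        using i j by (intro gen_ideal_base clique_gensI2) auto
    qed (use keys_m0 in auto)
    ultimately have "single m c - single m' c \<in> clique_ideal V A r W" by simp
    from ideal_add[OF ideal this IH] show ?thesis by simp
  qed
qed

text \<open>The map kills the generators. Conversely, \<open>lift\<close> chooses one monomial in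
  each fibre. A term of \<open>p\<close> either contains a variable in \<open>W\<close> or is
  congruent to the chosen monomial by \<open>fibre_eq_cong\<close>, so \<open>p\<close> is congruent
  to the lift of its image.\<close>

lemma clique_ideal_iff:
  fixes p :: "(nat edge_var, 'k::field) mpoly"
  assumes p: "p \<in> polys (edge_vars V)"
  shows "p \<in> clique_ideal V A r W \<longleftrightarrow> clique_map r p = 0"
proof
  show "clique_map r p = 0" if "p \<in> clique_ideal V A r W"
    using clique_gens_polys that
  proof (induction rule: gen_ideal_induct)
    case (mult h b)
    then consider w where "w \<in> W" "b = var w"
      | i j where "i \<in> A" "j \<in> A" "r i = r j" "b = minor i j"
      by (auto simp: clique_gens_def)
    then have "clique_map r b = 0"
    proof cases
      case 1
      then show ?thesis by (simp add: var_def clique_map_single)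
    next
      case 2
      have "fibre r (single (XVar i) 1 + single (YVar j) 1) = fibre r (single (XVar j) 1 + single (YVar i) 1)"
        using 2 by (intro fibre_swap) auto
      moreover have "keys (single (XVar i) (1::nat) + single (YVar j) 1) \<inter> W = {}"
        "keys (single (XVar j) (1::nat) + single (YVar i) 1) \<inter> W = {}"
        using 2 A_W by (auto simp: keys_add_monom)
      ultimately show ?thesis
        using 2(4) by (simp add: minor_def var_def mult_single clique_map_diff clique_map_single)
    qed
    then show ?case by (simp add: clique_map_mult)
  qed (simp_all add: clique_map_add)
next
  assume zero: "clique_map r p = 0"
  define rep where "rep \<mu> = (SOME m. keys m \<subseteq> edge_vars V - W \<and> fibre r m = \<mu>)" for \<mu>
  have rep: "keys (rep (fibre r m)) \<subseteq> edge_vars V - W \<and> fibre r (rep (fibre r m)) = fibre r m"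
    if "keys m \<subseteq> edge_vars V - W" for m
    unfolding rep_def by (rule someI[of _ m]) (use that in simp)
  define lift where "lift q = (\<Sum>\<mu>\<in>keys q. single (rep \<mu>) (lookup q \<mu>))" for q :: "(nat edge_var, 'k) mpoly"
  have lift_add: "lift (q + q') = lift q + lift q'" for q q'
    unfolding lift_def by (rule setsum_keys_plus_distrib) (simp_all add: single_add)
  have lift_single: "lift (single \<mu> c) = single (rep \<mu>) c" for \<mu> c
    by (cases "c = 0") (simp_all add: lift_def)
  have "p - lift (clique_map r p) \<in> clique_ideal V A r W"
  proof (rule poly_mapping_closure[where p = p])
    show "0 - lift (clique_map r 0) \<in> clique_ideal V A r W"
      using ideal_zero[OF ideal] by (simp add: lift_def)
  next
    fix q q' :: "(nat edge_var, 'k) mpoly"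
    assume "q - lift (clique_map r q) \<in> clique_ideal V A r W"
      "q' - lift (clique_map r q') \<in> clique_ideal V A r W"
    from ideal_add[OF ideal this]
    show "q + q' - lift (clique_map r (q + q')) \<in> clique_ideal V A r W"
      by (simp add: clique_map_add lift_add algebra_simps)
  next
    fix m assume m: "m \<in> keys p"
    let ?c = "lookup p m"
    have mV: "keys m \<subseteq> edge_vars V" using m p by (auto simp: polys_iff)
    show "single m ?c - lift (clique_map r (single m ?c)) \<in> clique_ideal V A r W"
    proof (cases "keys m \<inter> W = {}")
      case True
      then have mVW: "keys m \<subseteq> edge_vars V - W" using mV by auto
      show ?thesis
        using fibre_eq_cong[OF mVW, of "rep (fibre r m)" r ?c] rep[OF mVW] True
        by (simp add: clique_map_single lift_single)
    next
      case False
      then obtain w where w: "w \<in> keys m" "w \<in> W" by blast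
      have "single (m - single w 1) ?c * var w \<in> clique_ideal V A r W"
        using w mV keys_minus_single[of m w]
        by (intro ideal_mult[OF ideal] gen_ideal_base polys_single) (auto simp: clique_gens_def)
      then have "single m ?c \<in> clique_ideal V A r W"
        by (simp only: single_split_var[OF w(1), symmetric])
      moreover have "clique_map r (single m ?c) = 0"
        using False by (simp add: clique_map_single)
      ultimately show ?thesis by (simp add: lift_def)
    qed
  qed
  then show "p \<in> clique_ideal V A r W" using zero by (simp add: lift_def)
qed

lemma var_not_mem:
  fixes r :: "nat \<Rightarrow> nat"
  assumes "z \<in> edge_vars V" "z \<notin> W"
  shows "var z \<notin> (clique_ideal V A r W :: (nat edge_var, 'k::field) mpoly set)"
proof -
  have "single (fibre r (single z 1)) (1::'k) \<noteq> 0"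
    by (metis keys_single keys_zero insert_not_empty one_neq_zero)
  then show ?thesis
    using clique_ideal_iff[OF polys_var[OF assms(1)]] clique_map_var[OF assms(2), of r] by metis
qed

text \<open>The exponent of \<open>YVar (r i)\<close> separates the images of the two monomials
  under \<open>fibre\<close>.\<close>

lemma minor_not_mem:
  fixes r :: "nat \<Rightarrow> nat"
  assumes ij: "i \<in> A" "j \<in> A" "r i \<noteq> r j"
  shows "minor i j \<notin> (clique_ideal V A r W :: (nat edge_var, 'k::field) mpoly set)"
proof -
  let ?m = "single (XVar i) 1 + single (YVar j) (1::nat)"
  let ?n = "single (XVar j) 1 + single (YVar i) (1::nat)"
  have A_fin: "finite A" using V A finite_subset by blast
  have "lookup (fibre r ?m) (YVar (r i)) = 1" "lookup (fibre r ?n) (YVar (r i)) = 0"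
    using ij A_fin by (simp_all add: lookup_fibre_Y lookup_add lookup_single when_def)
  then have "fibre r ?m \<noteq> fibre r ?n" by auto
  moreover have "keys ?m \<inter> W = {}" "keys ?n \<inter> W = {}"
    using ij A_W by (auto simp: keys_add_monom)
  moreover have "clique_map r (minor i j) = clique_map r (single ?m (1::'k)) - clique_map r (single ?n 1)"
    by (simp add: minor_def var_def mult_single clique_map_diff)
  ultimately have "lookup (clique_map r (minor i j) :: (nat edge_var, 'k) mpoly) (fibre r ?m) = 1"
    by (simp add: clique_map_single lookup_minus lookup_single when_def)
  then have "clique_map r (minor i j) \<noteq> (0 :: (nat edge_var, 'k) mpoly)" by auto
  then show ?thesis
    using clique_ideal_iff[OF minor_polys[of i V j]] ij A by blast
qed

text \<open>The ideal is the kernel of a multiplicative map into polynomials over a field, which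
  have no zero divisors.\<close>

lemma prime_mult:
  fixes r :: "nat \<Rightarrow> nat" and p q :: "(nat edge_var, 'k::field) mpoly"
  assumes "p \<in> polys (edge_vars V)" "q \<in> polys (edge_vars V)" "p * q \<in> clique_ideal V A r W"
  shows "p \<in> clique_ideal V A r W \<or> q \<in> clique_ideal V A r W"
proof -
  have "clique_map r p * clique_map r q = 0"
    using assms(3) clique_ideal_iff[OF polys_mult[OF assms(1,2)]] by (simp add: clique_map_mult)
  then show ?thesis
    using clique_ideal_iff[OF assms(1)] clique_ideal_iff[OF assms(2)] by auto
qed

lemma primeideal:
  fixes r :: "nat \<Rightarrow> nat"
  shows "primeideal (clique_ideal V A r W) (poly_ring (edge_vars V) :: (nat edge_var, 'k::field) mpoly ring)"
proof (rule primeidealI[OF ideal cring_poly_ring])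
  have "clique_map r 1 = (1 :: (nat edge_var, 'k) mpoly)"
    using clique_map_single[of r 0 "1::'k"] by (simp add: single_one)
  then have "(1 :: (nat edge_var, 'k) mpoly) \<notin> clique_ideal V A r W"
    using clique_ideal_iff[of "1 :: (nat edge_var, 'k) mpoly" r] by (simp add: polys_one)
  then show "polys (edge_vars V) \<noteq> (clique_ideal V A r W :: (nat edge_var, 'k) mpoly set)"
    using polys_one by blast
qed (use prime_mult in auto)

end

section \<open>Regularity of clique ideals\<close>

text \<open>These label the cliques with an edge, the only ones that contribute nonzero
  minors.\<close>

definition multi_labels :: "'v set \<Rightarrow> ('v \<Rightarrow> 'c) \<Rightarrow> 'c set" where
  "multi_labels A r = {c. \<exists>i\<in>A. \<exists>j\<in>A. i \<noteq> j \<and> r i = c \<and> r j = c}"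

lemma multi_labels_mono: "A \<subseteq> B \<Longrightarrow> multi_labels A r \<subseteq> multi_labels B r"
  unfolding multi_labels_def by blast

lemma finite_multi_labels: "finite A \<Longrightarrow> finite (multi_labels A r)"
  by (rule finite_subset[of _ "r ` A"]) (auto simp: multi_labels_def)

lemma (in clique_data) ideal_plus_clique_var:
  fixes r :: "nat \<Rightarrow> nat"
  assumes "z \<in> edge_vars V"
  shows "ideal_plus (clique_ideal V A r W) (gen_ideal (edge_vars V) {var z}) =
    (gen_ideal (edge_vars V) (clique_gens A r W \<union> {var z}) :: (nat edge_var, 'k::field) mpoly set)"
  by (rule gen_ideal_Un[symmetric]) (use clique_gens_polys assms in auto)

lemma clique_gens_subsetI:
  assumes "\<And>w. w \<in> W \<Longrightarrow> var w \<in> I" "\<And>i j. i \<in> A \<Longrightarrow> j \<in> A \<Longrightarrow> r i = r j \<Longrightarrow> minor i j \<in> I"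
  shows "clique_gens A r W \<subseteq> I"
  using assms by (auto simp: clique_gens_def)

lemma clique_data_kill:
  assumes "clique_data V A W" "A' \<subseteq> A" "W \<subseteq> W'" "W' \<subseteq> edge_vars V" "W' \<inter> edge_vars A' = {}"
    and "\<And>i. i \<in> A \<Longrightarrow> i \<notin> A' \<Longrightarrow> XVar i \<in> W' \<or> YVar i \<in> W'"
  shows "clique_data V A' W'"
proof -
  interpret clique_data V A W by (rule assms(1))
  show ?thesis
  proof
    show "XVar i \<in> W' \<or> YVar i \<in> W'" if "i \<in> V" "i \<notin> A'" for i
      using that half[of i] assms(3,6) by (cases "i \<in> A") auto
  qed (use V A assms(2,4,5) in auto)
qed

context clique_data
begin

context
  fixes r :: "nat \<Rightarrow> nat" and v :: nat and C :: "nat set"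
  assumes v: "v \<in> A" and C: "C = {i \<in> A. r i = r v}"
begin

lemma clique_data_delete: "clique_data V (A - {v}) (W \<union> {XVar v, YVar v})"
  by (rule clique_data_kill[OF clique_data_axioms])
     (use v A W A_W in \<open>auto simp: edge_vars_def\<close>)

lemma clique_data_kill_class: "clique_data V (A - C) (W \<union> XVar ` C)"
  by (rule clique_data_kill[OF clique_data_axioms])
     (use C A W A_W in \<open>auto simp: edge_vars_def\<close>)

lemma clique_data_kill_class_and_vertex: "clique_data V (A - C) (W \<union> XVar ` C \<union> {YVar v})"
  by (rule clique_data_kill[OF clique_data_axioms])
     (use v C A W A_W in \<open>auto simp: edge_vars_def\<close>)

text \<open>
  Modulo \<open>x\<^sub>v\<close>, the clique \<open>C\<close> of \<open>v\<close> degenerates to \<open>y\<^sub>v x\<^sub>j = 0\<close> for \<open>j \<in> C\<close>, so that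
  either \<open>v\<close> is deleted or all \<open>x\<^sub>j\<close> vanish.
\<close>

lemma clique_var_Int:
  "gen_ideal (edge_vars V) (clique_gens A r W \<union> {var (XVar v)}) =
    clique_ideal V (A - {v}) r (W \<union> {XVar v, YVar v}) \<inter>
    (clique_ideal V (A - C) r (W \<union> XVar ` C) :: (nat edge_var, 'k::field) mpoly set)"
proof -
  interpret c1: clique_data V "A - {v}" "(W \<union> {XVar v, YVar v})" by (rule clique_data_delete)
  interpret c2: clique_data V "A - C" "(W \<union> XVar ` C)" by (rule clique_data_kill_class)
  let ?X = "edge_vars V"
  let ?I1 = "clique_ideal V (A - {v}) r (W \<union> {XVar v, YVar v}) :: (nat edge_var, 'k) mpoly set"
  let ?I2 = "clique_ideal V (A - C) r (W \<union> XVar ` C) :: (nat edge_var, 'k) mpoly set"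
  let ?B = "clique_gens A r W \<union> {var (XVar v)} :: (nat edge_var, 'k) mpoly set"
  let ?K = "gen_ideal ?X ?B"
  have vV: "v \<in> V" "v \<in> C" using v A C by auto
  have B: "?B \<subseteq> polys ?X" using clique_gens_polys vV by auto
  note K = gen_ideal_ideal[OF B]
  have W_K: "var w \<in> ?K" if "w \<in> W" for w
    using that by (intro gen_ideal_base UnI1 clique_gensI1)
  have x_K: "var (XVar v) \<in> ?K" by (intro gen_ideal_base) simp
  have minor_K: "minor i j \<in> ?K" if "i \<in> A" "j \<in> A" "r i = r j" for i j
    using that by (intro gen_ideal_base UnI1 clique_gensI2)
  have K1: "?K \<subseteq> ?I1"
  proof (rule gen_ideal_subset[OF c1.ideal])
    have vars: "var w \<in> ?I1" if "w \<in> (W \<union> {XVar v, YVar v})" for w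
      using that by (intro gen_ideal_base clique_gensI1)
    have "minor i j \<in> ?I1" if ij: "i \<in> A" "j \<in> A" "r i = r j" for i j
    proof (cases "i = v \<or> j = v")
      case True
      show ?thesis by (rule minor_memI[OF c1.ideal]) (use True vars ij A in auto)
    next
      case False
      then show ?thesis using ij by (intro gen_ideal_base clique_gensI2) auto
    qed
    then have "clique_gens A r W \<subseteq> ?I1"
      using vars by (intro clique_gens_subsetI) auto
    then show "?B \<subseteq> ?I1" using vars by simp
  qed
  have K2: "?K \<subseteq> ?I2"
  proof (rule gen_ideal_subset[OF c2.ideal])
    have vars: "var w \<in> ?I2" if "w \<in> (W \<union> XVar ` C)" for w
      using that by (intro gen_ideal_base clique_gensI1)
    have "minor i j \<in> ?I2" if ij: "i \<in> A" "j \<in> A" "r i = r j" for i j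
    proof (cases "i \<in> C")
      case True
      then have "j \<in> C" using ij C by simp
      then show ?thesis by (intro minor_memI[OF c2.ideal]) (use True vars ij A in auto)
    next
      case False
      then have "j \<notin> C" using ij C by simp
      then show ?thesis using ij False by (intro gen_ideal_base clique_gensI2) auto
    qed
    then have "clique_gens A r W \<subseteq> ?I2"
      using vars by (intro clique_gens_subsetI) auto
    then show "?B \<subseteq> ?I2" using vars vV by simp
  qed
  \<comment> \<open>The generators that matter are the \<open>XVar j\<close> for
    \<open>j \<in> C\<close>: their product with \<open>YVar v\<close> is a minor plus a multiple of
    \<open>XVar v\<close>.\<close>
  have y: "var (YVar v) * h \<in> ?K" if "h \<in> ?I2" for h
    using c2.clique_gens_polys that
  proof (induction rule: gen_ideal_induct)
    case (mult h b)
    then consider w where "w \<in> W" "b = var w" | j where "j \<in> C" "b = var (XVar j)"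
      | i j where "i \<in> A" "j \<in> A" "r i = r j" "b = minor i j"
      unfolding clique_gens_def by blast
    then have "var (YVar v) * b \<in> ?K"
    proof cases
      case 1
      show ?thesis unfolding 1(2) by (rule ideal_mult[OF K W_K]) (use 1 vV in auto)
    next
      case 2
      have "var (YVar v) * b = minor j v + var (YVar j) * var (XVar v)"
        by (simp add: 2(2) minor_def mult.commute)
      also have "\<dots> \<in> ?K"
      proof (rule ideal_add[OF K])
        show "minor j v \<in> ?K" by (rule minor_K) (use 2 C v in auto)
        show "var (YVar j) * var (XVar v) \<in> ?K" by (rule ideal_mult[OF K x_K], rule polys_var) (use 2 C A in auto)
      qed
      finally show ?thesis .
    next
      case 3
      show ?thesis unfolding 3(4) by (rule ideal_mult[OF K minor_K]) (use 3 vV in auto)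
    qed
    from ideal_mult[OF K this mult.hyps(1)] show ?case
      by (simp only: mult.left_commute)
  next
    case zero
    show ?case using ideal_zero[OF K] by simp
  next
    case (add p q)
    from ideal_add[OF K add.IH] show ?case by (simp only: distrib_left)
  qed
  have I1_sub: "?I1 \<subseteq> ideal_plus ?K (gen_ideal ?X {var (YVar v)})"
  proof -
    have iy: "ideal (gen_ideal ?X {var (YVar v) :: (nat edge_var, 'k) mpoly}) (poly_ring ?X)"
      using vV by (intro gen_ideal_ideal) auto
    show ?thesis
    proof (rule gen_ideal_subset[OF ideal_plus_ideal[OF K iy]], rule clique_gens_subsetI)
      fix w assume "w \<in> (W \<union> {XVar v, YVar v})"
      then show "var w \<in> ideal_plus ?K (gen_ideal ?X {var (YVar v)})"
        using W_K x_K ideal_plusI1[OF iy] ideal_plusI2[OF K] gen_ideal_base[of "var (YVar v)"] by blast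
    next
      fix i j assume "i \<in> A - {v}" "j \<in> A - {v}" "r i = r j"
      then show "minor i j \<in> ideal_plus ?K (gen_ideal ?X {var (YVar v)})"
        using minor_K ideal_plusI1[OF iy] by blast
    qed
  qed
  show ?thesis
  proof
    show "?K \<subseteq> ?I1 \<inter> ?I2" using K1 K2 by blast
    show "?I1 \<inter> ?I2 \<subseteq> ?K"
    proof
      fix p assume p: "p \<in> ?I1 \<inter> ?I2"
      have gy: "gen_ideal ?X {var (YVar v) :: (nat edge_var, 'k) mpoly} = {q * var (YVar v) | q. q \<in> polys ?X}"
        using vV by (intro gen_ideal_single) auto
      obtain g h where gh: "p = g + h * var (YVar v)" "g \<in> ?K" "h \<in> polys ?X"
        using p I1_sub unfolding ideal_plus_def gy by blast
      \<comment> \<open>Both \<open>p\<close> and \<open>g\<close> lie in \<open>?I2\<close>, which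
        is prime and does not contain \<open>YVar v\<close>. So \<open>h\<close> lies in
        \<open>?I2\<close>, and \<open>y\<close> brings the product back into
        \<open>?K\<close>.\<close>
      have "h * var (YVar v) = p - g" using gh by simp
      also have "\<dots> \<in> ?I2" using p gh K2 by (intro ideal_diff[OF c2.ideal]) auto
      finally have "h * var (YVar v) \<in> ?I2" .
      then have "h \<in> ?I2 \<or> var (YVar v) \<in> ?I2"
        using vV by (intro c2.prime_mult gh) auto
      moreover have "var (YVar v) \<notin> ?I2"
        by (rule c2.var_not_mem) (use vV v A_W in auto)
      ultimately have "var (YVar v) * h \<in> ?K" using y by blast
      then show "p \<in> ?K" unfolding gh(1) mult.commute[of h] by (rule ideal_add[OF K gh(2)])
    qed
  qed
qed

text \<open>In the sum the whole clique of \<open>v\<close> is gone, and with it one label; this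
  pays for the Mayer-Vietoris step.\<close>

lemma clique_var_plus:
  "ideal_plus (clique_ideal V (A - {v}) r (W \<union> {XVar v, YVar v})) (clique_ideal V (A - C) r (W \<union> XVar ` C)) =
    (clique_ideal V (A - C) r (W \<union> XVar ` C \<union> {YVar v}) :: (nat edge_var, 'k::field) mpoly set)"
proof -
  interpret c1: clique_data V "A - {v}" "(W \<union> {XVar v, YVar v})" by (rule clique_data_delete)
  interpret c2: clique_data V "A - C" "(W \<union> XVar ` C)" by (rule clique_data_kill_class)
  interpret c3: clique_data V "A - C" "(W \<union> XVar ` C \<union> {YVar v})" by (rule clique_data_kill_class_and_vertex)
  let ?G1 = "clique_gens (A - {v}) r (W \<union> {XVar v, YVar v}) :: (nat edge_var, 'k) mpoly set"
  let ?G2 = "clique_gens (A - C) r (W \<union> XVar ` C) :: (nat edge_var, 'k) mpoly set"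
  let ?I3 = "clique_ideal V (A - C) r (W \<union> XVar ` C \<union> {YVar v}) :: (nat edge_var, 'k) mpoly set"
  have vC: "v \<in> C" using v C by auto
  have vars: "var w \<in> ?I3" if "w \<in> (W \<union> XVar ` C \<union> {YVar v})" for w
    using that by (intro gen_ideal_base clique_gensI1)
  have minors: "minor i j \<in> ?I3" if ij: "i \<in> A" "j \<in> A" "r i = r j" for i j
  proof (cases "i \<in> C")
    case True
    then have "j \<in> C" using ij C by simp
    then show ?thesis by (intro minor_memI[OF c3.ideal]) (use True vars ij A in auto)
  next
    case False
    then have "j \<notin> C" using ij C by simp
    then show ?thesis using ij False by (intro gen_ideal_base clique_gensI2) auto
  qed
  have "gen_ideal (edge_vars V) (?G1 \<union> ?G2) = ?I3"
  proof
    have "?G1 \<subseteq> ?I3" by (rule clique_gens_subsetI) (use vars minors vC in auto)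
    moreover have "?G2 \<subseteq> ?I3" by (rule clique_gens_subsetI) (use vars minors in auto)
    ultimately show "gen_ideal (edge_vars V) (?G1 \<union> ?G2) \<subseteq> ?I3"
      by (intro gen_ideal_subset[OF c3.ideal]) simp
    have "clique_gens (A - C) r (W \<union> XVar ` C \<union> {YVar v}) \<subseteq> ?G1 \<union> ?G2"
      by (rule clique_gens_subsetI) (auto intro: clique_gensI1 clique_gensI2)
    then show "?I3 \<subseteq> gen_ideal (edge_vars V) (?G1 \<union> ?G2)" by (rule gen_ideal_mono)
  qed
  then show ?thesis
    by (simp only: gen_ideal_Un[OF c1.clique_gens_polys c2.clique_gens_polys])
qed

end

end

text \<open>Each clique with an edge costs \<open>1\<close>. Since the ideal is prime,
  \<open>XVar v\<close> is a nonzerodivisor and may be added; the result is the intersection in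
  \<open>clique_var_Int\<close>, and the corresponding sum has one label fewer. Once there are no
  edges, the remaining variables are added one at a time.\<close>

lemma reg_le_clique_ideal:
  fixes r :: "nat \<Rightarrow> nat"
  assumes "clique_data V A W"
  shows "reg_le (edge_vars V) (clique_ideal V A r W :: (nat edge_var, 'k::field) mpoly set)
    (card (multi_labels A r))"
  using assms
proof (induction "card (edge_vars V - W)" arbitrary: A W rule: less_induct)
  case less
  interpret clique_data V A W by (rule less.prems)
  let ?X = "edge_vars V"
  have X: "finite ?X" using V by simp
  have A_fin: "finite A" using V A finite_subset by blast
  have decr: "card (?X - W') < card (?X - W)" if "W \<subseteq> W'" "z \<in> W'" "z \<in> ?X" "z \<notin> W" for W' z
    using that X by (intro psubset_card_mono) auto
  have nzd: "reg_le ?X (clique_ideal V A r W :: (nat edge_var, 'k) mpoly set) b"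
    if z: "z \<in> ?X" "z \<notin> W" and reg: "reg_le ?X
      (gen_ideal ?X (clique_gens A r W \<union> {var z}) :: (nat edge_var, 'k) mpoly set) b" for z b
  proof (rule reg_le_nonzerodivisor[OF X homogeneous z(1)])
    fix p :: "(nat edge_var, 'k) mpoly"
    assume "p \<in> polys ?X" "var z * p \<in> clique_ideal V A r W"
    then have "var z \<in> (clique_ideal V A r W :: (nat edge_var, 'k) mpoly set) \<or> p \<in> clique_ideal V A r W"
      using z by (intro prime_mult) auto
    then show "p \<in> clique_ideal V A r W" using var_not_mem[OF z] by blast
  next
    show "reg_le ?X (ideal_plus (clique_ideal V A r W)
        (gen_ideal ?X {var z}) :: (nat edge_var, 'k) mpoly set) b"
      using reg unfolding ideal_plus_clique_var[OF z(1)] .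
  qed
  show ?case
  proof (cases "multi_labels A r = {}")
    case False
    then obtain v u where vu: "v \<in> A" "u \<in> A" "v \<noteq> u" "r u = r v"
      unfolding multi_labels_def by force
    define C where "C = {i \<in> A. r i = r v}"
    have z: "XVar v \<in> ?X" "XVar v \<notin> W" "YVar v \<notin> W" using vu A A_W by auto
    have vC: "v \<in> C" using vu by (simp add: C_def)
    note d1 = clique_data_delete[OF vu(1) C_def] and d2 = clique_data_kill_class[OF vu(1) C_def] and d3 = clique_data_kill_class_and_vertex[OF vu(1) C_def]
    have "r v \<in> multi_labels A r" using vu unfolding multi_labels_def by blast
    moreover have "multi_labels (A - C) r = multi_labels A r - {r v}"
    proof (rule Set.set_eqI)
      fix c
      have "c \<in> multi_labels (A - C) r \<longleftrightarrow> c \<in> multi_labels A r" if "c \<noteq> r v"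
      proof -
        have "i \<in> A - C" if "i \<in> A" "r i = c" for i
          using that \<open>c \<noteq> r v\<close> by (simp add: C_def)
        then show ?thesis unfolding multi_labels_def mem_Collect_eq by (metis DiffD1)
      qed
      moreover have "r v \<notin> multi_labels (A - C) r"
        by (simp add: multi_labels_def C_def)
      ultimately show "c \<in> multi_labels (A - C) r \<longleftrightarrow> c \<in> multi_labels A r - {r v}" by blast
    qed
    ultimately obtain b where b: "card (multi_labels A r) = Suc b" "card (multi_labels (A - C) r) = b"
      using finite_multi_labels[OF A_fin, of r] by (metis card_Suc_Diff1)
    have "card (multi_labels (A - {v}) r) \<le> Suc b"
      using card_mono[OF finite_multi_labels[OF A_fin] multi_labels_mono[of "A - {v}" A r]] b by simp
    moreover have "reg_le ?X (clique_ideal V (A - {v}) r (W \<union> {XVar v, YVar v}) :: (nat edge_var, 'k) mpoly set)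
        (card (multi_labels (A - {v}) r))"
      by (rule less.hyps[OF decr d1]) (use z in auto)
    ultimately have r1: "reg_le ?X (clique_ideal V (A - {v}) r (W \<union> {XVar v, YVar v}) ::
        (nat edge_var, 'k) mpoly set) (Suc b)"
      by (rule reg_le_mono[rotated])
    have "reg_le ?X (clique_ideal V (A - C) r (W \<union> XVar ` C) :: (nat edge_var, 'k) mpoly set)
        (card (multi_labels (A - C) r))"
      by (rule less.hyps[OF decr d2]) (use z vC in auto)
    then have r2: "reg_le ?X (clique_ideal V (A - C) r (W \<union> XVar ` C) :: (nat edge_var, 'k) mpoly set) (Suc b)"
      by (rule reg_le_mono) (simp add: b)
    have "reg_le ?X (clique_ideal V (A - C) r (W \<union> XVar ` C \<union> {YVar v}) :: (nat edge_var, 'k) mpoly set)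
        (card (multi_labels (A - C) r))"
      by (rule less.hyps[OF decr d3]) (use z vC in auto)
    then have r3: "reg_le ?X (clique_ideal V (A - C) r (W \<union> XVar ` C \<union> {YVar v}) ::
        (nat edge_var, 'k) mpoly set) b"
      by (simp only: b)
    have "reg_le ?X (clique_ideal V (A - {v}) r (W \<union> {XVar v, YVar v}) \<inter>
        clique_ideal V (A - C) r (W \<union> XVar ` C) :: (nat edge_var, 'k) mpoly set) (Suc b)"
      by (rule reg_le_Int[OF X clique_data.homogeneous[OF d1] clique_data.homogeneous[OF d2] r1 r2])
         (simp only: clique_var_plus[OF vu(1) C_def] r3)
    then show ?thesis
      unfolding b(1) clique_var_Int[OF vu(1) C_def, symmetric] by (rule nzd[OF z(1,2)])
  next
    case True
    show ?thesis
    proof (cases "?X \<subseteq> W")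
      case True
      then have "reg_le ?X (clique_ideal V A r W :: (nat edge_var, 'k) mpoly set) 0"
        by (intro reg_le_maximal[OF ideal] gen_ideal_base clique_gensI1) auto
      then show ?thesis by (rule reg_le_mono) simp
    next
      case False
      then obtain z where z: "z \<in> ?X" "z \<notin> W" by blast
      then obtain i where i: "i \<in> V" "z = XVar i \<or> z = YVar i" by (auto simp: edge_vars_def)
      have d: "clique_data V (A - {i}) (insert z W)"
        by (rule clique_data_kill[OF clique_data_axioms])
           (use i z A W A_W in \<open>auto simp: edge_vars_def\<close>)
      have minors: "a = b" if "a \<in> A" "b \<in> A" "r a = r b" for a b
        using that True unfolding multi_labels_def by blast
      let ?G = "clique_gens A r W \<union> {var z} :: (nat edge_var, 'k) mpoly set"
      let ?G' = "clique_gens (A - {i}) r (insert z W) :: (nat edge_var, 'k) mpoly set"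
      have G: "?G \<subseteq> polys ?X" using clique_gens_polys z by auto
      have "gen_ideal ?X ?G = gen_ideal ?X ?G'"
      proof
        have "clique_gens A r W \<subseteq> gen_ideal ?X ?G'"
        proof (rule clique_gens_subsetI)
          fix a b assume "a \<in> A" "b \<in> A" "r a = r b"
          then have "a = b" by (rule minors)
          then show "minor a b \<in> gen_ideal ?X ?G'"
            using ideal_zero[OF clique_data.ideal[OF d]] by simp
        qed (auto intro: gen_ideal_base clique_gensI1)
        then show "gen_ideal ?X ?G \<subseteq> gen_ideal ?X ?G'"
          by (intro gen_ideal_subset[OF clique_data.ideal[OF d]]) (auto intro: gen_ideal_base clique_gensI1)
        have "?G' \<subseteq> ?G"
          by (rule clique_gens_subsetI) (auto intro: clique_gensI1 clique_gensI2)
        then show "gen_ideal ?X ?G' \<subseteq> gen_ideal ?X ?G" by (rule gen_ideal_mono)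
      qed
      moreover have "reg_le ?X (gen_ideal ?X ?G') (card (multi_labels (A - {i}) r))"
        by (rule less.hyps[OF decr d]) (use z in auto)
      moreover have "multi_labels (A - {i}) r = multi_labels A r"
        using True multi_labels_mono[of "A - {i}" A r] by auto
      ultimately show ?thesis by (intro nzd[OF z]) simp
    qed
  qed
qed

section \<open>Deleting a vertex or completing its neighbourhood\<close>

text \<open>\<open>U\<close> collects the deleted vertices. Their variables are added to the ideal
  instead of leaving the ring, so all graphs of the induction live over the same ring, and minors at
  \<open>U\<close> are redundant.\<close>

definition graph_gens ::
    "'v set \<Rightarrow> 'v set \<Rightarrow> ('v \<Rightarrow> 'v \<Rightarrow> bool) \<Rightarrow> ('v edge_var, 'k::field) mpoly set" where
  "graph_gens V U adj = var ` edge_vars U \<union> {minor i j | i j. i \<in> V \<and> j \<in> V \<and> adj i j}"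

abbreviation graph_ideal ::
    "'v set \<Rightarrow> 'v set \<Rightarrow> ('v \<Rightarrow> 'v \<Rightarrow> bool) \<Rightarrow> ('v edge_var, 'k::field) mpoly set" where
  "graph_ideal V U adj \<equiv> gen_ideal (edge_vars V) (graph_gens V U adj)"

lemma graph_gensI1: "w \<in> edge_vars U \<Longrightarrow> var w \<in> graph_gens V U adj"
  and graph_gensI2: "i \<in> V \<Longrightarrow> j \<in> V \<Longrightarrow> adj i j \<Longrightarrow> minor i j \<in> graph_gens V U adj"
  unfolding graph_gens_def by blast+

lemma graph_gensE:
  assumes "b \<in> graph_gens V U adj"
  obtains (var) w where "w \<in> edge_vars U" "b = var w"
    | (minor) i j where "i \<in> V" "j \<in> V" "adj i j" "b = minor i j"
  using assms unfolding graph_gens_def by blast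

lemma graph_gens_subsetI:
  assumes "\<And>w. w \<in> edge_vars U \<Longrightarrow> var w \<in> I"
    and "\<And>i j. i \<in> V \<Longrightarrow> j \<in> V \<Longrightarrow> adj i j \<Longrightarrow> minor i j \<in> I"
  shows "graph_gens V U adj \<subseteq> I"
  using assms by (auto simp: graph_gens_def)

lemma edge_vars_mono: "U \<subseteq> V \<Longrightarrow> edge_vars U \<subseteq> edge_vars V"
  by (auto simp: edge_vars_def)

lemma graph_gens_polys: "U \<subseteq> V \<Longrightarrow> graph_gens V U adj \<subseteq> polys (edge_vars V)"
  by (rule graph_gens_subsetI) (auto intro: polys_var minor_polys dest: subsetD[OF edge_vars_mono])

lemma graph_ideal: "U \<subseteq> V \<Longrightarrow> ideal (graph_ideal V U adj) (poly_ring (edge_vars V))"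
  by (rule gen_ideal_ideal[OF graph_gens_polys])

lemma homogeneous_graph_ideal: "U \<subseteq> V \<Longrightarrow> homogeneous_ideal (edge_vars V) (graph_ideal V U adj)"
proof (rule homogeneous_ideal_gen)
  fix b assume "U \<subseteq> V" "b \<in> graph_gens V U adj"
  from this(2) show "\<exists>e. b \<in> homogeneous_part (edge_vars V) e"
  proof (cases rule: graph_gensE)
    case (var w)
    show ?thesis unfolding var(2)
      by (rule exI, rule homogeneous_var) (use var edge_vars_mono[OF \<open>U \<subseteq> V\<close>] in auto)
  next
    case (minor i j)
    show ?thesis unfolding minor(4) by (rule exI, rule minor_homogeneous) (use minor in auto)
  qed
qed

section \<open>Setting the variables of a vertex to zero\<close>

definition without_vertex :: "'v \<Rightarrow> ('v edge_var, 'k::field) mpoly \<Rightarrow> ('v edge_var, 'k) mpoly" where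
  "without_vertex v = restrict_monoms (\<lambda>m. XVar v \<notin> keys m \<and> YVar v \<notin> keys m)"

lemma without_vertex_zero [simp]: "without_vertex v 0 = 0"
  by (simp add: without_vertex_def)

lemma without_vertex_add: "without_vertex v (p + q) = without_vertex v p + without_vertex v q"
  by (simp add: without_vertex_def restrict_monoms_add)

lemma without_vertex_polys: "p \<in> polys X \<Longrightarrow> without_vertex v p \<in> polys X"
  by (simp add: without_vertex_def restrict_monoms_polys)

lemma restrict_monoms_False: "restrict_monoms (\<lambda>_. False) p = 0"
  by (rule poly_mapping_eqI) (simp add: lookup_restrict_monoms)

lemma without_vertex_mult_other:
  assumes "\<And>a. a \<in> keys b \<Longrightarrow> XVar v \<notin> keys a \<and> YVar v \<notin> keys a"
  shows "without_vertex v (h * b) = without_vertex v h * b"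
  unfolding without_vertex_def
  by (rule restrict_monoms_mult) (use assms in \<open>auto simp: keys_add_monom\<close>)

lemma without_vertex_mult_same:
  assumes "\<And>a. a \<in> keys b \<Longrightarrow> XVar v \<in> keys a \<or> YVar v \<in> keys a"
  shows "without_vertex v (h * b) = 0"
proof -
  have "without_vertex v (h * b) = restrict_monoms (\<lambda>_. False) h * b"
    unfolding without_vertex_def
    by (rule restrict_monoms_mult) (use assms in \<open>auto simp: keys_add_monom\<close>)
  then show ?thesis by (simp add: restrict_monoms_False)
qed

lemma keys_minor_subset:
  "keys (minor i j :: ('v edge_var, 'k::field) mpoly) \<subseteq>
    {single (XVar i) 1 + single (YVar j) 1, single (XVar j) 1 + single (YVar i) 1}"
proof -
  have "keys (minor i j :: ('v edge_var, 'k) mpoly) \<subseteq>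
      keys (single (single (XVar i) (1::nat) + single (YVar j) 1) (1::'k)) \<union>
      keys (single (single (XVar j) (1::nat) + single (YVar i) 1) (1::'k))"
    unfolding minor_def var_def mult_single mult_1_left by (rule keys_diff)
  then show ?thesis by (simp add: insert_commute)
qed

lemma without_vertex_minor_other:
  assumes "i \<noteq> v" "j \<noteq> v"
  shows "without_vertex v (h * minor i j) = without_vertex v h * minor i j"
proof (rule without_vertex_mult_other)
  fix a assume "a \<in> keys (minor i j :: ('a edge_var, 'b) mpoly)"
  then have "a = single (XVar i) 1 + single (YVar j) 1 \<or> a = single (XVar j) 1 + single (YVar i) 1"
    by (rule subsetD[OF keys_minor_subset, THEN insertE]) simp_all
  then show "XVar v \<notin> keys a \<and> YVar v \<notin> keys a"
    using assms by (auto simp: keys_add_monom)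
qed

lemma without_vertex_minor_same:
  assumes "i = v \<or> j = v"
  shows "without_vertex v (h * minor i j) = 0"
proof (rule without_vertex_mult_same)
  fix a assume "a \<in> keys (minor i j :: ('a edge_var, 'b) mpoly)"
  then have "a = single (XVar i) 1 + single (YVar j) 1 \<or> a = single (XVar j) 1 + single (YVar i) 1"
    by (rule subsetD[OF keys_minor_subset, THEN insertE]) simp_all
  then show "XVar v \<in> keys a \<or> YVar v \<in> keys a"
    using assms by (auto simp: keys_add_monom)
qed

lemma without_vertex_var_other:
  "w \<noteq> XVar v \<Longrightarrow> w \<noteq> YVar v \<Longrightarrow> without_vertex v (h * var w) = without_vertex v h * var w"
  by (rule without_vertex_mult_other) (auto simp: var_def)

lemma without_vertex_var_same:
  "w = XVar v \<or> w = YVar v \<Longrightarrow> without_vertex v (h * var w) = 0"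
  by (rule without_vertex_mult_same) (auto simp: var_def)

definition closed_nbhd :: "'v set \<Rightarrow> ('v \<Rightarrow> 'v \<Rightarrow> bool) \<Rightarrow> 'v \<Rightarrow> 'v set" where
  "closed_nbhd A adj v = insert v {j \<in> A. adj v j}"

text \<open>This puts loops on the closed neighbourhood, which are harmless because
  \<open>minor i i = 0\<close>.\<close>

definition complete_nbhd :: "'v set \<Rightarrow> ('v \<Rightarrow> 'v \<Rightarrow> bool) \<Rightarrow> 'v \<Rightarrow> 'v \<Rightarrow> 'v \<Rightarrow> bool" where
  "complete_nbhd A adj v i j \<longleftrightarrow> adj i j \<or> i \<in> closed_nbhd A adj v \<and> j \<in> closed_nbhd A adj v"

context
  fixes V U :: "'v set" and adj :: "'v \<Rightarrow> 'v \<Rightarrow> bool" and v :: 'v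
  assumes U: "U \<subseteq> V" and v: "v \<in> V" "v \<notin> U" and sym: "\<And>i j. adj i j \<Longrightarrow> adj j i"
begin

lemma insert_vertex_subset: "insert v U \<subseteq> V"
  using U v by blast

text \<open>Setting both variables of \<open>v\<close> to \<open>0\<close> kills the generators that
  involve \<open>v\<close> and fixes the others, which are generators for \<open>U\<close> as
  well.\<close>

lemma without_vertex_deleted:
  fixes p :: "('v edge_var, 'k::field) mpoly"
  assumes "p \<in> graph_ideal V (insert v U) adj"
  shows "without_vertex v p \<in> graph_ideal V U adj"
  using graph_gens_polys[OF insert_vertex_subset] assms
proof (induction rule: gen_ideal_induct)
  case (mult h b)
  note J = graph_ideal[OF U, of adj]
  from mult(2) show ?case
  proof (cases rule: graph_gensE)
    case (var w)
    show ?thesis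
    proof (cases "w = XVar v \<or> w = YVar v")
      case True
      then show ?thesis using ideal_zero[OF J] by (simp add: var(2) without_vertex_var_same)
    next
      case False
      then have w: "w \<in> edge_vars U" using var(1) by (auto simp: edge_vars_def)
      have "without_vertex v h * var w \<in> graph_ideal V U adj"
        by (rule ideal_mult[OF J gen_ideal_base[OF graph_gensI1[OF w]] without_vertex_polys[OF mult(1)]])
      then show ?thesis using False by (simp add: var(2) without_vertex_var_other)
    qed
  next
    case (minor i j)
    show ?thesis
    proof (cases "i = v \<or> j = v")
      case True
      then show ?thesis using ideal_zero[OF J] by (simp add: minor(4) without_vertex_minor_same)
    next
      case False
      have "without_vertex v h * minor i j \<in> graph_ideal V U adj"
        by (rule ideal_mult[OF J gen_ideal_base[OF graph_gensI2[of i V j adj, OF minor(1,2,3)]]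
              without_vertex_polys[OF mult(1)]])
      then show ?thesis using False by (simp add: minor(4) without_vertex_minor_other)
    qed
  qed
next
  case zero
  show ?case using ideal_zero[OF graph_ideal[OF U]] by simp
next
  case (add p q)
  from ideal_add[OF graph_ideal[OF U] add.IH] show ?case by (simp only: without_vertex_add)
qed

text \<open>These are instances of Pluecker relations.\<close>

lemma var_times_new_minor:
  assumes jk: "j \<in> closed_nbhd (V - U) adj v - {v}" "k \<in> closed_nbhd (V - U) adj v - {v}" and z: "z = XVar v \<or> z = YVar v"
  shows "var z * minor j k \<in> (graph_ideal V U adj :: ('v edge_var, 'k::field) mpoly set)"
proof -
  let ?J = "graph_ideal V U adj :: ('v edge_var, 'k) mpoly set"
  note J = graph_ideal[OF U, of adj]
  have mem: "minor v j \<in> ?J" "minor v k \<in> ?J" "j \<in> V" "k \<in> V"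
    using jk v by (auto simp: closed_nbhd_def intro!: gen_ideal_base graph_gensI2)
  have comb: "p * minor v k - q * minor v j \<in> ?J"
    if "p \<in> polys (edge_vars V)" "q \<in> polys (edge_vars V)" for p q
    using that mem by (intro ideal_diff[OF J] ideal_mult[OF J])
  show ?thesis
  proof (cases "z = XVar v")
    case True
    have "var (XVar j) * minor v k - var (XVar k) * minor v j \<in> ?J"
      by (rule comb; rule polys_var) (use mem in simp_all)
    moreover have "var z * minor j k = (var (XVar j) * minor v k - var (XVar k) * minor v j ::
        ('v edge_var, 'k) mpoly)"
      by (simp add: True minor_def algebra_simps)
    ultimately show ?thesis by simp
  next
    case False
    have "var (YVar j) * minor v k - var (YVar k) * minor v j \<in> ?J"
      by (rule comb; rule polys_var) (use mem in simp_all)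
    moreover have "var z * minor j k = (var (YVar j) * minor v k - var (YVar k) * minor v j ::
        ('v edge_var, 'k) mpoly)"
      using False z by (simp add: minor_def algebra_simps)
    ultimately show ?thesis by simp
  qed
qed

text \<open>In a multiple \<open>h * b\<close> of a new minor \<open>b\<close>, the terms of
  \<open>h\<close> that are removed contain a variable of \<open>v\<close>, and such a variable
  times \<open>b\<close> is in the old ideal by \<open>var_times_new_minor\<close>. For an old
  generator, \<open>h * b\<close> and its restriction are both in the ideal.\<close>

lemma without_vertex_completed:
  fixes p :: "('v edge_var, 'k::field) mpoly"
  assumes "p \<in> graph_ideal V U (complete_nbhd (V - U) adj v)"
  shows "p - without_vertex v p \<in> graph_ideal V U adj"
  using graph_gens_polys[OF U] assms
proof (induction rule: gen_ideal_induct)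
  case (mult h b)
  let ?J = "graph_ideal V U adj :: ('v edge_var, 'k) mpoly set"
  note J = graph_ideal[OF U, of adj]
  have old: "h * b - without_vertex v (h * b) \<in> ?J"
    if "b \<in> ?J" "without_vertex v (h * b) = 0 \<or> without_vertex v (h * b) = without_vertex v h * b"
    using that mult(1) ideal_mult[OF J that(1)] without_vertex_polys[OF mult(1)]
    by (auto intro: ideal_diff[OF J])
  from mult(2) show ?case
  proof (cases rule: graph_gensE)
    case (var w)
    show ?thesis
    proof (rule old)
      show "b \<in> ?J" unfolding var(2) by (rule gen_ideal_base[OF graph_gensI1[OF var(1)]])
      have "w \<noteq> XVar v" "w \<noteq> YVar v" using var(1) v(2) by auto
      then show "without_vertex v (h * b) = 0 \<or> without_vertex v (h * b) = without_vertex v h * b"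
        by (simp add: var(2) without_vertex_var_other)
    qed
  next
    case (minor i j)
    show ?thesis
    proof (cases "adj i j \<or> i = v \<or> j = v")
      case True
      show ?thesis
      proof (rule old)
        show "without_vertex v (h * b) = 0 \<or> without_vertex v (h * b) = without_vertex v h * b"
          unfolding minor(4)
          by (cases "i = v \<or> j = v") (simp_all add: without_vertex_minor_other without_vertex_minor_same)
        \<comment> \<open>Completion creates no edge at \<open>v\<close> except a loop, since the
          neighbours are adjacent to \<open>v\<close> already.\<close>
        have "i = j \<or> adj i j"
          using True minor(3) sym by (auto simp: complete_nbhd_def closed_nbhd_def)
        then show "b \<in> ?J"
        proof
          assume "i = j"
          then show ?thesis using ideal_zero[OF J] by (simp add: minor(4))
        next
          assume "adj i j"
          then show ?thesis unfolding minor(4)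
            using minor(1,2) by (intro gen_ideal_base graph_gensI2)
        qed
      qed
    next
      case False
      then have ij: "i \<in> closed_nbhd (V - U) adj v - {v}" "j \<in> closed_nbhd (V - U) adj v - {v}"
        using minor(3) by (auto simp: complete_nbhd_def)
      have "(h - without_vertex v h) * minor i j \<in> ?J"
      proof (rule poly_mapping_closure[where p = h])
        fix p q :: "('v edge_var, 'k) mpoly"
        assume "(p - without_vertex v p) * minor i j \<in> ?J" "(q - without_vertex v q) * minor i j \<in> ?J"
        from ideal_add[OF J this]
        show "(p + q - without_vertex v (p + q)) * minor i j \<in> ?J"
          by (simp add: without_vertex_add algebra_simps)
      next
        fix m assume m: "m \<in> keys h"
        show "(single m (lookup h m) - without_vertex v (single m (lookup h m))) * minor i j \<in> ?J"
        proof (cases "XVar v \<notin> keys m \<and> YVar v \<notin> keys m")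
          case True
          then show ?thesis
            using ideal_zero[OF J] by (simp add: without_vertex_def restrict_monoms_single)
        next
          case False
          then obtain z where z: "z \<in> keys m" "z = XVar v \<or> z = YVar v" by blast
          have "single (m - single z 1) (lookup h m) * (var z * minor i j) \<in> ?J"
          proof (rule ideal_mult[OF J var_times_new_minor[OF ij z(2)]])
            show "single (m - single z 1) (lookup h m) \<in> polys (edge_vars V)"
              using m mult(1) keys_minus_single[of m z] by (intro polys_single) (auto simp: polys_iff)
          qed
          then have "single m (lookup h m) * minor i j \<in> ?J"
            by (simp only: mult.assoc[symmetric] single_split_var[OF z(1), symmetric])
          then show ?thesis using False by (auto simp: without_vertex_def restrict_monoms_single)
        qed
      qed (use ideal_zero[OF J] in simp)
      then show ?thesis
        using False by (simp add: minor(4) without_vertex_minor_other left_diff_distrib)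
    qed
  qed
next
  case zero
  show ?case using ideal_zero[OF graph_ideal[OF U]] by simp
next
  case (add p q)
  from ideal_add[OF graph_ideal[OF U] add.IH] show ?case
    by (simp add: without_vertex_add algebra_simps)
qed

text \<open>An element \<open>p\<close> of the intersection is the sum of
  \<open>p - without_vertex v p\<close> and \<open>without_vertex v p\<close>. The first is in the
  ideal because \<open>p\<close> belongs to the completed graph, the second because \<open>p\<close>
  belongs to the graph without \<open>v\<close>.\<close>

lemma graph_ideal_Int:
  "graph_ideal V U adj = graph_ideal V U (complete_nbhd (V - U) adj v) \<inter>
    (graph_ideal V (insert v U) adj :: ('v edge_var, 'k::field) mpoly set)"
proof
  have "graph_gens V U adj \<subseteq> (graph_gens V U (complete_nbhd (V - U) adj v) :: ('v edge_var, 'k) mpoly set)"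
    by (rule graph_gens_subsetI) (auto intro: graph_gensI1 graph_gensI2 simp: complete_nbhd_def)
  moreover have "graph_gens V U adj \<subseteq> (graph_gens V (insert v U) adj :: ('v edge_var, 'k) mpoly set)"
    by (rule graph_gens_subsetI) (auto intro!: graph_gensI1 graph_gensI2 simp: edge_vars_def)
  ultimately show "graph_ideal V U adj \<subseteq> graph_ideal V U (complete_nbhd (V - U) adj v) \<inter>
      (graph_ideal V (insert v U) adj :: ('v edge_var, 'k) mpoly set)"
    using gen_ideal_mono by blast
  show "graph_ideal V U (complete_nbhd (V - U) adj v) \<inter> graph_ideal V (insert v U) adj \<subseteq>
      (graph_ideal V U adj :: ('v edge_var, 'k) mpoly set)"
  proof
    fix p :: "('v edge_var, 'k) mpoly"
    assume "p \<in> graph_ideal V U (complete_nbhd (V - U) adj v) \<inter> graph_ideal V (insert v U) adj"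
    then show "p \<in> graph_ideal V U adj"
      using without_vertex_completed[of p] without_vertex_deleted[of p]
        ideal_cong[OF graph_ideal[OF U]] by blast
  qed
qed

lemma graph_ideal_plus:
  "ideal_plus (graph_ideal V U (complete_nbhd (V - U) adj v)) (graph_ideal V (insert v U) adj) =
    (graph_ideal V (insert v U) (complete_nbhd (V - U) adj v) :: ('v edge_var, 'k::field) mpoly set)"
proof -
  have "graph_gens V U (complete_nbhd (V - U) adj v) \<union> graph_gens V (insert v U) adj =
      (graph_gens V (insert v U) (complete_nbhd (V - U) adj v) :: ('v edge_var, 'k) mpoly set)"
    by (auto simp: graph_gens_def complete_nbhd_def edge_vars_def)
  then show ?thesis
    by (simp only: gen_ideal_Un[OF graph_gens_polys[OF U] graph_gens_polys[OF insert_vertex_subset], symmetric])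
qed

end

lemma reg_le_graph_ideal_step:
  fixes adj :: "'v::linorder \<Rightarrow> 'v \<Rightarrow> bool"
  assumes V: "finite V" and U: "U \<subseteq> V" and v: "v \<in> V" "v \<notin> U" and sym: "\<And>i j. adj i j \<Longrightarrow> adj j i"
    and "reg_le (edge_vars V) (graph_ideal V U (complete_nbhd (V - U) adj v) ::
      ('v edge_var, 'k::field) mpoly set) (Suc b)"
    and "reg_le (edge_vars V) (graph_ideal V (insert v U) adj :: ('v edge_var, 'k) mpoly set) (Suc b)"
    and "reg_le (edge_vars V) (graph_ideal V (insert v U) (complete_nbhd (V - U) adj v) ::
      ('v edge_var, 'k) mpoly set) b"
  shows "reg_le (edge_vars V) (graph_ideal V U adj :: ('v edge_var, 'k) mpoly set) (Suc b)"
proof -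
  have "insert v U \<subseteq> V" using U v by simp
  note hom = homogeneous_graph_ideal[OF U] homogeneous_graph_ideal[OF this]
  have "reg_le (edge_vars V) (graph_ideal V U (complete_nbhd (V - U) adj v) \<inter>
      (graph_ideal V (insert v U) adj :: ('v edge_var, 'k) mpoly set)) (Suc b)"
    by (rule reg_le_Int[OF finite_edge_vars[OF V] hom assms(6,7)])
       (simp only: graph_ideal_plus[of U V v adj, OF U v sym] assms(8))
  then show ?thesis
    by (simp only: graph_ideal_Int[of U V v adj, OF U v sym, symmetric])
qed

section \<open>Bounding the regularity by a decomposition of the graph\<close>

text \<open>
  Every edge lies in a block (a fibre of \<open>\<rho>\<close>, not necessarily connected), in one of the cliques
  in \<open>NN\<close>, or in a star centred in \<open>S\<close>. These contribute the number of vertices minus the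
  number of blocks, \<open>1\<close> per clique and \<open>2\<close> per star.
\<close>

definition covers :: "'v set \<Rightarrow> ('v \<Rightarrow> 'v \<Rightarrow> bool) \<Rightarrow> ('v \<Rightarrow> 'c) \<Rightarrow> 'v set set \<Rightarrow> 'v set \<Rightarrow> bool" where
  "covers A adj \<rho> NN S \<longleftrightarrow>
     (\<forall>i\<in>A. \<forall>j\<in>A. adj i j \<longrightarrow> \<rho> i = \<rho> j \<or> (\<exists>N\<in>NN. i \<in> N \<and> j \<in> N) \<or> i \<in> S \<or> j \<in> S) \<and>
     (\<forall>N\<in>NN. \<forall>i\<in>N \<inter> A. \<forall>j\<in>N \<inter> A. i \<noteq> j \<longrightarrow> adj i j)"

lemma covers_edge:
  "covers A adj \<rho> NN S \<Longrightarrow> i \<in> A \<Longrightarrow> j \<in> A \<Longrightarrow> adj i j \<Longrightarrow>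
    \<rho> i = \<rho> j \<or> (\<exists>N\<in>NN. i \<in> N \<and> j \<in> N) \<or> i \<in> S \<or> j \<in> S"
  by (simp add: covers_def)

lemma covers_clique:
  "covers A adj \<rho> NN S \<Longrightarrow> N \<in> NN \<Longrightarrow> i \<in> N \<Longrightarrow> i \<in> A \<Longrightarrow> j \<in> N \<Longrightarrow> j \<in> A \<Longrightarrow> i \<noteq> j \<Longrightarrow> adj i j"
  by (simp add: covers_def)

text \<open>This is the height of the ideal generated by all minors inside the blocks.\<close>

definition block_excess :: "'v set \<Rightarrow> ('v \<Rightarrow> 'c) \<Rightarrow> nat" where
  "block_excess A \<rho> = card A - card (\<rho> ` A)"

lemma block_excess_delete:
  assumes "finite A" "v \<in> A"
  shows "block_excess (A - {v}) \<rho> \<le> block_excess A \<rho>"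
proof -
  have "\<rho> ` A = insert (\<rho> v) (\<rho> ` (A - {v}))" using assms by auto
  then have "card (\<rho> ` A) \<le> Suc (card (\<rho> ` (A - {v})))"
    using assms card_insert_le_m1[of "Suc (card (\<rho> ` (A - {v})))" "\<rho> ` (A - {v})" "\<rho> v"] by simp
  moreover have "card A = Suc (card (A - {v}))"
    using card.remove[OF assms] .
  ultimately show ?thesis unfolding block_excess_def by linarith
qed

text \<open>The block survives the deletion through \<open>j\<close>, so the number of vertices
  drops and the number of blocks does not.\<close>

lemma block_excess_delete_less:
  assumes A: "finite A" "v \<in> A" and j: "j \<in> A" "j \<noteq> v" "\<rho> j = \<rho> v"
  shows "block_excess (A - {v}) \<rho> < block_excess A \<rho>"
proof -
  have "\<rho> v \<in> \<rho> ` (A - {v})" using j by (intro image_eqI[of _ _ j]) auto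
  moreover have "\<rho> ` A = insert (\<rho> v) (\<rho> ` (A - {v}))" using A by auto
  ultimately have eq: "\<rho> ` (A - {v}) = \<rho> ` A" by auto
  have "card (\<rho> ` (A - {v})) \<le> card (A - {v})"
    using A by (intro card_image_le) auto
  moreover have "card A = Suc (card (A - {v}))"
    using card.remove[OF A] .
  ultimately show ?thesis unfolding block_excess_def eq by linarith
qed

section \<open>Covers under deletion and completion\<close>

lemma covers_delete: "covers A adj \<rho> NN S \<Longrightarrow> covers (A - {v}) adj \<rho> NN (S - {v})"
  unfolding covers_def by blast

lemma complete_nbhd_sym:
  "(\<And>i j. adj i j \<Longrightarrow> adj j i) \<Longrightarrow> complete_nbhd A adj v i j \<Longrightarrow> complete_nbhd A adj v j i"
  by (auto simp: complete_nbhd_def)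

text \<open>The edges at \<open>v\<close> and all new edges lie in the closed neighbourhood, which
  is now a clique; so a star is traded for a clique.\<close>

lemma covers_complete_star:
  assumes cov: "covers A adj \<rho> NN S" and v: "v \<in> A" and sym: "\<And>i j. adj i j \<Longrightarrow> adj j i"
  shows "covers A (complete_nbhd A adj v) \<rho> (insert (closed_nbhd A adj v) NN) (S - {v})"
proof -
  let ?N = "closed_nbhd A adj v"
  have "\<rho> i = \<rho> j \<or> (\<exists>N\<in>insert ?N NN. i \<in> N \<and> j \<in> N) \<or> i \<in> S - {v} \<or> j \<in> S - {v}"
    if ij: "i \<in> A" "j \<in> A" "complete_nbhd A adj v i j" for i j
  proof (cases "i \<in> ?N \<and> j \<in> ?N")
    case False
    then have adj: "adj i j" using ij unfolding complete_nbhd_def by blast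
    then have "i \<noteq> v" "j \<noteq> v" using False ij sym[OF adj] by (auto simp: closed_nbhd_def)
    then show ?thesis using cov adj ij unfolding covers_def by auto
  qed simp
  moreover have "complete_nbhd A adj v i j" if "N \<in> insert ?N NN" "i \<in> N \<inter> A" "j \<in> N \<inter> A" "i \<noteq> j" for N i j
    using that cov unfolding covers_def complete_nbhd_def by blast
  ultimately show ?thesis unfolding covers_def by blast
qed

text \<open>With no stars and no clique through \<open>v\<close>, all neighbours of \<open>v\<close>
  are in its own block, and so are the new edges.\<close>

lemma covers_complete_block:
  assumes cov: "covers A adj \<rho> NN {}" and v: "v \<in> A" and none: "\<And>N. N \<in> NN \<Longrightarrow> v \<notin> N"
  shows "covers A (complete_nbhd A adj v) \<rho> NN {}"
proof -
  have "\<rho> j = \<rho> v" if "j \<in> closed_nbhd A adj v" for j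
    using that cov v none unfolding covers_def closed_nbhd_def by fastforce
  then have "\<rho> i = \<rho> j" if "i \<in> closed_nbhd A adj v" "j \<in> closed_nbhd A adj v" for i j
    using that by simp
  then show ?thesis
    using cov unfolding covers_def complete_nbhd_def by blast
qed

text \<open>Within \<open>A\<close>, every clique through \<open>v\<close> is contained in the
  closed neighbourhood, so the one new clique replaces them all.\<close>

lemma covers_complete_clique:
  assumes cov: "covers A adj \<rho> NN {}" and v: "v \<in> A"
  shows "covers A (complete_nbhd A adj v) \<rho>
    (insert (closed_nbhd A adj v) (NN - {N \<in> NN. v \<in> N})) {}"
proof -
  let ?N = "closed_nbhd A adj v"
  let ?NN = "insert ?N (NN - {N \<in> NN. v \<in> N})"
  have sub: "j \<in> ?N" if "N \<in> NN" "v \<in> N" "j \<in> N" "j \<in> A" for N j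
    using covers_clique[OF cov that(1,2) v that(3,4)] that(4) by (auto simp: closed_nbhd_def)
  have "\<rho> i = \<rho> j \<or> (\<exists>N\<in>?NN. i \<in> N \<and> j \<in> N)"
    if ij: "i \<in> A" "j \<in> A" "complete_nbhd A adj v i j" for i j
  proof (cases "i \<in> ?N \<and> j \<in> ?N")
    case False
    then have adj: "adj i j" using ij unfolding complete_nbhd_def by blast
    consider "\<rho> i = \<rho> j" | N where "N \<in> NN" "i \<in> N" "j \<in> N"
      using covers_edge[OF cov ij(1,2) adj] by blast
    then show ?thesis
    proof cases
      case 2
      then have "v \<notin> N" using False sub ij by blast
      then show ?thesis using 2 by blast
    qed simp
  qed simp
  moreover have "complete_nbhd A adj v i j" if "N \<in> ?NN" "i \<in> N \<inter> A" "j \<in> N \<inter> A" "i \<noteq> j" for N i j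
    using that covers_clique[OF cov, of N i j] by (auto simp: complete_nbhd_def)
  ultimately show ?thesis by (simp add: covers_def)
qed

text \<open>The graph on \<open>V - U\<close> is a disjoint union of cliques, labelled through
  \<open>r\<close> by their least vertices. A component with an edge contains a vertex that does not
  represent its block, or else it meets a clique in \<open>NN\<close>; this bounds the number of
  such components.\<close>

lemma reg_le_transitive_graph:
  fixes adj :: "nat \<Rightarrow> nat \<Rightarrow> bool"
  assumes V: "finite V" and U: "U \<subseteq> V" and sym: "\<And>i j. adj i j \<Longrightarrow> adj j i" and NN: "finite NN"
    and cov: "covers (V - U) adj \<rho> NN {}"
    and trans: "\<And>v i j. v \<in> V - U \<Longrightarrow> i \<in> closed_nbhd (V - U) adj v \<Longrightarrow>
      j \<in> closed_nbhd (V - U) adj v \<Longrightarrow> i \<noteq> j \<Longrightarrow> adj i j"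
  shows "reg_le (edge_vars V) (graph_ideal V U adj :: (nat edge_var, 'k::field) mpoly set)
    (block_excess (V - U) \<rho> + card NN)"
proof -
  let ?A = "V - U"
  let ?X = "edge_vars V"
  have A: "finite ?A" using V by simp
  define r where "r i = Min (closed_nbhd ?A adj i)" for i
  have fin: "finite (closed_nbhd ?A adj i)" for i
    using V by (simp add: closed_nbhd_def)
  have r_mem: "r i \<in> closed_nbhd ?A adj i" for i
    unfolding r_def using fin[of i] by (intro Min_in) (auto simp: closed_nbhd_def)
  have r_A: "r i \<in> ?A" if "i \<in> ?A" for i
    using r_mem[of i] that by (auto simp: closed_nbhd_def)
  have mem_sym: "j \<in> closed_nbhd ?A adj i" if "i \<in> closed_nbhd ?A adj j" "j \<in> ?A" for i j
    using that sym by (auto simp: closed_nbhd_def)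
  have r_adj: "i = j \<or> adj i j" if ij: "i \<in> ?A" "j \<in> ?A" "r i = r j" for i j
    using trans[OF r_A[OF ij(1)], of i j] mem_sym[OF r_mem[of i] ij(1)] mem_sym[OF r_mem[of j] ij(2)] ij(3)
    by auto
  have adj_r: "r i = r j" if ij: "i \<in> ?A" "j \<in> ?A" "adj i j" for i j
  proof -
    have "closed_nbhd ?A adj i \<subseteq> closed_nbhd ?A adj j" if "i \<in> ?A" "j \<in> ?A" "adj i j" for i j
    proof
      fix k assume k: "k \<in> closed_nbhd ?A adj i"
      have "j \<in> closed_nbhd ?A adj i" using that by (simp add: closed_nbhd_def)
      then have "k = j \<or> adj j k" using trans[OF that(1) _ k, of j] by blast
      moreover have "k \<in> ?A" using k that by (auto simp: closed_nbhd_def)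
      ultimately show "k \<in> closed_nbhd ?A adj j" by (auto simp: closed_nbhd_def)
    qed
    then have "closed_nbhd ?A adj i = closed_nbhd ?A adj j" using ij sym by blast
    then show ?thesis by (simp add: r_def)
  qed
  have data: "clique_data V ?A (edge_vars U)"
    by standard (use V U in \<open>auto simp: edge_vars_def\<close>)
  have eq: "graph_ideal V U adj = (clique_ideal V ?A r (edge_vars U) :: (nat edge_var, 'k) mpoly set)"
  proof
    have "graph_gens V U adj \<subseteq> (clique_ideal V ?A r (edge_vars U) :: (nat edge_var, 'k) mpoly set)"
    proof (rule graph_gens_subsetI)
      fix i j assume ij: "i \<in> V" "j \<in> V" "adj i j"
      have var: "var w \<in> (clique_ideal V ?A r (edge_vars U) :: (nat edge_var, 'k) mpoly set)"
        if "w \<in> edge_vars U" for w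
        using that by (intro gen_ideal_base clique_gensI1)
      show "minor i j \<in> (clique_ideal V ?A r (edge_vars U) :: (nat edge_var, 'k) mpoly set)"
      proof (cases "i \<in> U \<or> j \<in> U")
        case True
        show ?thesis by (rule minor_memI[OF clique_data.ideal[OF data] ij(1,2)]) (use True var in auto)
      next
        case False
        then show ?thesis using ij adj_r by (intro gen_ideal_base clique_gensI2) auto
      qed
    qed (intro gen_ideal_base clique_gensI1)
    then show "graph_ideal V U adj \<subseteq> (clique_ideal V ?A r (edge_vars U) :: (nat edge_var, 'k) mpoly set)"
      by (rule gen_ideal_subset[OF clique_data.ideal[OF data]])
    have "clique_gens ?A r (edge_vars U) \<subseteq> (graph_ideal V U adj :: (nat edge_var, 'k) mpoly set)"
    proof (rule clique_gens_subsetI)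
      fix i j assume ij: "i \<in> ?A" "j \<in> ?A" "r i = r j"
      from r_adj[OF ij] show "minor i j \<in> (graph_ideal V U adj :: (nat edge_var, 'k) mpoly set)"
      proof
        assume "i = j"
        then show ?thesis using ideal_zero[OF graph_ideal[OF U]] by simp
      next
        assume "adj i j"
        then show ?thesis using ij by (intro gen_ideal_base graph_gensI2) auto
      qed
    qed (intro gen_ideal_base graph_gensI1)
    then show "(clique_ideal V ?A r (edge_vars U) :: (nat edge_var, 'k) mpoly set) \<subseteq> graph_ideal V U adj"
      by (rule gen_ideal_subset[OF graph_ideal[OF U]])
  qed
  define reps where "reps = inv_into ?A \<rho> ` \<rho> ` ?A"
  have reps: "reps \<subseteq> ?A"
    unfolding reps_def using inv_into_into[of _ \<rho> ?A] by blast
  have reps_inj: "inj_on \<rho> reps"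
    unfolding reps_def by (intro inj_on_inverseI[of _ "inv_into ?A \<rho>"]) (auto simp: f_inv_into_f)
  have "card (\<rho> ` ?A) = card reps"
    unfolding reps_def by (rule card_image[symmetric], rule inj_on_inv_into) simp
  then have card_rest: "card (?A - reps) = block_excess ?A \<rho>"
    using reps A unfolding block_excess_def by (simp add: card_Diff_subset finite_subset)
  \<comment> \<open>The component that \<open>N\<close> meets; the choice of the vertex does not
    matter, as \<open>N \<inter> ?A\<close> is complete.\<close>
  let ?h = "\<lambda>N. r (SOME i. i \<in> N \<inter> ?A)"
  have "multi_labels ?A r \<subseteq> r ` (?A - reps) \<union> ?h ` NN"
  proof
    fix c assume "c \<in> multi_labels ?A r"
    then obtain i j where ij: "i \<in> ?A" "j \<in> ?A" "i \<noteq> j" "r i = c" "r j = c"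
      unfolding multi_labels_def by blast
    then have "adj i j" using r_adj[OF ij(1,2)] by simp
    then consider "\<rho> i = \<rho> j" | N where "N \<in> NN" "i \<in> N"
      using covers_edge[OF cov ij(1,2)] by blast
    then show "c \<in> r ` (?A - reps) \<union> ?h ` NN"
    proof cases
      case 1
      then have "i \<notin> reps \<or> j \<notin> reps" using reps_inj ij by (auto dest: inj_onD)
      then have "i \<in> ?A - reps \<or> j \<in> ?A - reps" using ij(1,2) by simp
      then have "r i \<in> r ` (?A - reps) \<or> r j \<in> r ` (?A - reps)" by (elim disjE) simp_all
      then show ?thesis unfolding ij(4,5) by simp
    next
      case 2
      define k where "k = (SOME k. k \<in> N \<inter> ?A)"
      have k: "k \<in> N \<inter> ?A" unfolding k_def by (rule someI[of _ i]) (use 2 ij in auto)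
      then have "k = i \<or> adj k i" using covers_clique[OF cov 2(1), of k i] 2 ij by blast
      then have "r k = c" using adj_r[of k i] k ij by auto
      then show ?thesis using 2(1) unfolding k_def by (intro UnI2 image_eqI[of _ _ N]) simp_all
    qed
  qed
  then have "card (multi_labels ?A r) \<le> card (r ` (?A - reps) \<union> ?h ` NN)"
    using A NN by (intro card_mono) auto
  also have "\<dots> \<le> card (r ` (?A - reps)) + card (?h ` NN)" by (rule card_Un_le)
  also have "\<dots> \<le> card (?A - reps) + card NN"
    using A NN by (intro add_mono card_image_le) auto
  finally have "card (multi_labels ?A r) \<le> block_excess ?A \<rho> + card NN" by (simp only: card_rest)
  then show ?thesis
    unfolding eq by (rule reg_le_mono[OF reg_le_clique_ideal[OF data]])
qed

lemma finite_nonadjacent: "finite A \<Longrightarrow> finite {(i, j). i \<in> A \<and> j \<in> A \<and> \<not> adj i j}"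
  by (rule finite_subset[of _ "A \<times> A"]) auto

lemma complete_nbhd_nonadjacent:
  assumes "finite A"
  shows "card {(i, j). i \<in> A \<and> j \<in> A \<and> \<not> complete_nbhd A adj v i j} \<le>
    card {(i, j). i \<in> A \<and> j \<in> A \<and> \<not> adj i j}"
  by (rule card_mono[OF finite_nonadjacent[OF assms]]) (auto simp: complete_nbhd_def)

lemma card_nonadjacent_delete:
  assumes "finite A"
  shows "card {(i, j). i \<in> A - {v} \<and> j \<in> A - {v} \<and> \<not> adj i j} \<le>
    card {(i, j). i \<in> A \<and> j \<in> A \<and> \<not> adj i j}"
  by (rule card_mono[OF finite_nonadjacent[OF assms]]) auto

text \<open>Deleting \<open>v\<close> lowers the number of vertices, completing lowers the number of
  nonadjacent pairs. At the centre of a star completion may add no edge, but then \<open>v\<close>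
  leaves \<open>S\<close>; hence \<open>card S\<close> is part of the measure.\<close>

theorem reg_le_graph_ideal:
  fixes adj :: "nat \<Rightarrow> nat \<Rightarrow> bool"
  assumes V: "finite V" and "U \<subseteq> V" "\<And>i j. adj i j \<Longrightarrow> adj j i" "finite NN" "S \<subseteq> V - U"
    "covers (V - U) adj \<rho> NN S"
  shows "reg_le (edge_vars V) (graph_ideal V U adj :: (nat edge_var, 'k::field) mpoly set)
    (block_excess (V - U) \<rho> + card NN + 2 * card S)"
  using assms(2-)
proof (induction "card (V - U) + card {(i, j). i \<in> V - U \<and> j \<in> V - U \<and> \<not> adj i j} + card S"
    arbitrary: U adj NN S rule: less_induct)
  case less
  note U = less.prems(1) and sym = less.prems(2) and NN = less.prems(3) and S = less.prems(4)
    and cov = less.prems(5)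
  let ?A = "V - U"
  let ?miss = "\<lambda>A adj. card {(i, j). i \<in> A \<and> j \<in> A \<and> \<not> adj i j}"
  have A: "finite ?A" using V by simp
  have S_fin: "finite S" using S A finite_subset by blast
  \<comment> \<open>One Mayer-Vietoris step at \<open>v\<close>: \<open>1\<close> is for the
    completed graph, \<open>2\<close> for the graph without \<open>v\<close>, and \<open>3\<close>
    for the completed graph without \<open>v\<close>, which has to stay below the target by
    one.\<close>
  have step: "reg_le (edge_vars V) (graph_ideal V U adj :: (nat edge_var, 'k) mpoly set) (Suc b)"
    if v: "v \<in> ?A"
      and smaller: "?miss ?A (complete_nbhd ?A adj v) + card S' < ?miss ?A adj + card S"
      and 1: "finite NN1" "S' \<subseteq> S - {v}" "covers ?A (complete_nbhd ?A adj v) \<rho> NN1 S'"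
        "block_excess ?A \<rho> + card NN1 + 2 * card S' \<le> Suc b"
      and 2: "block_excess (?A - {v}) \<rho> + card NN + 2 * card (S - {v}) \<le> Suc b"
      and 3: "block_excess (?A - {v}) \<rho> + card NN1 + 2 * card S' \<le> b"
    for v S' NN1 b
  proof (rule reg_le_graph_ideal_step[OF V U _ _ sym])
    let ?adj = "complete_nbhd ?A adj v"
    have Av: "V - insert v U = ?A - {v}" by blast
    have sym': "\<And>i j. ?adj i j \<Longrightarrow> ?adj j i" using complete_nbhd_sym[of adj] sym by blast
    have insert_vertex_subset: "insert v U \<subseteq> V" using v U by blast
    have card_A: "card (?A - {v}) < card ?A" using v A by (metis card_Diff1_less)
    have S': "S' - {v} = S'" using 1 by blast
    have card_S: "card S' \<le> card S" "card (S - {v}) \<le> card S"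
      using 1 S_fin by (auto intro!: card_mono)
    show "v \<in> V" "v \<notin> U" using v by auto
    have "reg_le (edge_vars V) (graph_ideal V U ?adj :: (nat edge_var, 'k) mpoly set)
        (block_excess ?A \<rho> + card NN1 + 2 * card S')"
      by (rule less.hyps[OF _ U sym' 1(1) _ 1(3)]) (use smaller 1 S in auto)
    then show "reg_le (edge_vars V) (graph_ideal V U ?adj :: (nat edge_var, 'k) mpoly set) (Suc b)"
      using 1(4) by (rule reg_le_mono)
    have "reg_le (edge_vars V) (graph_ideal V (insert v U) adj :: (nat edge_var, 'k) mpoly set)
        (block_excess (?A - {v}) \<rho> + card NN + 2 * card (S - {v}))"
      unfolding Av[symmetric]
    proof (rule less.hyps[OF _ insert_vertex_subset sym NN])
      show "covers (V - insert v U) adj \<rho> NN (S - {v})"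
        unfolding Av by (rule covers_delete[OF cov])
      show "card (V - insert v U) + ?miss (V - insert v U) adj + card (S - {v}) <
          card ?A + ?miss ?A adj + card S"
        unfolding Av using card_A card_nonadjacent_delete[OF A, of v adj] card_S by linarith
    qed (use S in auto)
    then show "reg_le (edge_vars V) (graph_ideal V (insert v U) adj :: (nat edge_var, 'k) mpoly set) (Suc b)"
      using 2 by (rule reg_le_mono)
    have "reg_le (edge_vars V) (graph_ideal V (insert v U) ?adj :: (nat edge_var, 'k) mpoly set)
        (block_excess (?A - {v}) \<rho> + card NN1 + 2 * card S')"
      unfolding Av[symmetric]
    proof (rule less.hyps[OF _ insert_vertex_subset sym' 1(1)])
      show "covers (V - insert v U) ?adj \<rho> NN1 S'"
        unfolding Av using covers_delete[OF 1(3), of v] by (simp only: S')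
      show "card (V - insert v U) + ?miss (V - insert v U) ?adj + card S' <
          card ?A + ?miss ?A adj + card S"
        unfolding Av using card_A card_nonadjacent_delete[OF A, of v ?adj]
          complete_nbhd_nonadjacent[OF A, of adj v] card_S by linarith
    qed (use 1 S in auto)
    then show "reg_le (edge_vars V) (graph_ideal V (insert v U) ?adj :: (nat edge_var, 'k) mpoly set) b"
      using 3 by (rule reg_le_mono)
  qed
  show ?case
  proof (cases "S = {}")
    case False
    then obtain v where v: "v \<in> S" by blast
    then have vA: "v \<in> ?A" using S by blast
    let ?N = "closed_nbhd ?A adj v"
    have card_S: "card S = Suc (card (S - {v}))" using card.remove[OF S_fin v] .
    have card_N: "card (insert ?N NN) \<le> Suc (card NN)"
      using card_insert_le_m1[of "Suc (card NN)" NN ?N] by simp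
    \<comment> \<open>The star at \<open>v\<close> costs \<open>2\<close>: completion replaces it by
      a clique of cost \<open>1\<close>, and the Mayer-Vietoris step consumes the other
      \<open>1\<close>.\<close>
    have "reg_le (edge_vars V) (graph_ideal V U adj :: (nat edge_var, 'k) mpoly set)
        (Suc (block_excess ?A \<rho> + card NN + 2 * card (S - {v}) + 1))"
    proof (rule step[OF vA _ _ subset_refl covers_complete_star[OF cov vA sym]])
      show "?miss ?A (complete_nbhd ?A adj v) + card (S - {v}) < ?miss ?A adj + card S"
        using complete_nbhd_nonadjacent[OF A, of adj v] card_S by linarith
    qed (use NN card_N block_excess_delete[OF A vA, of \<rho>] in auto)
    then show ?thesis by (simp add: card_S)
  next
    case True
    have cov0: "covers ?A adj \<rho> NN {}" using cov True by simp
    show ?thesis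
    proof (cases "\<exists>v\<in>?A. \<exists>i\<in>closed_nbhd ?A adj v. \<exists>j\<in>closed_nbhd ?A adj v. i \<noteq> j \<and> \<not> adj i j")
      case False
      have "reg_le (edge_vars V) (graph_ideal V U adj :: (nat edge_var, 'k) mpoly set)
          (block_excess ?A \<rho> + card NN)"
        by (rule reg_le_transitive_graph[OF V U sym NN cov0]) (use False in blast)+
      then show ?thesis using True by simp
    next
      case True': True
      then obtain v i j where v: "v \<in> ?A" and ij: "i \<in> closed_nbhd ?A adj v"
        "j \<in> closed_nbhd ?A adj v" "i \<noteq> j" "\<not> adj i j" by blast
      have ijA: "i \<in> ?A" "j \<in> ?A" using ij v by (auto simp: closed_nbhd_def)
      have iv: "i \<noteq> v" "j \<noteq> v" using ij sym by (auto simp: closed_nbhd_def)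
      have "?miss ?A (complete_nbhd ?A adj v) < ?miss ?A adj"
      proof (rule psubset_card_mono)
        show "finite {(i, j). i \<in> ?A \<and> j \<in> ?A \<and> \<not> adj i j}"
          by (rule finite_nonadjacent[OF A])
        have "(i, j) \<in> {(i, j). i \<in> ?A \<and> j \<in> ?A \<and> \<not> adj i j}" using ij ijA by simp
        moreover have "(i, j) \<notin> {(i, j). i \<in> ?A \<and> j \<in> ?A \<and> \<not> complete_nbhd ?A adj v i j}"
          using ij by (simp add: complete_nbhd_def)
        moreover have "{(i, j). i \<in> ?A \<and> j \<in> ?A \<and> \<not> complete_nbhd ?A adj v i j} \<subseteq>
            {(i, j). i \<in> ?A \<and> j \<in> ?A \<and> \<not> adj i j}"
          by (auto simp: complete_nbhd_def)
        ultimately show "{(i, j). i \<in> ?A \<and> j \<in> ?A \<and> \<not> complete_nbhd ?A adj v i j} \<subset>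
            {(i, j). i \<in> ?A \<and> j \<in> ?A \<and> \<not> adj i j}" by blast
      qed
      then have smaller: "?miss ?A (complete_nbhd ?A adj v) + card ({} :: nat set) < ?miss ?A adj + card S"
        using True by simp
      let ?NNv = "{N \<in> NN. v \<in> N}"
      \<comment> \<open>Without stars, the saving of \<open>1\<close> after deletion must come from
        the blocks or from the number of cliques.\<close>
      have finish: ?thesis
        if NN1: "finite NN1" "covers ?A (complete_nbhd ?A adj v) \<rho> NN1 {}" "card NN1 \<le> card NN"
          and less: "block_excess (?A - {v}) \<rho> + card NN1 < block_excess ?A \<rho> + card NN" for NN1
      proof -
        obtain b where b: "block_excess ?A \<rho> + card NN = Suc b"
          using less by (cases "block_excess ?A \<rho> + card NN") simp_all
        have "reg_le (edge_vars V) (graph_ideal V U adj :: (nat edge_var, 'k) mpoly set) (Suc b)"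
          by (rule step[OF v smaller NN1(1) _ NN1(2)])
             (use True b NN1(3) less block_excess_delete[OF A v, of \<rho>] in auto)
        then show ?thesis using True b by simp
      qed
      have nbr: "\<rho> k = \<rho> v \<or> (\<exists>N\<in>NN. v \<in> N \<and> k \<in> N)"
        if "k \<in> closed_nbhd ?A adj v" "k \<noteq> v" for k
      proof -
        have "k \<in> ?A" "adj v k" using that by (simp_all add: closed_nbhd_def)
        from covers_edge[OF cov0 v this] show ?thesis by (elim disjE) simp_all
      qed
      show ?thesis
      proof (cases "?NNv = {}")
        case True
        then have none: "\<And>N. N \<in> NN \<Longrightarrow> v \<notin> N" by blast
        then have "\<rho> i = \<rho> v" using nbr[OF ij(1) iv(1)] by blast
        from block_excess_delete_less[OF A v ijA(1) iv(1) this] show ?thesis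
          by (intro finish[OF NN covers_complete_block[OF cov0 v none]]) auto
      next
        case False
        have "card NN = card ?NNv + card (NN - ?NNv)"
          using card_Diff_subset[of ?NNv NN] card_mono[of NN ?NNv] NN by auto
        moreover have "card ?NNv \<ge> 1" using False NN by (simp add: Suc_le_eq card_gt_0_iff)
        moreover have "card (insert (closed_nbhd ?A adj v) (NN - ?NNv)) \<le> Suc (card (NN - ?NNv))"
          using card_insert_le_m1[of "Suc (card (NN - ?NNv))" "NN - ?NNv"] by simp
        \<comment> \<open>Otherwise \<open>i\<close> and \<open>j\<close> would both lie in the only
          clique through \<open>v\<close> and be adjacent. So either the excess drops, or at least
          two cliques through \<open>v\<close> merge into one.\<close>
        moreover have "block_excess (?A - {v}) \<rho> < block_excess ?A \<rho> \<or> card ?NNv \<ge> 2"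
        proof (rule ccontr)
          assume *: "\<not> ?thesis"
          then have "\<rho> i \<noteq> \<rho> v" "\<rho> j \<noteq> \<rho> v"
            using block_excess_delete_less[OF A v] ijA iv by blast+
          then obtain N N' where N: "N \<in> ?NNv" "i \<in> N" "N' \<in> ?NNv" "j \<in> N'"
            using nbr[OF ij(1) iv(1)] nbr[OF ij(2) iv(2)] by blast
          have "card ?NNv = 1" using * \<open>card ?NNv \<ge> 1\<close> by linarith
          then have "N = N'" using N by (metis card_1_singletonE singletonD)
          then show False using covers_clique[OF cov0, of N i j] N ij ijA by blast
        qed
        ultimately show ?thesis
          using block_excess_delete[OF A v, of \<rho>] NN
          by (intro finish[OF _ covers_complete_clique[OF cov0 v]]) auto
      qed
    qed
  qed
qed

section \<open>Chains of prime ideals\<close>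

definition prime_chain :: "('a, 'b) ring_scheme \<Rightarrow> 'a set \<Rightarrow> nat \<Rightarrow> bool" where
  "prime_chain R P l \<longleftrightarrow> (\<exists>C. (\<forall>i\<le>l. primeideal (C i) R) \<and> (\<forall>i<l. C i \<subset> C (Suc i)) \<and> C l = P)"

lemma prime_height_ge: "prime_chain R P l \<Longrightarrow> enat l \<le> prime_height R P"
  unfolding prime_height_def prime_chain_def by (rule Sup_upper) blast

lemma prime_chain_0: "primeideal P R \<Longrightarrow> prime_chain R P 0"
  unfolding prime_chain_def by (intro exI[of _ "\<lambda>_. P"]) simp

lemma prime_chain_Suc:
  assumes "prime_chain R Q l" "primeideal P R" "Q \<subset> P"
  shows "prime_chain R P (Suc l)"
proof -
  obtain C where C: "\<forall>i\<le>l. primeideal (C i) R" "\<forall>i<l. C i \<subset> C (Suc i)" "C l = Q"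
    using assms(1) unfolding prime_chain_def by blast
  let ?C = "C(Suc l := P)"
  have "primeideal (?C i) R" if "i \<le> Suc l" for i
    using that C(1) assms(2) by (cases "i = Suc l") simp_all
  moreover have "?C i \<subset> ?C (Suc i)" if "i < Suc l" for i
    using that C(2,3) assms(3) by (cases "i = l") simp_all
  ultimately show ?thesis unfolding prime_chain_def by (intro exI[of _ ?C]) simp
qed

text \<open>Only the top of the chain is replaced by \<open>P\<close>, which keeps the last
  inclusion strict.\<close>

lemma prime_chain_mono:
  assumes "prime_chain R Q l" "primeideal P R" "Q \<subseteq> P"
  shows "prime_chain R P l"
proof (cases l)
  case 0
  then show ?thesis using prime_chain_0[OF assms(2)] by simp
next
  case (Suc l')
  obtain C where C: "\<forall>i\<le>l. primeideal (C i) R" "\<forall>i<l. C i \<subset> C (Suc i)" "C l = Q"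
    using assms(1) unfolding prime_chain_def by blast
  then have "prime_chain R (C l') l'"
    using Suc unfolding prime_chain_def by (intro exI[of _ C]) simp
  moreover have "C l' \<subset> P"
    using C(2,3) Suc assms(3) by (metis lessI psubset_subset_trans)
  ultimately show ?thesis using prime_chain_Suc[OF _ assms(2)] Suc by blast
qed

lemma not_inj_on_block_excess:
  assumes "finite A" "0 < block_excess A r"
  obtains i j where "i \<in> A" "j \<in> A" "i \<noteq> j" "r i = r j"
proof -
  have "\<not> inj_on r A" using assms(2) card_image[of r A] by (auto simp: block_excess_def)
  then show ?thesis using that unfolding inj_on_def by blast
qed

text \<open>The chain descends from the ideal itself: while some clique has two vertices, one of
  them is split off; afterwards the variables in \<open>W\<close> are given back one by one. All
  ideals on the way are prime, and each step lowers \<open>block_excess A r + card W\<close> by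
  exactly \<open>1\<close>.\<close>

lemma prime_chain_clique_ideal:
  fixes r :: "nat \<Rightarrow> nat"
  assumes "clique_data V A W"
  shows "prime_chain (poly_ring (edge_vars V)) (clique_ideal V A r W :: (nat edge_var, 'k::field) mpoly set)
    (block_excess A r + card W)"
  using assms
proof (induction "block_excess A r + card W" arbitrary: A r W)
  case 0
  then show ?case using prime_chain_0[OF clique_data.primeideal[OF 0(2)]] by simp
next
  case (Suc l)
  interpret clique_data V A W by (rule Suc.prems)
  have A_fin: "finite A" using V A finite_subset by blast
  have W_fin: "finite W" using V W finite_subset[OF W] by simp
  let ?I = "clique_ideal V A r W :: (nat edge_var, 'k) mpoly set"
  have extend: ?case
    if data: "clique_data V A' W'" and l: "l = block_excess A' r' + card W'"
      and sub: "clique_gens A' r' W' \<subseteq> ?I" and p: "p \<in> ?I" "p \<notin> clique_ideal V A' r' W'"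
    for A' W' p and r' :: "nat \<Rightarrow> nat"
  proof -
    have chain: "prime_chain (poly_ring (edge_vars V))
        (clique_ideal V A' r' W' :: (nat edge_var, 'k) mpoly set) l"
      using Suc.hyps(1)[OF l data] l by simp
    have "clique_ideal V A' r' W' \<subseteq> ?I" by (rule gen_ideal_subset[OF ideal sub])
    then have "clique_ideal V A' r' W' \<subset> ?I" using p by blast
    from prime_chain_Suc[OF chain primeideal this] show ?thesis
      using Suc.hyps(2) by simp
  qed
  show ?case
  proof (cases "0 < block_excess A r")
    case True
    obtain i j where ij: "i \<in> A" "j \<in> A" "i \<noteq> j" "r i = r j"
      by (rule not_inj_on_block_excess[OF A_fin True])
    \<comment> \<open>A fresh label for \<open>i\<close> alone. The old label survives at
      \<open>j\<close>, so the number of labels grows by \<open>1\<close>.\<close>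
    obtain c where c: "c \<notin> r ` A"
      using A_fin by (meson ex_new_if_finite finite_imageI infinite_UNIV_nat)
    define r' where "r' = r(i := c)"
    have "r' ` A = insert c (r ` (A - {i}))" using ij by (auto simp: r'_def)
    also have "r ` (A - {i}) = r ` A" using ij by (auto simp: image_iff)
    finally have image: "card (r' ` A) = Suc (card (r ` A))" using c A_fin by simp
    show ?thesis
    proof (rule extend[OF clique_data_axioms])
      have "card (r' ` A) \<le> card A" using A_fin by (rule card_image_le)
      then show "l = block_excess A r' + card W"
        using Suc.hyps(2) image unfolding block_excess_def by linarith
      show "clique_gens A r' W \<subseteq> ?I"
      proof (rule clique_gens_subsetI)
        fix a b assume ab: "a \<in> A" "b \<in> A" "r' a = r' b"
        show "minor a b \<in> ?I"
        proof (cases "a = b")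
          case True
          then show ?thesis using ideal_zero[OF ideal] by simp
        next
          case False
          have "r a \<noteq> c" "r b \<noteq> c" using c ab by auto
          then have "r a = r b" using ab False by (auto simp: r'_def split: if_splits)
          then show ?thesis using ab by (intro gen_ideal_base clique_gensI2)
        qed
      qed (intro gen_ideal_base clique_gensI1)
      show "minor i j \<in> ?I" using ij by (intro gen_ideal_base clique_gensI2)
      have "r j \<noteq> c" using c ij by auto
      then show "minor i j \<notin> (clique_ideal V A r' W :: (nat edge_var, 'k) mpoly set)"
        using ij by (intro minor_not_mem) (auto simp: r'_def)
    qed
  next
    case False
    then have "W \<noteq> {}" using Suc.hyps(2) by auto
    then obtain w where w: "w \<in> W" by blast
    then obtain i where i: "i \<in> V" "w = XVar i \<or> w = YVar i" using W by (auto simp: edge_vars_def)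
    have iA: "i \<notin> A" using w i A_W by auto
    define W' where "W' = W - {w}"
    \<comment> \<open>A vertex with both variables free again has to return to \<open>A\<close>. The
      labels \<open>id\<close> make all cliques singletons, which they already are on
      \<open>A\<close> because the excess of \<open>r\<close> is \<open>0\<close>.\<close>
    define A' where "A' = (if XVar i \<in> W' \<or> YVar i \<in> W' then A else insert i A)"
    have data: "clique_data V A' W'"
    proof
      show "W' \<inter> edge_vars A' = {}"
        using A_W by (auto simp: A'_def W'_def edge_vars_def)
      show "XVar a \<in> W' \<or> YVar a \<in> W'" if "a \<in> V" "a \<notin> A'" for a
        using that half[of a] i by (auto simp: A'_def W'_def split: if_splits)
    qed (use V A W i in \<open>auto simp: A'_def W'_def\<close>)
    show ?thesis
    proof (rule extend[OF data, of id])
      have "card W = Suc (card W')" using card.remove[OF W_fin w] by (simp add: W'_def)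
      then show "l = block_excess A' id + card W'"
        using Suc.hyps(2) False by (simp add: block_excess_def)
      show "clique_gens A' id W' \<subseteq> ?I"
      proof (rule clique_gens_subsetI)
        fix a b :: nat assume "id a = id b"
        then show "minor a b \<in> ?I" using ideal_zero[OF ideal] by simp
      qed (auto simp: W'_def intro: gen_ideal_base clique_gensI1)
      show "var w \<in> ?I" using w by (intro gen_ideal_base clique_gensI1)
      show "var w \<notin> (clique_ideal V A' id W' :: (nat edge_var, 'k) mpoly set)"
        by (rule clique_data.var_not_mem[OF data]) (use w W in \<open>auto simp: W'_def\<close>)
    qed
  qed
qed

section \<open>Comparing regularity and height\<close>

lemma primeideal_mult:
  "primeideal P (poly_ring X) \<Longrightarrow> p \<in> polys X \<Longrightarrow> q \<in> polys X \<Longrightarrow> p * q \<in> P \<Longrightarrow> p \<in> P \<or> q \<in> P"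
  using primeideal.I_prime[of P "poly_ring X" p q] by simp

text \<open>By Pluecker relations \<open>P\<close> contains the products of \<open>minor i k\<close>
  with \<open>x\<^sub>j\<close> and with \<open>y\<^sub>j\<close>, and one of these variables is
  outside \<open>P\<close>. This makes the blocks below the classes of an equivalence
  relation.\<close>

lemma minor_trans:
  assumes P: "primeideal P (poly_ring (edge_vars V) :: ('v edge_var, 'k::field) mpoly ring)"
    and V: "i \<in> V" "j \<in> V" "k \<in> V" and mem: "minor i j \<in> P" "minor j k \<in> P"
    and j: "\<not> (var (XVar j) \<in> P \<and> var (YVar j) \<in> P)"
  shows "minor i k \<in> P"
proof -
  have I: "ideal P (poly_ring (edge_vars V))" using P by (rule primeideal.axioms)
  have comb: "p * minor j k + q * minor i j \<in> P"
    if "p \<in> polys (edge_vars V)" "q \<in> polys (edge_vars V)" for p q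
    using that mem by (intro ideal_add[OF I] ideal_mult[OF I])
  have "var (XVar i) * minor j k + var (XVar k) * minor i j \<in> P"
    by (rule comb; rule polys_var) (use V in simp_all)
  moreover have "var (XVar j) * minor i k =
      (var (XVar i) * minor j k + var (XVar k) * minor i j :: ('v edge_var, 'k) mpoly)"
    by (simp add: minor_def algebra_simps)
  ultimately have x: "var (XVar j) * minor i k \<in> P" by simp
  have "var (YVar i) * minor j k + var (YVar k) * minor i j \<in> P"
    by (rule comb; rule polys_var) (use V in simp_all)
  moreover have "var (YVar j) * minor i k =
      (var (YVar i) * minor j k + var (YVar k) * minor i j :: ('v edge_var, 'k) mpoly)"
    by (simp add: minor_def algebra_simps)
  ultimately have y: "var (YVar j) * minor i k \<in> P" by simp
  have polys: "var (XVar j) \<in> (polys (edge_vars V) :: ('v edge_var, 'k) mpoly set)"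
    "var (YVar j) \<in> (polys (edge_vars V) :: ('v edge_var, 'k) mpoly set)"
    "minor i k \<in> (polys (edge_vars V) :: ('v edge_var, 'k) mpoly set)"
    using V by (simp_all add: polys_var minor_polys)
  show ?thesis
    using primeideal_mult[OF P polys(1,3) x] primeideal_mult[OF P polys(2,3) y] j by blast
qed

lemma reg_le_prime_height:
  fixes adj :: "nat \<Rightarrow> nat \<Rightarrow> bool" and P :: "(nat edge_var, 'k::field) mpoly set"
  assumes V: "finite V" and sym: "\<And>i j. adj i j \<Longrightarrow> adj j i"
    and P: "primeideal P (poly_ring (edge_vars V))" and sub: "graph_ideal V {} adj \<subseteq> P"
  obtains b where "reg_le (edge_vars V) (graph_ideal V {} adj :: (nat edge_var, 'k) mpoly set) b"
    "enat b \<le> prime_height (poly_ring (edge_vars V)) P"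
proof -
  have I: "ideal P (poly_ring (edge_vars V))" using P by (rule primeideal.axioms)
  define S where "S = {v \<in> V. var (XVar v) \<in> P \<and> var (YVar v) \<in> P}"
  define A where "A = V - S"
  define cls where "cls i = {j \<in> A. minor i j \<in> P}" for i
  \<comment> \<open>Each vertex in \<open>S\<close> is a block of its own; its edges are covered by
    its star.\<close>
  define \<rho> where "\<rho> i = (if i \<in> A then Min (cls i) else i)" for i
  have A: "A \<subseteq> V" "finite A" and S: "S \<subseteq> V" "finite S" using V by (auto simp: A_def S_def)
  have minor_sym: "minor j i \<in> P" if "minor i j \<in> P" for i j
    using ideal_uminus[OF I that] minor_swap[of j i] by (metis minor_swap)
  have trans: "minor i k \<in> P" if "i \<in> A" "j \<in> A" "k \<in> A" "minor i j \<in> P" "minor j k \<in> P" for i j k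
    by (rule minor_trans[OF P _ _ _ that(4,5)]) (use that A in \<open>auto simp: A_def S_def\<close>)
  have Min_cls: "Min (cls i) \<in> cls i" if "i \<in> A" for i
  proof (rule Min_in)
    show "finite (cls i)" using A by (simp add: cls_def)
    have "i \<in> cls i" using that ideal_zero[OF I] by (simp add: cls_def)
    then show "cls i \<noteq> {}" by blast
  qed
  have \<rho>_mem: "\<rho> i \<in> A" "minor i (\<rho> i) \<in> P" if "i \<in> A" for i
    using Min_cls[OF that] that by (simp_all add: \<rho>_def cls_def)
  have \<rho>_minor: "minor i j \<in> P" if "i \<in> A" "j \<in> A" "\<rho> i = \<rho> j" for i j
    using trans[of i "\<rho> i" j] \<rho>_mem[of i] \<rho>_mem[of j] minor_sym that by metis
  have minor_\<rho>: "\<rho> i = \<rho> j" if ij: "i \<in> A" "j \<in> A" "minor i j \<in> P" for i j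
  proof -
    have "cls i \<subseteq> cls j" if "i \<in> A" "j \<in> A" "minor i j \<in> P" for i j
      using trans[OF that(2,1) _ minor_sym[OF that(3)]] by (auto simp: cls_def)
    then have "cls i = cls j" using ij minor_sym by blast
    then show ?thesis using ij by (simp add: \<rho>_def)
  qed
  have data: "clique_data V A (edge_vars S)"
    by standard (use V A S in \<open>auto simp: A_def edge_vars_def\<close>)
  have "clique_gens A \<rho> (edge_vars S) \<subseteq> P"
    by (rule clique_gens_subsetI) (use \<rho>_minor in \<open>auto simp: edge_vars_def S_def\<close>)
  then have "clique_ideal V A \<rho> (edge_vars S) \<subseteq> P" by (rule gen_ideal_subset[OF I])
  then have chain: "prime_chain (poly_ring (edge_vars V)) P (block_excess A \<rho> + card (edge_vars S))"
    by (rule prime_chain_mono[OF prime_chain_clique_ideal[OF data] P])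
  \<comment> \<open>In the height, the cost \<open>2\<close> of a star is matched by the two
    variables of its centre.\<close>
  have "card (edge_vars S) = 2 * card S"
  proof -
    have "card (edge_vars S) = card (XVar ` S) + card (YVar ` S)"
      unfolding edge_vars_def using S by (intro card_Un_disjoint) auto
    then show ?thesis by (simp add: card_image inj_on_def)
  qed
  moreover have "block_excess V \<rho> = block_excess A \<rho>"
  proof -
    have "\<rho> ` V = \<rho> ` A \<union> S" using S(1) by (auto simp: \<rho>_def A_def image_iff)
    moreover have "\<rho> ` A \<inter> S = {}" using \<rho>_mem(1) by (auto simp: A_def)
    ultimately have "card (\<rho> ` V) = card (\<rho> ` A) + card S"
      using A S by (simp add: card_Un_disjoint)
    moreover have "card V = card A + card S"
      using card_Diff_subset[OF S(2,1)] card_mono[OF V S(1)] by (simp add: A_def)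
    ultimately show ?thesis by (simp add: block_excess_def)
  qed
  moreover have "reg_le (edge_vars V) (graph_ideal V {} adj :: (nat edge_var, 'k) mpoly set)
      (block_excess (V - {}) \<rho> + card ({} :: nat set set) + 2 * card S)"
  proof (rule reg_le_graph_ideal[OF V _ sym])
    have "\<rho> i = \<rho> j" if "i \<in> A" "j \<in> A" "adj i j" for i j
    proof (rule minor_\<rho>[OF that(1,2)])
      have "minor i j \<in> (graph_ideal V {} adj :: (nat edge_var, 'k) mpoly set)"
        using that A by (intro gen_ideal_base graph_gensI2) auto
      then show "minor i j \<in> P" using sub by blast
    qed
    then show "covers (V - {}) adj \<rho> {} S"
      unfolding covers_def by (auto simp: A_def)
  qed (use S in auto)
  ultimately have "reg_le (edge_vars V) (graph_ideal V {} adj :: (nat edge_var, 'k) mpoly set)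
      (block_excess A \<rho> + card (edge_vars S))" by simp
  then show ?thesis using prime_height_ge[OF chain] by (rule that)
qed

lemma binomial_edge_ideal_eq_graph_ideal:
  assumes "simple_graph V E"
  shows "binomial_edge_ideal V E =
    (graph_ideal V {} (\<lambda>i j. {i, j} \<in> E) :: ('v edge_var, 'k::field) mpoly set)"
proof -
  have "i \<in> V \<and> j \<in> V" if "{i, j} \<in> E" for i j
    using assms that unfolding simple_graph_def by blast
  then have "{var (XVar i) * var (YVar j) - var (XVar j) * var (YVar i) | i j. {i, j} \<in> E} =
      (graph_gens V {} (\<lambda>i j. {i, j} \<in> E) :: ('v edge_var, 'k) mpoly set)"
    unfolding graph_gens_def minor_def edge_vars_def by blast
  then show ?thesis by (simp only: binomial_edge_ideal_def)
qed

theorem theorem1p5: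
  fixes n :: nat and E :: "nat set set"
    and R :: "(nat edge_var, 'k::field) mpoly ring"
    and J :: "(nat edge_var, 'k) mpoly set"
  assumes "simple_graph {1..n} E"
    and R_def: "R = poly_ring (edge_vars {1..n})"
    and J_def: "J = binomial_edge_ideal {1..n} E"
  shows "regularity (edge_vars {1..n}) (quotient_module R J) (quotient_grading (edge_vars {1..n}) J)
           \<le> ereal_of_enat (ideal_height R J)"
  unfolding regularity_def
proof (rule Sup_least)
  let ?V = "{1..n}"
  let ?X = "edge_vars ?V"
  let ?adj = "\<lambda>i j. {i, j} \<in> E"
  fix x
  assume "x \<in> {ereal (real_of_int (deg i k - int i)) | r deg g A i k.
    minimal_graded_free_resolution ?X (quotient_module R J) (quotient_grading ?X J) r deg g A \<and> k < r i}"
  then obtain r deg g A i k where x: "x = ereal (real_of_int (deg i k - int i))"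
    and res: "minimal_graded_free_resolution ?X (quotient_module (poly_ring ?X) J) (quotient_grading ?X J) r deg g A"
    and k: "k < r i"
    unfolding R_def by blast
  have J: "J = graph_ideal ?V {} ?adj"
    unfolding J_def by (rule binomial_edge_ideal_eq_graph_ideal[OF assms(1)])
  have hom: "homogeneous_ideal ?X J" unfolding J by (rule homogeneous_graph_ideal) simp
  \<comment> \<open>The height is an infimum over primes, so each prime above \<open>J\<close> is
    treated separately. \<open>nat\<close> raises negative values to \<open>0\<close>, which is
    harmless because the bound \<open>b\<close> is a natural number.\<close>
  have "enat (nat (deg i k - int i)) \<le> prime_height R P" if P: "primeideal P R" "J \<subseteq> P" for P
  proof -
    have sub: "graph_ideal ?V {} ?adj \<subseteq> P" using P(2) unfolding J .
    have sym: "?adj b a" if "?adj a b" for a b using that by (simp add: insert_commute)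
    obtain b where b: "reg_le ?X J b" "enat b \<le> prime_height R P"
      using reg_le_prime_height[OF _ sym P(1)[unfolded R_def] sub] unfolding J R_def by blast
    have "deg i k - int i \<le> int b"
      by (rule minimal_resolution_degree_le[OF _ hom b(1) res k]) simp
    then have "enat (nat (deg i k - int i)) \<le> enat b" by simp
    then show ?thesis using b(2) by (rule order_trans)
  qed
  then have "enat (nat (deg i k - int i)) \<le> ideal_height R J"
    unfolding ideal_height_def by (intro Inf_greatest) blast
  then have "ereal_of_enat (enat (nat (deg i k - int i))) \<le> ereal_of_enat (ideal_height R J)"
    by (simp only: ereal_of_enat_le_iff)
  moreover have "x \<le> ereal_of_enat (enat (nat (deg i k - int i)))"
    unfolding x by simp
  ultimately show "x \<le> ereal_of_enat (ideal_height R J)" by (rule order_trans[rotated])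
qed

end
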